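(* Let $P$ be the Metropolis-Hastings transition kernel on $\mathbb{R}^d$ with target density $\pi$ and proposal density $q$, let $\Phi$ be the Markov chain driven by $P$, and assume that $P$ satisfies assumptions A1, A2, A3 (stated in the context) with drift function $V$. Let $F\in L^\infty_V$ be continuous $\pi$-almost everywhere, and let $(\mathbb{X}_n)_{n\in\mathbb{N}}$, with partitions $\{J^n_0,\dots,J^n_{m_n}\}$ and representatives $a^n_j\in J^n_j$, be a sequence of allotments exhaustive with respect to $V$. For each $n$ let $\tilde F_n$ be the output of the Scheme with input $P$, $F$, $\mathbb{X}_n$, let $\delta_n=\delta(\mathbb{X}_n,V)$ be the $V$-mesh, let $a^n(x)=\sum_{j=0}^{m_n}a^n_j1_{J^n_j}(x)$, and let $Z_n(x,y)=\big|\alpha(a^n(x),y)q(a^n(x),y)-\alpha(x,y)q(x,y)\big|$ for $x,y\in\mathbb{R}^d$. Assume that $$\limsup_{n\to\infty}\delta_n^{-2}\int_{\mathbb{R}^d\setminus J^n_0}\Big(\int_{\mathbb{R}^d}\big(V(x)+V(y)\big)Z_n(x,y)\,dy\Big)^2\pi(x)\,dx<\infty$$ and $$\limsup_{n\to\infty}\delta_n^{-2}\int_{\mathbb{R}^d\setminus J^n_0}|F(x)-F(a^n(x))|^2\pi(x)\,dx<\infty .$$ Then there exists a constant $C_0>0$ such that the asymptotic variance $\sigma_n^2$ in the central limit theorem for the ergodic averages of $F+P\tilde F_n-\tilde F_n$ along $\Phi$ satisfies $$\sigma_n^2\le C_0\max\{\pi(V^21_{J^n_0}),\delta_n^2\}\qquad\text{for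 all }n\in\mathbb{N}.$$
   Context: Metropolis-Hastings kernel: $\pi$ is a probability density on $\mathbb{R}^d$ with respect to Lebesgue measure $\mu^{\mathrm{Leb}}$, and $q:\mathbb{R}^d\times\mathbb{R}^d\to\mathbb{R}$ is a transition density (for every $x$, $y\mapsto q(x,y)$ is a probability density). Put $\alpha(x,y)=\min\left(1,\frac{\pi(y)q(y,x)}{\pi(x)q(x,y)}\right)$ if $\pi(x)q(x,y)>0$ and $\alpha(x,y)=1$ otherwise, and $$P(x,dy)=\alpha(x,y)q(x,y)\,dy+\Big(1-\int_{\mathbb{R}^d}\alpha(x,z)q(x,z)\,dz\Big)\delta_x(dy).$$ The symbol $\pi$ also denotes the probability measure $\pi(x)dx$; $\pi(G)=\int G(x)\pi(x)dx$ and $PG(x)=\int G(y)P(x,dy)$. Assumptions. A1: there is a continuous function $V:\mathbb{R}^d\to[1,\infty)$ with $\pi(V^2)<\infty$, with bounded sublevel sets ($V^{-1}([1,c])$ is bounded for every $c\ge1$), and there are constants $\lambda_V\in(0,1)$, $\kappa_V>0$ and a compact set $C_V\subset\mathbb{R}^d$ with $PV(x)\le\lambda_V V(x)+\kappa_V 1_{C_V}(x)$ for all $x\in\mathbb{R}^d$. A2: $\pi:\mathbb{R}^d\to(0,\infty)$ is continuous and strictly positive. A3: $q:\mathbb{R}^d\times\mathbb{R}^d\to(0,\infty)$ is continuous, strictly positive and bounded. $L^\infty_V$ is the space of measurable $G:\mathbb{R}^d\to\mathbb{R}$ with $\|G\|_V:=\sup_x |G(x)|/V(x)<\infty$. Asymptotic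 variance: for $H\in L^\infty_V$ let $S_k(H)=\frac1k\sum_{i=1}^kH(\Phi_i)$. Under A1-A3 the CLT $\sqrt{k}\,(S_k(H)-\pi(H))\to\sigma_H N(0,1)$ in distribution as $k\to\infty$ holds, with $\sigma_H^2$ not depending on the initial distribution; $\sigma_H^2$ is the asymptotic variance. For $G\in L^\infty_V$ one has $PG\in L^\infty_V$ and $\pi(PG-G)=0$. Allotments: an allotment $\mathbb{X}=(\mathbb{J},X)$ of size $m$ consists of a partition $\mathbb{J}=\{J_0,\dots,J_m\}$ of $\mathbb{R}^d$ into measurable sets with $\bigcup_{j=1}^mJ_j$ bounded and $\mu^{\mathrm{Leb}}(J_j)>0$ for all $0\le j\le m$, and a set of representatives $X=\{a_0,\dots,a_m\}$ with $a_j\in J_j$. For measurable $W:\mathbb{R}^d\to[1,\infty)$ define $\mathrm{rad}(\mathbb{X},W)=\inf_{y\in J_0}W(y)$ and the $W$-mesh $$\delta(\mathbb{X},W)=\max\Big(\max_{1\le j\le m}\sup_{y\in J_j}|y-a_j|,\ \max_{0\le j\le m}\sup_{y\in J_j}\big(W(a_j)/W(y)-1\big)\Big).$$ A sequence $(\mathbb{X}_n)$ of allotments is exhaustive with respect to $W$ if $\mathrm{rad}(\mathbb{X}_n,W)\to\infty$ and $\delta(\mathbb{X}_n,W)\to0$ as $n\to\infty$. The Scheme with input $P$, $F$, $\mathbb{X}$: (I) let $(p_{\mathbb{X}})_{ij}=P(a_i,J_j)$, $0\le i,j\le m$, and $f_{\mathbb{X}}(a_j)=F(a_j)$; (II) let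 $\hat f_{\mathbb{X}}:X\to\mathbb{R}$ be a solution of $\hat f_{\mathbb{X}}-p_{\mathbb{X}}\hat f_{\mathbb{X}}=f_{\mathbb{X}}-\pi_{\mathbb{X}}(f_{\mathbb{X}})$, where $\pi_{\mathbb{X}}$ is the unique invariant probability measure of the stochastic matrix $p_{\mathbb{X}}$ on $X$ (under A2, A3 all entries of $p_{\mathbb{X}}$ are strictly positive, so a solution exists and is unique up to an additive constant; any solution may be chosen); (III) output $\tilde F_{\mathbb{X}}=\sum_{j=0}^m\hat f_{\mathbb{X}}(a_j)1_{J_j}$. *)

theory Defs
  imports "HOL-Probability.Probability"
begin

definition is_density :: "('a::euclidean_space \<Rightarrow> real) \<Rightarrow> bool" where
  "is_density f \<longleftrightarrow> f \<in> borel_measurable borel \<and> (\<forall>x. 0 \<le> f x) \<and>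
     (\<integral>\<^sup>+x. ennreal (f x) \<partial>lborel) = 1"

text \<open>The target density is called \<open>p\<close>; \<open>target p\<close> is the probability measure \<open>p(x) dx\<close>.\<close>

definition target :: "('a::euclidean_space \<Rightarrow> real) \<Rightarrow> 'a measure" where
  "target p = density lborel (\<lambda>x. ennreal (p x))"

definition acceptance :: "('a \<Rightarrow> real) \<Rightarrow> ('a \<Rightarrow> 'a \<Rightarrow> real) \<Rightarrow> 'a \<Rightarrow> 'a \<Rightarrow> real" where
  "acceptance p q x y =
     (if p x * q x y > 0 then min 1 ((p y * q y x) / (p x * q x y)) else 1)"

definition mh_kernel ::
  "('a::euclidean_space \<Rightarrow> real) \<Rightarrow> ('a \<Rightarrow> 'a \<Rightarrow> real) \<Rightarrow> 'a \<Rightarrow> 'a measure" where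
  "mh_kernel p q x = measure_of UNIV (sets borel) (\<lambda>A.
     (\<integral>\<^sup>+y\<in>A. ennreal (acceptance p q x y * q x y) \<partial>lborel)
     + ennreal (1 - (\<integral>z. acceptance p q x z * q x z \<partial>lborel)) * indicator A x)"

definition kernel_op :: "('a \<Rightarrow> 'a measure) \<Rightarrow> ('a \<Rightarrow> real) \<Rightarrow> 'a \<Rightarrow> real" where
  "kernel_op P G x = (\<integral>y. G y \<partial>P x)"

definition drift_assumption ::
  "('a::euclidean_space \<Rightarrow> 'a measure) \<Rightarrow> 'a measure \<Rightarrow> ('a \<Rightarrow> real) \<Rightarrow> bool" where
  "drift_assumption P \<mu> V \<longleftrightarrow>
     continuous_on UNIV V \<and> (\<forall>x. 1 \<le> V x) \<and>
     (\<integral>\<^sup>+x. ennreal ((V x)\<^sup>2) \<partial>\<mu>) < \<infinity> \<and>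
     (\<forall>c\<ge>1. bounded (V -` {1..c})) \<and>
     (\<exists>lam \<kappa> C. 0 < lam \<and> lam < 1 \<and> 0 < \<kappa> \<and> compact C \<and>
        (\<forall>x. (\<integral>\<^sup>+y. ennreal (V y) \<partial>P x) \<le> ennreal (lam * V x + \<kappa> * indicator C x)))"

definition LV :: "('a::euclidean_space \<Rightarrow> real) \<Rightarrow> ('a \<Rightarrow> real) set" where
  "LV V = {G \<in> borel_measurable borel. bdd_above (range (\<lambda>x. \<bar>G x\<bar> / V x))}"

definition history :: "'b measure \<Rightarrow> (nat \<Rightarrow> 'b \<Rightarrow> 'a::topological_space) \<Rightarrow> nat \<Rightarrow> 'b measure" where
  "history M \<Phi> i =
     sigma (space M) (\<Union>j\<le>i. {\<Phi> j -` B \<inter> space M | B. B \<in> sets borel})"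

text \<open>The initial distribution, i.e. the law of \<open>\<Phi> 0\<close>, is arbitrary.\<close>

definition markov_chain ::
  "'b measure \<Rightarrow> (nat \<Rightarrow> 'b \<Rightarrow> 'a::topological_space) \<Rightarrow> ('a \<Rightarrow> 'a measure) \<Rightarrow> bool" where
  "markov_chain M \<Phi> P \<longleftrightarrow> prob_space M \<and> (\<forall>i. \<Phi> i \<in> measurable M borel) \<and>
     (\<forall>i. \<forall>A\<in>sets borel. AE \<omega> in M.
        real_cond_exp M (history M \<Phi> i) (indicator (\<Phi> (Suc i) -` A)) \<omega> = measure (P (\<Phi> i \<omega>)) A)"

definition ergodic_average :: "(nat \<Rightarrow> 'b \<Rightarrow> 'a) \<Rightarrow> ('a \<Rightarrow> real) \<Rightarrow> nat \<Rightarrow> 'b \<Rightarrow> real" where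
  "ergodic_average \<Phi> H k \<omega> = (\<Sum>i=1..k. H (\<Phi> i \<omega>)) / real k"

text \<open>
  \<open>v\<close> is the asymptotic variance of \<open>H\<close> if the central limit theorem holds with limit law
  \<open>sqrt v * N(0,1)\<close> (the point mass at \<open>0\<close> when \<open>v = 0\<close>) for every chain driven by \<open>P\<close>,
  whatever its initial distribution. Since the assertion only involves the law of the chain,
  it is enough to let the underlying probability space range over measures on the type of paths.
\<close>

definition is_asymptotic_variance ::
  "('a::euclidean_space \<Rightarrow> 'a measure) \<Rightarrow> 'a measure \<Rightarrow> ('a \<Rightarrow> real) \<Rightarrow> real \<Rightarrow> bool" where
  "is_asymptotic_variance P \<mu> H v \<longleftrightarrow> 0 \<le> v \<and>
     (\<forall>(M :: (nat \<Rightarrow> 'a) measure) \<Phi>. markov_chain M \<Phi> P \<longrightarrow>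
        weak_conv_m
          (\<lambda>k. distr M borel (\<lambda>\<omega>. sqrt (real k) * (ergodic_average \<Phi> H k \<omega> - (\<integral>x. H x \<partial>\<mu>))))
          (distr std_normal_distribution borel (\<lambda>z. sqrt v * z)))"

text \<open>An allotment of size \<open>m\<close> uses the values of \<open>cell\<close> and \<open>rep\<close> at \<open>0, ..., m\<close> only.\<close>

record 'a allotment =
  asize :: nat
  cell :: "nat \<Rightarrow> 'a set"
  rep :: "nat \<Rightarrow> 'a"

definition is_allotment :: "'a::euclidean_space allotment \<Rightarrow> bool" where
  "is_allotment X \<longleftrightarrow>
     (\<Union>j\<le>asize X. cell X j) = UNIV \<and> disjoint_family_on (cell X) {..asize X} \<and>
     (\<forall>j\<le>asize X. cell X j \<in> sets borel \<and> emeasure lborel (cell X j) > 0 \<and> rep X j \<in> cell X j) \<and>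
     bounded (\<Union>j\<in>{1..asize X}. cell X j)"

definition rad :: "'a::euclidean_space allotment \<Rightarrow> ('a \<Rightarrow> real) \<Rightarrow> real" where
  "rad X W = (INF y\<in>cell X 0. W y)"

text \<open>
  The truncation of negative values by \<^term>\<open>ennreal\<close> is harmless, since the expressions under
  both suprema vanish at \<open>y = rep X j\<close>.
\<close>

definition mesh :: "'a::euclidean_space allotment \<Rightarrow> ('a \<Rightarrow> real) \<Rightarrow> ennreal" where
  "mesh X W = max
     (SUP j\<in>{1..asize X}. SUP y\<in>cell X j. ennreal (norm (y - rep X j)))
     (SUP j\<in>{..asize X}. SUP y\<in>cell X j. ennreal (W (rep X j) / W y - 1))"

definition exhaustive :: "(nat \<Rightarrow> 'a::euclidean_space allotment) \<Rightarrow> ('a \<Rightarrow> real) \<Rightarrow> bool" where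
  "exhaustive X W \<longleftrightarrow> filterlim (\<lambda>n. rad (X n) W) at_top sequentially \<and>
     (\<lambda>n. mesh (X n) W) \<longlonglongrightarrow> 0"

definition rep_map :: "'a::euclidean_space allotment \<Rightarrow> 'a \<Rightarrow> 'a" where
  "rep_map X x = (\<Sum>j\<le>asize X. indicator (cell X j) x *\<^sub>R rep X j)"

definition scheme_matrix ::
  "('a \<Rightarrow> 'a measure) \<Rightarrow> 'a allotment \<Rightarrow> nat \<Rightarrow> nat \<Rightarrow> real" where
  "scheme_matrix P X i j = measure (P (rep X i)) (cell X j)"

definition invariant_distribution :: "nat \<Rightarrow> (nat \<Rightarrow> nat \<Rightarrow> real) \<Rightarrow> (nat \<Rightarrow> real) \<Rightarrow> bool" where
  "invariant_distribution m A w \<longleftrightarrow> (\<forall>i\<le>m. 0 \<le> w i) \<and> (\<Sum>i\<le>m. w i) = 1 \<and>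
     (\<forall>j\<le>m. (\<Sum>i\<le>m. w i * A i j) = w j)"

text \<open>
  The solution of the discretised Poisson equation is unique only up to an additive constant, so
  the output is a relation: \<open>G\<close> is the output for some choice of the solution.
\<close>

definition scheme_output ::
  "('a \<Rightarrow> 'a measure) \<Rightarrow> ('a \<Rightarrow> real) \<Rightarrow> 'a allotment \<Rightarrow> ('a \<Rightarrow> real) \<Rightarrow> bool" where
  "scheme_output P F X G \<longleftrightarrow>
     (\<exists>w fhat. invariant_distribution (asize X) (scheme_matrix P X) w \<and>
        (\<forall>i\<le>asize X.
           fhat (rep X i) - (\<Sum>j\<le>asize X. scheme_matrix P X i j * fhat (rep X j))
           = F (rep X i) - (\<Sum>j\<le>asize X. w j * F (rep X j))) \<and>
        G = (\<lambda>x. \<Sum>j\<le>asize X. fhat (rep X j) * indicator (cell X j) x))"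

definition proposal_gap ::
  "('a::euclidean_space \<Rightarrow> real) \<Rightarrow> ('a \<Rightarrow> 'a \<Rightarrow> real) \<Rightarrow> 'a allotment \<Rightarrow> 'a \<Rightarrow> 'a \<Rightarrow> real" where
  "proposal_gap p q X x y =
     \<bar>acceptance p q (rep_map X x) y * q (rep_map X x) y - acceptance p q x y * q x y\<bar>"

end

theory Submission
  imports Defs
begin

text \<open>
  Write \<open>P\<close> for the Metropolis-Hastings kernel, \<open>\<mu>\<close> for its target, \<open>a\<close> for the map that sends a point
  to the representative of its cell, and \<open>G\<close> for the output of the scheme. The discrete equation says
  that \<open>G\<close> solves Poisson's equation for the kernel \<open>P (a x)\<close>, namely
  \<open>G x - P G (a x) = F (a x) - c\<close>. Hence
  \<open>F + P G - G - c = (F - F \<circ> a) + (P G - P G \<circ> a)\<close>: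
  up to a constant, the function whose averages are formed is a pure discretisation error.
  Two facts then give the theorem.

  First, for every \<open>H\<close> dominated by \<open>V\<close>, the asymptotic variance is at most a constant times \<open>\<integral> (H - c)\<^sup>2 d\<mu>\<close>
  (\<open>asymptotic_variance_bound\<close>). The variance in the central limit theorem is
  \<open>\<integral> U\<^sup>2 d\<mu> - \<integral> (P U)\<^sup>2 d\<mu>\<close> for the solution \<open>U\<close> of \<open>U - P U = H - \<integral> H d\<mu>\<close>, and reversibility turns
  geometric ergodicity into a spectral gap in \<open>L\<^sup>2(\<mu>)\<close>, which controls \<open>U\<close> by \<open>H\<close>.

  Second, \<open>\<bar>G - s\<bar> \<le> M V\<close> for some constant \<open>s\<close>, with \<open>M\<close> the same for all sufficiently fine allotments
  (\<open>scheme_output_stability\<close>). Drift and minorisation make \<open>P\<close> a contraction for a seminorm of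
  weighted oscillation, after Hairer and Mattingly (\<open>weighted_oscillation_contraction\<close>). The
  contraction constants depend only on the constants of drift and minorisation, and these barely
  change when \<open>P x\<close> is replaced by \<open>P (a x)\<close>. So all these kernels contract at one common rate,
  and Poisson's equation for \<open>P (a x)\<close> can be solved with a uniform bound.

  On the cells \<open>J\<^sub>1, \<dots>, J\<^sub>m\<close> the error \<open>P G - P G \<circ> a\<close> is then at most
  \<open>M \<integral> (V x + V y) Z(x, y) dy\<close>, which the hypotheses measure by the mesh, and on \<open>J\<^sub>0\<close> both
  errors are at most a multiple of \<open>V\<close>. This gives the two terms of the maximum.

  The central limit theorem is proved through characteristic functions. If
  \<open>T g = P (exp (\<i> \<theta> H) g)\<close>, then \<open>E (exp (\<i> \<theta> (H(\<Phi>\<^sub>1) + \<dots> + H(\<Phi>\<^sub>k)))) = E ((T\<^sup>k 1)(\<Phi>\<^sub>0))\<close>.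
  The operator \<open>T\<close> does not increase the norm of \<open>L\<^sup>1(\<mu>)\<close>, and \<open>1 + \<i> \<theta> P U + \<theta>\<^sup>2 w\<close>, for a suitable
  bounded \<open>w\<close>, is an eigenfunction of \<open>T\<close> for the eigenvalue \<open>1 - \<sigma>\<^sup>2 \<theta>\<^sup>2 / 2\<close> up to a small multiple
  of \<open>\<theta>\<^sup>2\<close>. With \<open>\<theta> = t / \<surd>k\<close> these errors stay small over \<open>k\<close> steps, so
  \<open>\<integral> T\<^sup>k 1 d\<mu>\<close> tends to \<open>exp (- \<sigma>\<^sup>2 t\<^sup>2 / 2)\<close> (\<open>tilted_pow_mean_limit\<close>). Contraction also makes \<open>T\<^sup>k 1\<close>
  nearly constant, which gives the same limit from every starting point
  (\<open>tilted_pow_forgets_start\<close>).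
\<close>

section \<open>Contraction of weighted oscillations\<close>

text \<open>
  A suitable constant is the supremum of \<open>\<phi> - W\<close>: the hypothesis says exactly that every value of
  \<open>\<phi> - W\<close> lies below every value of \<open>\<phi> + W\<close>. This passes from oscillations to weighted
  sup-norms without losing a factor.
\<close>

lemma recentering:
  fixes \<phi> W :: "'a \<Rightarrow> real"
  assumes osc: "\<And>x y. \<bar>\<phi> x - \<phi> y\<bar> \<le> W x + W y"
  shows "\<exists>s. \<forall>x. \<bar>\<phi> x - s\<bar> \<le> W x"
proof (intro exI allI)
  fix x
  let ?s = "SUP x. \<phi> x - W x"
  have le: "\<phi> z - W z \<le> \<phi> y + W y" for y z
    using osc[of z y] by linarith
  have "?s \<le> \<phi> x + W x"
    by (intro cSUP_least le) auto
  moreover have "\<phi> x - W x \<le> ?s"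
    using le by (intro cSUP_upper bdd_aboveI2[of _ _ "\<phi> x + W x"]) auto
  ultimately show "\<bar>\<phi> x - ?s\<bar> \<le> W x"
    by linarith
qed

text \<open>
  The distance of two distinct points in the method of Hairer and Mattingly. The weight
  \<open>\<beta>\<close> of \<open>V\<close> is to be chosen such that the gain from the minorisation outweighs \<open>\<beta>\<close> times the
  additive constant of the drift condition.
\<close>

definition osc_weight :: "real \<Rightarrow> ('a \<Rightarrow> real) \<Rightarrow> 'a \<Rightarrow> 'a \<Rightarrow> real" where
  "osc_weight \<beta> V x y = 2 + \<beta> * V x + \<beta> * V y"

text \<open>
  The first entry is the rate when \<open>V x + V y \<ge> R\<close>, where the drift contracts; the others
  are the rates when both points are in the small set, where the minorisation gains \<open>\<epsilon>\<close> on the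
  constant part and the drift gains \<open>\<gamma>\<close> on the part with \<open>V\<close>. The weight is \<open>\<beta> = \<epsilon> / (2 * K)\<close>.
\<close>

definition contraction_rate :: "real \<Rightarrow> real \<Rightarrow> real \<Rightarrow> real \<Rightarrow> real" where
  "contraction_rate \<gamma> K R \<epsilon> =
     max ((2 + \<epsilon> / (2 * K) * (\<gamma> * R + 2 * K)) / (2 + \<epsilon> / (2 * K) * R)) (max (1 - \<epsilon> / 2) \<gamma>)"

lemma contraction_rate_bounds:
  assumes "0 \<le> \<gamma>" "\<gamma> < 1" "0 < K" "2 * K / (1 - \<gamma>) < R" "0 < \<epsilon>"
  shows "0 \<le> contraction_rate \<gamma> K R \<epsilon>" "contraction_rate \<gamma> K R \<epsilon> < 1"
proof -
  have R: "2 * K < R * (1 - \<gamma>)"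
    using assms by (simp add: field_simps)
  have "0 < 2 * K / (1 - \<gamma>)"
    using assms by (intro divide_pos_pos) auto
  then have "0 < R"
    using assms(4) by linarith
  then have "0 < 2 + \<epsilon> / (2 * K) * R"
    using assms by (intro add_pos_nonneg mult_nonneg_nonneg) auto
  moreover have "\<epsilon> / (2 * K) * (\<gamma> * R + 2 * K) < \<epsilon> / (2 * K) * R"
    using R assms by (intro mult_strict_left_mono) (auto simp: algebra_simps)
  ultimately have "(2 + \<epsilon> / (2 * K) * (\<gamma> * R + 2 * K)) / (2 + \<epsilon> / (2 * K) * R) < 1"
    by simp
  then show "contraction_rate \<gamma> K R \<epsilon> < 1" "0 \<le> contraction_rate \<gamma> K R \<epsilon>"
    using assms by (auto simp: contraction_rate_def)
qed

text \<open>
  After subtraction of a constant, \<open>\<bar>\<phi>\<bar> \<le> L (1 + \<beta> V)\<close>. If \<open>V x + V y\<close> is large, the drift alone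
  makes the sum of the means of \<open>1 + \<beta> V\<close> under \<open>Q x\<close> and \<open>Q y\<close> smaller than the weight of the two points. Otherwise \<open>Q x\<close> and \<open>Q y\<close> share the mass \<open>\<nu>\<close>, whose
  contributions cancel in the difference; comparing \<open>\<nu>\<close> with \<open>Q x\<close> on the nonnegative functions
  \<open>W \<plusminus> \<psi>\<close> expresses this cancellation without subtracting measures.
  The rate depends on \<open>Q\<close> only through the constants in the hypotheses.
\<close>

lemma weighted_oscillation_contraction:
  fixes Q :: "'a::topological_space \<Rightarrow> 'a measure" and V \<phi> :: "'a \<Rightarrow> real"
  assumes \<gamma>: "0 \<le> \<gamma>" "\<gamma> < 1" and K: "0 < K" and R: "2 * K / (1 - \<gamma>) < R" and \<epsilon>: "0 < \<epsilon>"
    and Q: "\<And>x. prob_space (Q x)" "\<And>x. sets (Q x) = sets borel"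
    and V: "V \<in> borel_measurable borel" "\<And>x. 0 \<le> V x"
    and drift: "\<And>x. (\<integral>\<^sup>+y. ennreal (V y) \<partial>Q x) \<le> ennreal (\<gamma> * V x + K)"
    and minor: "\<And>x f. V x \<le> R \<Longrightarrow> f \<in> borel_measurable borel \<Longrightarrow>
        (\<integral>\<^sup>+y. f y \<partial>\<nu>) \<le> (\<integral>\<^sup>+y. f y \<partial>Q x)"
    and \<nu>: "sets \<nu> = sets borel" "ennreal \<epsilon> \<le> emeasure \<nu> (space \<nu>)"
    and \<phi>: "\<phi> \<in> borel_measurable borel" "0 \<le> L"
      "\<And>x y. \<bar>\<phi> x - \<phi> y\<bar> \<le> L * osc_weight (\<epsilon> / (2 * K)) V x y"
  shows "\<bar>(\<integral>z. \<phi> z \<partial>Q x) - (\<integral>z. \<phi> z \<partial>Q y)\<bar>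
      \<le> contraction_rate \<gamma> K R \<epsilon> * (L * osc_weight (\<epsilon> / (2 * K)) V x y)"
proof -
  define \<beta> where "\<beta> = \<epsilon> / (2 * K)"
  define W where "W = (\<lambda>x. L * (1 + \<beta> * V x))"
  have \<beta>: "0 < \<beta>"
    using K \<epsilon> by (simp add: \<beta>_def)
  have meas [measurable_cong]: "sets (Q x) = sets borel" for x
    by (rule Q)
  note [measurable_cong] = \<nu>(1)
  note [measurable] = V(1) \<phi>(1)
  have W: "0 \<le> W z" for z
    using V(2)[of z] \<beta> \<phi>(2) by (simp add: W_def)
  have [measurable]: "W \<in> borel_measurable borel"
    by (simp add: W_def)
  have osc: "L * osc_weight (\<epsilon> / (2 * K)) V x y = W x + W y" for x y
    by (simp add: osc_weight_def W_def \<beta>_def algebra_simps)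
  obtain s where s: "\<bar>\<phi> z - s\<bar> \<le> W z" for z
    using recentering[of \<phi> W] \<phi>(3) unfolding osc by blast
  define \<psi> where "\<psi> = (\<lambda>z. \<phi> z - s)"
  have [measurable]: "\<psi> \<in> borel_measurable borel"
    by (simp add: \<psi>_def)
  have \<psi>: "\<bar>\<psi> z\<bar> \<le> W z" for z
    using s by (simp add: \<psi>_def)
  have intV: "integrable (Q x) V" for x
  proof (rule integrableI_bounded)
    have "(\<integral>\<^sup>+y. ennreal (norm (V y)) \<partial>Q x) = (\<integral>\<^sup>+y. ennreal (V y) \<partial>Q x)"
      using V(2) by (intro nn_integral_cong) auto
    also have "\<dots> < \<infinity>"
      using drift[of x] by (simp add: le_less_trans)
    finally show "(\<integral>\<^sup>+y. ennreal (norm (V y)) \<partial>Q x) < \<infinity>" .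
  qed simp
  have fin: "finite_measure (Q x)" for x
    using Q(1) by (rule prob_space.finite_measure)
  have prob: "measure (Q x) (space (Q x)) = 1" for x
    using Q(1) by (rule prob_space.prob_space)
  have const: "integrable (Q x) (\<lambda>_. c)" for x and c :: real
    using fin by (rule finite_measure.integrable_const)
  have intW: "integrable (Q x) W" for x
    unfolding W_def using intV const by (intro integrable_mult_right integrable_add) auto
  have int\<psi>: "integrable (Q x) \<psi>" for x
    by (rule Bochner_Integration.integrable_bound[OF intW[of x]]) (use \<psi> W in \<open>auto intro: order_trans\<close>)
  have V_le: "(\<integral>z. V z \<partial>Q x) \<le> \<gamma> * V x + K" for x
  proof -
    have "ennreal (\<integral>z. V z \<partial>Q x) = (\<integral>\<^sup>+y. ennreal (V y) \<partial>Q x)"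
      using V(2) intV by (intro nn_integral_eq_integral[symmetric]) auto
    also note drift
    finally show ?thesis
      using \<gamma> V(2)[of x] K by (subst (asm) ennreal_le_iff) auto
  qed
  have W_eq: "(\<integral>z. W z \<partial>Q x) = L * (1 + \<beta> * (\<integral>z. V z \<partial>Q x))" for x
    unfolding W_def using intV[of x] prob[of x] const[of x] by simp
  have W_le: "(\<integral>z. W z \<partial>Q x) \<le> L * (1 + \<beta> * (\<gamma> * V x + K))" for x
    unfolding W_eq using V_le \<beta> \<phi>(2) by (intro mult_left_mono add_left_mono) auto
  have \<psi>_le: "\<bar>\<integral>z. \<psi> z \<partial>Q x\<bar> \<le> (\<integral>z. W z \<partial>Q x)" for x
    using int\<psi>[of x] intW[of x] \<psi> by (intro integral_abs_bound[THEN order_trans] integral_mono) auto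
  have diff: "(\<integral>z. \<phi> z \<partial>Q x) - (\<integral>z. \<phi> z \<partial>Q y) = (\<integral>z. \<psi> z \<partial>Q x) - (\<integral>z. \<psi> z \<partial>Q y)"
  proof -
    have "(\<integral>z. \<phi> z \<partial>Q x) = (\<integral>z. \<psi> z \<partial>Q x) + s" for x
    proof -
      have "(\<integral>z. \<phi> z \<partial>Q x) = (\<integral>z. \<psi> z + s \<partial>Q x)"
        by (simp add: \<psi>_def)
      also have "\<dots> = (\<integral>z. \<psi> z \<partial>Q x) + (\<integral>z. s \<partial>Q x)"
        by (intro Bochner_Integration.integral_add int\<psi> const)
      finally show ?thesis
        using prob[of x] by simp
    qed
    then show ?thesis by simp
  qed
  define S where "S = V x + V y"
  have S: "0 \<le> S"
    using V(2) by (simp add: S_def)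
  show ?thesis
  proof (cases "R \<le> S")
    case True
    have "0 < 2 * K / (1 - \<gamma>)"
      using \<gamma> K by (intro divide_pos_pos) auto
    then have R0: "0 < R"
      using R by linarith
    have RK: "2 * K < R * (1 - \<gamma>)"
      using R \<gamma> by (simp add: field_simps)
    have "2 + \<beta> * (\<gamma> * S + 2 * K) \<le> (2 + \<beta> * (\<gamma> * R + 2 * K)) / (2 + \<beta> * R) * (2 + \<beta> * S)"
    proof -
      have "0 \<le> (\<beta> * (S - R)) * (2 * ((1 - \<gamma>)) + 2 * K * \<beta>)"
        using True \<beta> K \<gamma> by (intro mult_nonneg_nonneg add_nonneg_nonneg) auto
      then have "(2 + \<beta> * (\<gamma> * S + 2 * K)) * (2 + \<beta> * R) \<le> (2 + \<beta> * (\<gamma> * R + 2 * K)) * (2 + \<beta> * S)"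
        by (simp add: algebra_simps)
      moreover have "0 < 2 + \<beta> * R"
        using \<beta> R0 by (simp add: add_pos_pos)
      ultimately show ?thesis
        by (simp add: pos_le_divide_eq)
    qed
    also have "\<dots> \<le> contraction_rate \<gamma> K R \<epsilon> * (2 + \<beta> * S)"
      using mult_nonneg_nonneg[OF less_imp_le[OF \<beta>] S]
      by (intro mult_right_mono) (auto simp: contraction_rate_def \<beta>_def)
    finally have "L * (2 + \<beta> * (\<gamma> * S + 2 * K)) \<le> L * (contraction_rate \<gamma> K R \<epsilon> * (2 + \<beta> * S))"
      using \<phi>(2) by (rule mult_left_mono)
    moreover have "\<bar>(\<integral>z. \<psi> z \<partial>Q x) - (\<integral>z. \<psi> z \<partial>Q y)\<bar> \<le> L * (2 + \<beta> * (\<gamma> * S + 2 * K))"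
      using \<psi>_le[of x] \<psi>_le[of y] W_le[of x] W_le[of y] by (simp add: S_def algebra_simps)
    ultimately show ?thesis
      unfolding diff osc by (simp add: S_def W_def algebra_simps)
  next
    case False
    have xR: "V x \<le> R" "V y \<le> R"
      using False V(2)[of x] V(2)[of y] by (auto simp: S_def)
    have \<nu>W: "(\<integral>\<^sup>+z. ennreal (W z) \<partial>\<nu>) \<le> ennreal (\<integral>z. W z \<partial>Q x)"
      using minor[OF xR(1), of "\<lambda>z. ennreal (W z)"] intW[of x] W by (simp add: nn_integral_eq_integral)
    have intW\<nu>: "integrable \<nu> W"
    proof (rule integrableI_bounded)
      have "(\<integral>\<^sup>+z. ennreal (norm (W z)) \<partial>\<nu>) = (\<integral>\<^sup>+z. ennreal (W z) \<partial>\<nu>)"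
        using W by (intro nn_integral_cong) auto
      with \<nu>W show "(\<integral>\<^sup>+z. ennreal (norm (W z)) \<partial>\<nu>) < \<infinity>"
        by (simp add: le_less_trans)
    qed simp
    have int\<psi>\<nu>: "integrable \<nu> \<psi>"
      by (rule Bochner_Integration.integrable_bound[OF intW\<nu>]) (use \<psi> W in \<open>auto intro: order_trans\<close>)
    have minor': "(\<integral>z. f z \<partial>\<nu>) \<le> (\<integral>z. f z \<partial>Q u)"
      if "V u \<le> R" "integrable \<nu> f" "integrable (Q u) f" "\<And>z. 0 \<le> f z" "f \<in> borel_measurable borel"
      for f :: "'a \<Rightarrow> real" and u
    proof -
      have "ennreal (\<integral>z. f z \<partial>\<nu>) = (\<integral>\<^sup>+z. ennreal (f z) \<partial>\<nu>)"
        using that by (intro nn_integral_eq_integral[symmetric]) auto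
      also have "\<dots> \<le> (\<integral>\<^sup>+z. ennreal (f z) \<partial>Q u)"
        using that by (intro minor) auto
      also have "\<dots> = ennreal (\<integral>z. f z \<partial>Q u)"
        using that by (intro nn_integral_eq_integral) auto
      finally show ?thesis
        using that by (subst (asm) ennreal_le_iff) auto
    qed
    have nonneg: "0 \<le> W z - \<psi> z" "0 \<le> W z + \<psi> z" for z
      using \<psi>[of z] by auto
    have A: "(\<integral>z. W z \<partial>\<nu>) - (\<integral>z. \<psi> z \<partial>\<nu>) \<le> (\<integral>z. W z \<partial>Q u) - (\<integral>z. \<psi> z \<partial>Q u)"
        "(\<integral>z. W z \<partial>\<nu>) + (\<integral>z. \<psi> z \<partial>\<nu>) \<le> (\<integral>z. W z \<partial>Q u) + (\<integral>z. \<psi> z \<partial>Q u)" if "V u \<le> R" for u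
      using minor'[OF that, of "\<lambda>z. W z - \<psi> z"] minor'[OF that, of "\<lambda>z. W z + \<psi> z"] nonneg
        intW\<nu> int\<psi>\<nu> intW[of u] int\<psi>[of u] by simp_all
    have W\<nu>: "L * \<epsilon> \<le> (\<integral>z. W z \<partial>\<nu>)"
    proof -
      have "ennreal (L * \<epsilon>) = ennreal L * ennreal \<epsilon>"
        using \<phi>(2) \<epsilon> by (simp add: ennreal_mult)
      also have "\<dots> \<le> ennreal L * emeasure \<nu> (space \<nu>)"
        using \<nu>(2) by (intro mult_left_mono) auto
      also have "\<dots> = (\<integral>\<^sup>+z. ennreal L \<partial>\<nu>)"
        by simp
      also have "\<dots> \<le> (\<integral>\<^sup>+z. ennreal (W z) \<partial>\<nu>)"
        using V(2) \<beta> \<phi>(2) by (intro nn_integral_mono ennreal_leI) (simp add: W_def mult_le_cancel_left1 algebra_simps)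
      also have "\<dots> = ennreal (\<integral>z. W z \<partial>\<nu>)"
        using intW\<nu> W by (intro nn_integral_eq_integral) auto
      finally show ?thesis
        using W by (subst (asm) ennreal_le_iff) (auto intro!: integral_nonneg_AE)
    qed
    have "\<bar>(\<integral>z. \<psi> z \<partial>Q x) - (\<integral>z. \<psi> z \<partial>Q y)\<bar> \<le> (\<integral>z. W z \<partial>Q x) + (\<integral>z. W z \<partial>Q y) - 2 * (\<integral>z. W z \<partial>\<nu>)"
      using A(1)[OF xR(1)] A(1)[OF xR(2)] A(2)[OF xR(1)] A(2)[OF xR(2)] by linarith
    also have "\<dots> \<le> L * (2 + \<beta> * (\<gamma> * S + 2 * K)) - 2 * (L * \<epsilon>)"
      using W_le[of x] W_le[of y] W\<nu> by (simp add: S_def algebra_simps)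
    also have "\<dots> = L * (2 * (1 - \<epsilon> / 2) + \<gamma> * (\<beta> * S))"
      using K by (simp add: \<beta>_def field_simps)
    also have "\<dots> \<le> L * (contraction_rate \<gamma> K R \<epsilon> * (2 + \<beta> * S))"
    proof (intro mult_left_mono \<phi>(2))
      have "1 - \<epsilon> / 2 \<le> contraction_rate \<gamma> K R \<epsilon>"
        unfolding contraction_rate_def by linarith
      moreover have "\<gamma> * (\<beta> * S) \<le> contraction_rate \<gamma> K R \<epsilon> * (\<beta> * S)"
        using \<beta> S by (intro mult_right_mono) (auto simp: contraction_rate_def)
      ultimately show "2 * (1 - \<epsilon> / 2) + \<gamma> * (\<beta> * S) \<le> contraction_rate \<gamma> K R \<epsilon> * (2 + \<beta> * S)"
        by (simp add: distrib_left)
    qed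
    finally show ?thesis
      unfolding diff osc by (simp add: S_def W_def algebra_simps)
  qed
qed

section \<open>Kernels with an invariant probability measure\<close>

text \<open>
  By \<open>domination\<close>, a function that is integrable for \<open>\<mu>\<close> is integrable for \<open>P x\<close> at every \<open>x\<close>, and
  not only at almost every \<open>x\<close>. So \<open>P\<close> acts linearly on functions, not on classes of functions. For the
  Metropolis-Hastings kernel this holds because proposals have a bounded density.
\<close>

locale stationary_kernel =
  fixes P :: "'a::topological_space \<Rightarrow> 'a measure" and \<mu> :: "'a measure"
  assumes kernel [measurable]: "P \<in> borel \<rightarrow>\<^sub>M prob_algebra borel"
    and prob_stationary: "prob_space \<mu>"
    and sets_stationary [measurable_cong]: "sets \<mu> = sets borel"
    and stationary: "\<And>f. f \<in> borel_measurable borel \<Longrightarrow>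
      (\<integral>\<^sup>+x. \<integral>\<^sup>+y. f y \<partial>P x \<partial>\<mu>) = (\<integral>\<^sup>+x. f x \<partial>\<mu>)"
    and domination: "\<And>x. \<exists>c::real. \<forall>f\<in>borel_measurable borel.
      (\<integral>\<^sup>+y. f y \<partial>P x) \<le> ennreal c * (\<integral>\<^sup>+y. f y \<partial>\<mu>) + f x"
begin

sublocale \<mu>: prob_space \<mu>
  by (rule prob_stationary)

lemma sets_kernel [simp, measurable_cong]: "sets (P x) = sets borel"
  using measurable_space[OF kernel, of x] by (simp add: space_prob_algebra)

lemma prob_kernel: "prob_space (P x)"
  using measurable_space[OF kernel, of x] by (simp add: space_prob_algebra)

sublocale P: prob_space "P x" for x
  by (rule prob_kernel)

lemma space_kernel [simp]: "space (P x) = UNIV" "space \<mu> = UNIV"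
  using sets_eq_imp_space_eq[OF sets_kernel] sets_eq_imp_space_eq[OF sets_stationary] by auto

lemma measurable_kernel_integral [measurable (raw)]:
  fixes f :: "'a \<Rightarrow> 'b::{banach, second_countable_topology}"
  assumes [measurable]: "f \<in> borel_measurable borel"
  shows "(\<lambda>x. \<integral>y. f y \<partial>P x) \<in> borel_measurable borel"
  by (rule measurable_compose[OF measurable_prob_algebraD[OF kernel] integral_measurable_subprob_algebra]) simp

lemma measurable_kernel_op [measurable (raw)]:
  "f \<in> borel_measurable borel \<Longrightarrow> kernel_op P f \<in> borel_measurable borel"
  unfolding kernel_op_def[abs_def] by measurable

lemma measurable_kernel_op_pow:
  "f \<in> borel_measurable borel \<Longrightarrow> (kernel_op P ^^ k) f \<in> borel_measurable borel"
  by (induction k) auto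

lemma integrable_stationary_imp_measurable:
  "integrable \<mu> f \<Longrightarrow> f \<in> borel_measurable borel"
  using measurable_cong_sets[OF sets_stationary refl] by (auto dest: borel_measurable_integrable)

lemma measurable_stationary: "f \<in> borel_measurable borel \<Longrightarrow> f \<in> borel_measurable \<mu>"
  by (simp add: measurable_cong_sets[OF sets_stationary refl])

lemma integrable_kernel:
  fixes f :: "'a \<Rightarrow> 'b::{banach, second_countable_topology}"
  assumes f: "integrable \<mu> f"
  shows "integrable (P x) f"
proof (rule integrableI_bounded)
  note [measurable] = integrable_stationary_imp_measurable[OF f]
  show "f \<in> borel_measurable (P x)"
    by simp
  obtain c :: real where "(\<integral>\<^sup>+y. ennreal (norm (f y)) \<partial>P x)
      \<le> ennreal c * (\<integral>\<^sup>+y. ennreal (norm (f y)) \<partial>\<mu>) + ennreal (norm (f x))"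
    using domination[of x] by (auto dest!: bspec[where x="\<lambda>y. ennreal (norm (f y))"])
  also have "\<dots> < \<infinity>"
    using f by (auto simp: integrable_iff_bounded ennreal_mult_less_top)
  finally show "(\<integral>\<^sup>+y. ennreal (norm (f y)) \<partial>P x) < \<infinity>" .
qed

lemma
  fixes f :: "'a \<Rightarrow> 'b::{banach, second_countable_topology}"
  assumes f: "integrable \<mu> f"
  shows integrable_kernel_integral: "integrable \<mu> (\<lambda>x. \<integral>y. f y \<partial>P x)"
    and norm_kernel_integral_le: "(\<integral>x. norm (\<integral>y. f y \<partial>P x) \<partial>\<mu>) \<le> (\<integral>x. norm (f x) \<partial>\<mu>)"
proof -
  note [measurable] = integrable_stationary_imp_measurable[OF f]
  have "(\<integral>\<^sup>+x. ennreal (norm (\<integral>y. f y \<partial>P x)) \<partial>\<mu>) \<le> (\<integral>\<^sup>+x. \<integral>\<^sup>+y. ennreal (norm (f y)) \<partial>P x \<partial>\<mu>)"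
    using integrable_kernel[OF f] by (intro nn_integral_mono integral_norm_bound_ennreal) auto
  also have "\<dots> = (\<integral>\<^sup>+x. ennreal (norm (f x)) \<partial>\<mu>)"
    by (rule stationary) simp
  finally have le: "(\<integral>\<^sup>+x. ennreal (norm (\<integral>y. f y \<partial>P x)) \<partial>\<mu>) \<le> (\<integral>\<^sup>+x. ennreal (norm (f x)) \<partial>\<mu>)" .
  have "(\<lambda>x. \<integral>y. f y \<partial>P x) \<in> borel_measurable \<mu>"
    by (simp add: measurable_stationary measurable_kernel_integral)
  then show int: "integrable \<mu> (\<lambda>x. \<integral>y. f y \<partial>P x)"
    using le f by (intro integrableI_bounded) (auto simp: integrable_iff_bounded intro: le_less_trans)
  show "(\<integral>x. norm (\<integral>y. f y \<partial>P x) \<partial>\<mu>) \<le> (\<integral>x. norm (f x) \<partial>\<mu>)"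
    using le f int by (simp add: nn_integral_eq_integral)
qed

lemma integral_kernel_integral:
  fixes f :: "'a \<Rightarrow> real"
  assumes f: "integrable \<mu> f"
  shows "(\<integral>x. \<integral>y. f y \<partial>P x \<partial>\<mu>) = (\<integral>x. f x \<partial>\<mu>)"
proof -
  note [measurable] = integrable_stationary_imp_measurable[OF f]
  have nonneg: "(\<integral>x. \<integral>y. g y \<partial>P x \<partial>\<mu>) = (\<integral>x. g x \<partial>\<mu>)"
    if g: "integrable \<mu> g" "\<And>x. 0 \<le> g x" for g :: "'a \<Rightarrow> real"
  proof -
    note [measurable] = integrable_stationary_imp_measurable[OF g(1)]
    have "ennreal (\<integral>x. \<integral>y. g y \<partial>P x \<partial>\<mu>) = (\<integral>\<^sup>+x. ennreal (\<integral>y. g y \<partial>P x) \<partial>\<mu>)"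
      using g integrable_kernel_integral[OF g(1)] by (intro nn_integral_eq_integral[symmetric]) auto
    also have "\<dots> = (\<integral>\<^sup>+x. \<integral>\<^sup>+y. ennreal (g y) \<partial>P x \<partial>\<mu>)"
      using g integrable_kernel[OF g(1)] by (intro nn_integral_cong nn_integral_eq_integral[symmetric]) auto
    also have "\<dots> = (\<integral>\<^sup>+x. ennreal (g x) \<partial>\<mu>)"
      by (rule stationary) simp
    also have "\<dots> = ennreal (\<integral>x. g x \<partial>\<mu>)"
      using g by (intro nn_integral_eq_integral) auto
    finally show ?thesis
      using g by (subst (asm) ennreal_inj) (auto intro!: Bochner_Integration.integral_nonneg)
  qed
  define g h where "g = (\<lambda>x. max 0 (f x))" and "h = (\<lambda>x. max 0 (- f x))"
  have gh: "integrable \<mu> g" "integrable \<mu> h" "\<And>x. 0 \<le> g x" "\<And>x. 0 \<le> h x"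
    using f by (auto simp: g_def h_def)
  have eq: "f = (\<lambda>x. g x - h x)"
    by (auto simp: g_def h_def)
  show ?thesis
    unfolding eq using gh by (simp add: integrable_kernel integrable_kernel_integral nonneg)
qed

lemma integrable_kernel_op: "integrable \<mu> f \<Longrightarrow> integrable \<mu> (kernel_op P f)"
  unfolding kernel_op_def[abs_def] by (rule integrable_kernel_integral)

lemma integral_kernel_op: "integrable \<mu> f \<Longrightarrow> (\<integral>x. kernel_op P f x \<partial>\<mu>) = (\<integral>x. f x \<partial>\<mu>)"
  unfolding kernel_op_def by (rule integral_kernel_integral)

lemma integrable_kernel_op_pow: "integrable \<mu> f \<Longrightarrow> integrable \<mu> ((kernel_op P ^^ k) f)"
  by (induction k) (auto intro: integrable_kernel_op)

lemma integral_kernel_op_pow: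
  "integrable \<mu> f \<Longrightarrow> (\<integral>x. (kernel_op P ^^ k) f x \<partial>\<mu>) = (\<integral>x. f x \<partial>\<mu>)"
  by (induction k) (auto simp: integral_kernel_op integrable_kernel_op_pow)

lemma kernel_op_diff:
  "integrable \<mu> f \<Longrightarrow> integrable \<mu> g \<Longrightarrow>
    kernel_op P (\<lambda>y. f y - g y) = (\<lambda>x. kernel_op P f x - kernel_op P g x)"
  by (auto simp: kernel_op_def integrable_kernel)

lemma kernel_op_const: "kernel_op P (\<lambda>_. c) = (\<lambda>_. c)"
  using P.prob_space by (auto simp: kernel_op_def)

lemma kernel_op_mono:
  "integrable \<mu> f \<Longrightarrow> integrable \<mu> g \<Longrightarrow> (\<And>y. f y \<le> g y) \<Longrightarrow> kernel_op P f x \<le> kernel_op P g x"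
  unfolding kernel_op_def by (intro integral_mono integrable_kernel)

lemma kernel_op_abs_le:
  "integrable \<mu> f \<Longrightarrow> \<bar>kernel_op P f x\<bar> \<le> kernel_op P (\<lambda>y. \<bar>f y\<bar>) x"
  unfolding kernel_op_def by (rule integral_abs_bound)

lemma integrable_square_imp_integrable:
  fixes f :: "'a \<Rightarrow> real"
  assumes [measurable]: "f \<in> borel_measurable borel" and "integrable \<mu> (\<lambda>x. (f x)\<^sup>2)"
  shows "integrable \<mu> f"
proof (rule Bochner_Integration.integrable_bound)
  show "integrable \<mu> (\<lambda>x. 1 + (f x)\<^sup>2)"
    using assms(2) by (intro Bochner_Integration.integrable_add) auto
  have "\<bar>t\<bar> \<le> 1 + t\<^sup>2" for t :: real
  proof -
    have "2 * \<bar>t\<bar> \<le> 1 + t\<^sup>2"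
      using zero_le_power2[of "1 - \<bar>t\<bar>"] by (simp add: power2_diff)
    then show ?thesis by linarith
  qed
  then show "AE x in \<mu>. norm (f x) \<le> norm (1 + (f x)\<^sup>2)"
    by simp
qed simp

text \<open>
  The difference of the two sides is the variance of \<open>f\<close> under \<open>P x\<close>.
\<close>

lemma kernel_op_square_le:
  assumes [measurable]: "f \<in> borel_measurable borel" and f2: "integrable \<mu> (\<lambda>x. (f x)\<^sup>2)"
  shows "(kernel_op P f x)\<^sup>2 \<le> kernel_op P (\<lambda>y. (f y)\<^sup>2) x"
proof -
  have f: "integrable \<mu> f"
    using assms by (rule integrable_square_imp_integrable)
  have "P.variance x f = kernel_op P (\<lambda>y. (f y)\<^sup>2) x - (kernel_op P f x)\<^sup>2"
    unfolding kernel_op_def by (intro P.variance_eq integrable_kernel f f2)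
  moreover have "0 \<le> P.variance x f"
    by simp
  ultimately show ?thesis
    by linarith
qed

lemma integral_kernel_op_square_le:
  fixes f :: "'a \<Rightarrow> real"
  assumes [measurable]: "f \<in> borel_measurable borel" and f2: "integrable \<mu> (\<lambda>x. (f x)\<^sup>2)"
  shows "(\<integral>x. (kernel_op P f x)\<^sup>2 \<partial>\<mu>) \<le> (\<integral>x. (f x)\<^sup>2 \<partial>\<mu>)"
proof -
  have "integrable \<mu> (\<lambda>x. (kernel_op P f x)\<^sup>2)"
    by (rule Bochner_Integration.integrable_bound[OF integrable_kernel_op[OF f2]])
      (use order_trans[OF kernel_op_square_le[OF assms] abs_ge_self] in auto)
  then have "(\<integral>x. (kernel_op P f x)\<^sup>2 \<partial>\<mu>) \<le> (\<integral>x. kernel_op P (\<lambda>y. (f y)\<^sup>2) x \<partial>\<mu>)"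
    using kernel_op_square_le[OF assms] integrable_kernel_op[OF f2] by (intro integral_mono) auto
  then show ?thesis
    by (simp add: integral_kernel_op[OF f2])
qed

end

section \<open>Functions dominated by a multiple of the drift function\<close>

text \<open>
  Membership in \<^const>\<open>LV\<close> in a form that avoids division by \<open>V\<close>.
\<close>

definition V_bounded :: "('a \<Rightarrow> real) \<Rightarrow> ('a::topological_space \<Rightarrow> real) \<Rightarrow> bool" where
  "V_bounded V f \<longleftrightarrow> f \<in> borel_measurable borel \<and> (\<exists>c\<ge>0. \<forall>x. \<bar>f x\<bar> \<le> c * V x)"

lemma V_bounded_measurable: "V_bounded V f \<Longrightarrow> f \<in> borel_measurable borel"
  by (simp add: V_bounded_def)

lemma V_boundedI: "f \<in> borel_measurable borel \<Longrightarrow> 0 \<le> c \<Longrightarrow> (\<And>x. \<bar>f x\<bar> \<le> c * V x) \<Longrightarrow> V_bounded V f"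
  by (auto simp: V_bounded_def)

lemma V_bounded_add: "V_bounded V f \<Longrightarrow> V_bounded V g \<Longrightarrow> V_bounded V (\<lambda>x. f x + g x)"
proof -
  assume f: "V_bounded V f" and g: "V_bounded V g"
  obtain c where c: "0 \<le> c" "\<And>x. \<bar>f x\<bar> \<le> c * V x"
    using f unfolding V_bounded_def by blast
  obtain d where d: "0 \<le> d" "\<And>x. \<bar>g x\<bar> \<le> d * V x"
    using g unfolding V_bounded_def by blast
  note cd = c d
  note [measurable] = V_bounded_measurable[OF f] V_bounded_measurable[OF g]
  have "\<bar>f x + g x\<bar> \<le> (c + d) * V x" for x
    using cd(2,4)[of x] by (simp add: distrib_right)
  then show ?thesis
    using cd by (intro V_boundedI[of _ "c + d"]) auto
qed

lemma V_bounded_cmult: "V_bounded V f \<Longrightarrow> V_bounded V (\<lambda>x. c * f x)"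
proof -
  assume f: "V_bounded V f"
  obtain d where d: "0 \<le> d" "\<And>x. \<bar>f x\<bar> \<le> d * V x"
    using f unfolding V_bounded_def by blast
  note [measurable] = V_bounded_measurable[OF f]
  have "\<bar>c * f x\<bar> \<le> (\<bar>c\<bar> * d) * V x" for x
    using mult_left_mono[OF d(2)[of x], of "\<bar>c\<bar>"] by (simp add: abs_mult mult.assoc)
  then show ?thesis
    using d by (intro V_boundedI[of _ "\<bar>c\<bar> * d"]) auto
qed

lemma V_bounded_diff: "V_bounded V f \<Longrightarrow> V_bounded V g \<Longrightarrow> V_bounded V (\<lambda>x. f x - g x)"
  using V_bounded_add[of V f "\<lambda>x. (-1) * g x"] V_bounded_cmult[of V g "-1"] by simp

section \<open>Geometric ergodicity and Poisson's equation\<close>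

text \<open>
  What remains of drift and minorisation once they have been turned into a contraction.
\<close>

locale ergodic_kernel = stationary_kernel P \<mu>
  for P :: "'a::euclidean_space \<Rightarrow> 'a measure" and \<mu> +
  fixes V :: "'a \<Rightarrow> real" and \<beta> \<rho> D :: real
  assumes V_measurable [measurable]: "V \<in> borel_measurable borel"
    and V_ge_1: "\<And>x. 1 \<le> V x"
    and V_square_integrable: "integrable \<mu> (\<lambda>x. (V x)\<^sup>2)"
    and kernel_V_le: "\<And>x. kernel_op P V x \<le> D * V x"
    and \<beta>_pos: "0 < \<beta>" and \<rho>_nonneg: "0 \<le> \<rho>" and \<rho>_less_1: "\<rho> < 1"
    and contraction: "\<And>\<phi> L x y. \<phi> \<in> borel_measurable borel \<Longrightarrow> 0 \<le> L \<Longrightarrow>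
      (\<And>x y. \<bar>\<phi> x - \<phi> y\<bar> \<le> L * osc_weight \<beta> V x y) \<Longrightarrow>
      \<bar>kernel_op P \<phi> x - kernel_op P \<phi> y\<bar> \<le> \<rho> * (L * osc_weight \<beta> V x y)"
begin

lemma V_integrable: "integrable \<mu> V"
  by (rule integrable_square_imp_integrable[OF V_measurable V_square_integrable])

lemma V_nonneg: "0 \<le> V x"
  using V_ge_1[of x] by simp

lemma D_nonneg: "0 \<le> D"
proof -
  have "0 \<le> kernel_op P V x" for x
    unfolding kernel_op_def using V_nonneg by simp
  then have "0 \<le> D * V x" for x
    using kernel_V_le[of x] by (rule order_trans)
  moreover have "0 < V x" for x
    using V_ge_1[of x] by linarith
  ultimately show ?thesis
    by (meson zero_le_mult_iff not_le)
qed

lemma integrable_mult_V_bounded: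
  assumes f: "V_bounded V f" and g: "V_bounded V g"
  shows "integrable \<mu> (\<lambda>x. f x * g x)"
proof -
  obtain c where c: "0 \<le> c" "\<And>x. \<bar>f x\<bar> \<le> c * V x"
    using f unfolding V_bounded_def by blast
  obtain d where d: "0 \<le> d" "\<And>x. \<bar>g x\<bar> \<le> d * V x"
    using g unfolding V_bounded_def by blast
  note cd = c d
  note [measurable] = V_bounded_measurable[OF f] V_bounded_measurable[OF g]
  have "\<bar>f x * g x\<bar> \<le> (c * d) * (V x)\<^sup>2" for x
  proof -
    have "\<bar>f x * g x\<bar> \<le> (c * V x) * (d * V x)"
      unfolding abs_mult using cd V_nonneg by (intro mult_mono) auto
    then show ?thesis
      by (simp add: power2_eq_square mult_ac)
  qed
  then show ?thesis
    by (intro Bochner_Integration.integrable_bound[OF integrable_mult_right[OF V_square_integrable, of "c * d"]])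
      (auto intro: order_trans[OF _ abs_ge_self])
qed

lemma integrable_V_bounded_square: "V_bounded V f \<Longrightarrow> integrable \<mu> (\<lambda>x. (f x)\<^sup>2)"
  using integrable_mult_V_bounded[of f f] by (simp add: power2_eq_square)

lemma integrable_V_bounded: "V_bounded V f \<Longrightarrow> integrable \<mu> f"
  by (rule integrable_square_imp_integrable[OF V_bounded_measurable integrable_V_bounded_square])

lemma V_bounded_const: "V_bounded V (\<lambda>_. c)"
  using mult_left_mono[OF V_ge_1, of "\<bar>c\<bar>"] by (intro V_boundedI[of _ "\<bar>c\<bar>"]) auto

lemma kernel_op_V_bound:
  assumes [measurable]: "f \<in> borel_measurable borel" and c: "0 \<le> c" "\<And>x. \<bar>f x\<bar> \<le> c * V x"
  shows "\<bar>kernel_op P f x\<bar> \<le> c * D * V x"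
proof -
  have f: "integrable \<mu> f"
    using c by (intro integrable_V_bounded V_boundedI) auto
  have "\<bar>kernel_op P f x\<bar> \<le> kernel_op P (\<lambda>y. \<bar>f y\<bar>) x"
    by (rule kernel_op_abs_le[OF f])
  also have "\<dots> \<le> kernel_op P (\<lambda>y. c * V y) x"
    using c(2) by (intro kernel_op_mono integrable_mult_right V_integrable integrable_abs f) auto
  also have "\<dots> = c * kernel_op P V x"
    by (simp add: kernel_op_def)
  also have "\<dots> \<le> c * (D * V x)"
    by (intro mult_left_mono kernel_V_le c)
  finally show ?thesis
    by (simp add: mult.assoc)
qed

lemma V_bounded_kernel_op:
  assumes f: "V_bounded V f"
  shows "V_bounded V (kernel_op P f)"
proof -
  note [measurable] = V_bounded_measurable[OF f]
  obtain c where c: "0 \<le> c" "\<And>x. \<bar>f x\<bar> \<le> c * V x"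
    using f unfolding V_bounded_def by blast
  show ?thesis
    using kernel_op_V_bound[OF _ c] c D_nonneg by (intro V_boundedI[of _ "c * D"]) auto
qed

lemma V_bounded_kernel_op_pow: "V_bounded V f \<Longrightarrow> V_bounded V ((kernel_op P ^^ k) f)"
  by (induction k) (auto intro: V_bounded_kernel_op)

lemma contraction_pow:
  assumes [measurable]: "\<phi> \<in> borel_measurable borel" and L: "0 \<le> L"
    and \<phi>: "\<And>x y. \<bar>\<phi> x - \<phi> y\<bar> \<le> L * osc_weight \<beta> V x y"
  shows "\<bar>(kernel_op P ^^ k) \<phi> x - (kernel_op P ^^ k) \<phi> y\<bar> \<le> \<rho> ^ k * L * osc_weight \<beta> V x y"
proof (induction k arbitrary: x y)
  case 0
  then show ?case using \<phi> by simp
next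
  case (Suc k)
  then show ?case
    using contraction[OF measurable_kernel_op_pow[of \<phi>], where L="\<rho> ^ k * L"] L \<rho>_nonneg
    by (simp add: mult_ac)
qed

text \<open>
  Since \<open>P\<^sup>k f\<close> has mean zero, its value at \<open>x\<close> is the mean over \<open>y\<close> of its oscillation between
  \<open>x\<close> and \<open>y\<close>, and that has contracted \<open>k\<close> times.
\<close>

lemma geometric_decay:
  assumes f: "V_bounded V f" and zero: "(\<integral>x. f x \<partial>\<mu>) = 0"
  shows "\<exists>C\<ge>0. \<forall>k x. \<bar>(kernel_op P ^^ k) f x\<bar> \<le> C * \<rho> ^ k * V x"
proof -
  note [measurable] = V_bounded_measurable[OF f]
  obtain c where c: "0 \<le> c" "\<And>x. \<bar>f x\<bar> \<le> c * V x"
    using f unfolding V_bounded_def by blast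
  (* The oscillation of f is measured by osc_weight through its part with V. *)
  define L where "L = c / \<beta>"
  have L: "0 \<le> L" and c_eq: "c = L * \<beta>"
    using c \<beta>_pos by (auto simp: L_def)
  have osc: "\<bar>f x - f y\<bar> \<le> L * osc_weight \<beta> V x y" for x y
    using c(2)[of x] c(2)[of y] L by (simp add: c_eq osc_weight_def algebra_simps)
  define C where "C = L * (2 + \<beta> + \<beta> * (\<integral>x. V x \<partial>\<mu>))"
  have EV: "0 \<le> (\<integral>x. V x \<partial>\<mu>)"
    using V_nonneg by simp
  have "\<bar>(kernel_op P ^^ k) f x\<bar> \<le> C * \<rho> ^ k * V x" for k x
  proof -
    let ?f = "(kernel_op P ^^ k) f"
    have int: "integrable \<mu> ?f"
      by (intro integrable_V_bounded V_bounded_kernel_op_pow f)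
    have zero': "(\<integral>y. ?f y \<partial>\<mu>) = 0"
      using integral_kernel_op_pow[OF integrable_V_bounded[OF f], of k] zero by simp
    have "?f x = (\<integral>y. ?f x - ?f y \<partial>\<mu>)"
      using int zero' \<mu>.prob_space by simp
    then have "\<bar>?f x\<bar> \<le> (\<integral>y. \<bar>?f x - ?f y\<bar> \<partial>\<mu>)"
      using integral_abs_bound[of \<mu> "\<lambda>y. ?f x - ?f y"] by simp
    also have "\<dots> \<le> (\<integral>y. \<rho> ^ k * L * osc_weight \<beta> V x y \<partial>\<mu>)"
      using contraction_pow[of f L k x] osc L int V_integrable
      by (intro integral_mono) (auto simp: osc_weight_def)
    also have "\<dots> = \<rho> ^ k * L * (2 + \<beta> * V x + \<beta> * (\<integral>y. V y \<partial>\<mu>))"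
      using V_integrable \<mu>.prob_space by (simp add: osc_weight_def)
    also have "\<dots> \<le> \<rho> ^ k * L * ((2 + \<beta> + \<beta> * (\<integral>x. V x \<partial>\<mu>)) * V x)"
    proof (intro mult_left_mono)
      have "2 + \<beta> * (\<integral>y. V y \<partial>\<mu>) \<le> (2 + \<beta> * (\<integral>y. V y \<partial>\<mu>)) * V x"
        using mult_left_mono[OF V_ge_1[of x], of "2 + \<beta> * (\<integral>y. V y \<partial>\<mu>)"]
          mult_nonneg_nonneg[OF less_imp_le[OF \<beta>_pos] EV] by simp
      then show "2 + \<beta> * V x + \<beta> * (\<integral>y. V y \<partial>\<mu>) \<le> (2 + \<beta> + \<beta> * (\<integral>x. V x \<partial>\<mu>)) * V x"
        by (simp add: distrib_right)
    qed (use \<rho>_nonneg L in auto)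
    finally show ?thesis
      by (simp add: C_def mult_ac)
  qed
  moreover have "0 \<le> C"
    unfolding C_def using L EV \<beta>_pos by (intro mult_nonneg_nonneg add_nonneg_nonneg) auto
  ultimately show ?thesis
    by blast
qed

text \<open>
  The solution is the series of all \<open>P\<^sup>k f\<close>, which geometric decay makes convergent.
\<close>

lemma poisson_equation:
  assumes f: "V_bounded V f" and zero: "(\<integral>x. f x \<partial>\<mu>) = 0"
  shows "\<exists>u. V_bounded V u \<and> (\<integral>x. u x \<partial>\<mu>) = 0 \<and> (\<forall>x. u x - kernel_op P u x = f x)"
proof -
  note [measurable] = V_bounded_measurable[OF f]
  let ?f = "\<lambda>k. (kernel_op P ^^ k) f"
  obtain C where C: "0 \<le> C" "\<And>k x. \<bar>?f k x\<bar> \<le> C * \<rho> ^ k * V x"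
    using geometric_decay[OF assms] by blast
  have geo: "summable (\<lambda>k. C * \<rho> ^ k * v)" for v
    using \<rho>_nonneg \<rho>_less_1 by (intro summable_mult summable_mult2 summable_geometric) auto
  have sum_abs: "summable (\<lambda>k. \<bar>?f k x\<bar>)" for x
    by (rule summable_comparison_test[OF _ geo[of "V x"]]) (use C in auto)
  then have sum: "summable (\<lambda>k. ?f k x)" for x
    by (rule summable_rabs_cancel)
  define u where "u = (\<lambda>x. \<Sum>k. ?f k x)"
  have [measurable]: "?f k \<in> borel_measurable borel" for k
    by (intro measurable_kernel_op_pow) simp
  have [measurable]: "u \<in> borel_measurable borel"
    unfolding u_def by measurable
  have u_le: "\<bar>u x\<bar> \<le> (C * (1 / (1 - \<rho>))) * V x" for x
  proof -
    have "\<bar>u x\<bar> \<le> (\<Sum>k. \<bar>?f k x\<bar>)"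
      unfolding u_def by (rule summable_rabs[OF sum_abs])
    also have "\<dots> \<le> (\<Sum>k. C * \<rho> ^ k * V x)"
      by (intro suminf_le C sum_abs geo)
    also have "\<dots> = C * (\<Sum>k. \<rho> ^ k) * V x"
      using \<rho>_nonneg \<rho>_less_1 by (simp add: suminf_mult suminf_mult2[symmetric] summable_geometric summable_mult)
    also have "(\<Sum>k. \<rho> ^ k) = 1 / (1 - \<rho>)"
      using \<rho>_nonneg \<rho>_less_1 by (intro suminf_geometric) auto
    finally show ?thesis .
  qed
  have u: "V_bounded V u"
    using u_le C(1) \<rho>_less_1 by (intro V_boundedI[of _ "C * (1 / (1 - \<rho>))"]) auto
  have int: "integrable \<mu> (?f k)" for k
    by (intro integrable_V_bounded V_bounded_kernel_op_pow f)
  have swap: "(\<integral>y. u y \<partial>N) = (\<Sum>k. \<integral>y. ?f k y \<partial>N)"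
    if N: "\<And>g::'a \<Rightarrow> real. integrable \<mu> g \<Longrightarrow> integrable N g" for N
    unfolding u_def
  proof (rule integral_suminf)
    show "summable (\<lambda>k. \<integral>x. norm (?f k x) \<partial>N)"
    proof (rule summable_comparison_test[OF _ geo[of "\<integral>x. V x \<partial>N"]], intro exI allI impI)
      fix k
      have "(\<integral>x. \<bar>?f k x\<bar> \<partial>N) \<le> (\<integral>x. C * \<rho> ^ k * V x \<partial>N)"
        using C N int V_integrable by (intro integral_mono) auto
      then show "norm (\<integral>x. norm (?f k x) \<partial>N) \<le> C * \<rho> ^ k * (\<integral>x. V x \<partial>N)"
        by simp
    qed
  qed (use N int sum_abs in auto)
  have Pu: "kernel_op P u x = (\<Sum>k. ?f (Suc k) x)" for x
    using swap[OF integrable_kernel, of x] by (simp add: kernel_op_def[of P u] kernel_op_def[of P "?f _"])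
  have "u x - kernel_op P u x = f x" for x
    unfolding Pu using suminf_split_head[OF sum[of x]] by (simp add: u_def)
  moreover have "(\<integral>x. u x \<partial>\<mu>) = 0"
    using swap[of \<mu>] integral_kernel_op_pow[OF integrable_V_bounded[OF f]] zero by simp
  ultimately show ?thesis
    using u by blast
qed

end

section \<open>The tilted transition operator\<close>

text \<open>
  The \<open>k\<close>-th power applied to the constant 1 is, as a function of the starting point, the
  characteristic function at \<open>\<theta>\<close> of the sum of \<open>H\<close> over the first \<open>k\<close> steps.
\<close>

definition tilted_op ::
  "('a::topological_space \<Rightarrow> 'a measure) \<Rightarrow> ('a \<Rightarrow> real) \<Rightarrow> real \<Rightarrow> ('a \<Rightarrow> complex) \<Rightarrow> 'a \<Rightarrow> complex" where
  "tilted_op P H \<theta> g x = (\<integral>y. iexp (\<theta> * H y) * g y \<partial>P x)"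

lemma norm_iexp_minus_1: "cmod (iexp z - 1) \<le> 2 * min 1 \<bar>z\<bar>"
proof -
  have "cmod (iexp z - 1) \<le> 2 * \<bar>z\<bar>" "cmod (iexp z - 1) \<le> 2"
    using iexp_approx1[of z 0] iexp_approx2[of z 0] abs_ge_zero[of z] by simp_all
  then show ?thesis
    by (auto simp: min_def)
qed

lemma norm_iexp_taylor1: "cmod (iexp z - 1 - \<i> * z) \<le> 2 * \<bar>z\<bar> * min 1 \<bar>z\<bar>"
proof -
  have "cmod (iexp z - 1 - \<i> * z) \<le> \<bar>z\<bar>\<^sup>2 / 2" "cmod (iexp z - 1 - \<i> * z) \<le> 2 * \<bar>z\<bar>"
    using iexp_approx1[of z 1] iexp_approx2[of z 1]
    by (simp_all add: diff_diff_eq eval_nat_numeral)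
  moreover have "\<bar>z\<bar>\<^sup>2 / 2 \<le> 2 * \<bar>z\<bar> * \<bar>z\<bar>"
    by (simp add: power2_eq_square)
  ultimately show ?thesis
    by (auto simp: min_def)
qed

lemma norm_iexp_taylor2: "cmod (iexp z - 1 - \<i> * z + (complex_of_real z)\<^sup>2 / 2) \<le> z\<^sup>2 * min 1 \<bar>z\<bar>"
proof -
  have eq: "(\<Sum>k\<le>2. (\<i> * complex_of_real z) ^ k / fact k) = 1 + \<i> * z - (complex_of_real z)\<^sup>2 / 2"
    by (simp add: eval_nat_numeral algebra_simps)
  have "cmod (iexp z - 1 - \<i> * z + (complex_of_real z)\<^sup>2 / 2) \<le> \<bar>z\<bar> ^ 3 / 6"
    "cmod (iexp z - 1 - \<i> * z + (complex_of_real z)\<^sup>2 / 2) \<le> z\<^sup>2"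
    using iexp_approx1[of z 2, unfolded eq] iexp_approx2[of z 2, unfolded eq]
    by (simp_all add: algebra_simps fact_numeral)
  moreover have "\<bar>z\<bar> ^ 3 / 6 \<le> z\<^sup>2 * \<bar>z\<bar>"
  proof -
    have "\<bar>z\<bar> ^ 3 = z\<^sup>2 * \<bar>z\<bar>"
      by (simp add: power3_eq_cube power2_eq_square)
    moreover have "0 \<le> z\<^sup>2 * \<bar>z\<bar>"
      by simp
    ultimately show ?thesis by linarith
  qed
  ultimately show ?thesis
    by (auto simp: min_def)
qed

text \<open>
  The expansion, at one point, of \<open>exp (\<i> \<theta> H) (1 + \<i> \<theta> u + \<theta>\<^sup>2 w) - (1 - s \<theta>\<^sup>2 / 2) (1 + \<i> \<theta> (H + u) + \<theta>\<^sup>2 w')\<close>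
  up to the second order. The orders 0 and 1 cancel, and order 2 leaves the first term on the
  right. The factors \<open>min 1 \<bar>\<theta> * H\<bar>\<close> replace a third moment: they are
  bounded, and they tend to 0 with \<open>\<theta>\<close>.
\<close>

lemma quasi_eigenfunction_pointwise:
  fixes \<theta> H u w w' s W :: real
  assumes \<theta>: "\<bar>\<theta>\<bar> \<le> 1" and s: "0 \<le> s" and w: "\<bar>w\<bar> \<le> W" "\<bar>w'\<bar> \<le> W"
  shows "cmod (iexp (\<theta> * H) * (1 + \<i> * \<theta> * u + \<theta>\<^sup>2 * w)
        - (1 - s * \<theta>\<^sup>2 / 2) * (1 + \<i> * \<theta> * (H + u) + \<theta>\<^sup>2 * w'))
    \<le> \<theta>\<^sup>2 * (\<bar>(w' - w) - (s - ((H + u)\<^sup>2 - u\<^sup>2)) / 2\<bar>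
        + (H\<^sup>2 + 2 * \<bar>u * H\<bar> + 2 * W) * min 1 \<bar>\<theta> * H\<bar> + s * \<bar>\<theta>\<bar> * (\<bar>H + u\<bar> + W))"
    (is "cmod ?A \<le> \<theta>\<^sup>2 * (\<bar>?d\<bar> + _ * ?m + _)")
proof -
  define z e where "z = \<theta> * H" and "e = iexp z"
  have split: "?A = (e - 1 - \<i> * z + (complex_of_real z)\<^sup>2 / 2) + \<i> * \<theta> * u * (e - 1 - \<i> * z)
      + \<theta>\<^sup>2 * w * (e - 1) - \<theta>\<^sup>2 * ?d + s * \<theta>\<^sup>2 / 2 * (\<i> * \<theta> * (H + u) + \<theta>\<^sup>2 * w')"
  proof -
    have "iexp (\<theta> * H) = e"
      by (simp add: e_def z_def)
    then show ?thesis
      by (simp only:) (simp add: z_def power2_eq_square field_simps complex_eq_iff)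
  qed
  have W: "0 \<le> W"
    using w by linarith
  have b1: "cmod (e - 1 - \<i> * z + (complex_of_real z)\<^sup>2 / 2) \<le> \<theta>\<^sup>2 * (H\<^sup>2 * ?m)"
    using norm_iexp_taylor2[of z] by (simp add: e_def z_def power_mult_distrib mult.assoc)
  have b2: "cmod (\<i> * \<theta> * u * (e - 1 - \<i> * z)) \<le> \<theta>\<^sup>2 * (2 * \<bar>u * H\<bar> * ?m)"
  proof -
    have "cmod (\<i> * \<theta> * u * (e - 1 - \<i> * z)) \<le> \<bar>\<theta>\<bar> * \<bar>u\<bar> * (2 * \<bar>z\<bar> * min 1 \<bar>z\<bar>)"
      unfolding e_def using norm_iexp_taylor1[of z] by (simp add: norm_mult mult_left_mono)
    also have "\<dots> = \<theta>\<^sup>2 * (2 * \<bar>u * H\<bar> * ?m)"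
      by (simp add: z_def abs_mult power2_eq_square mult_ac flip: power2_abs)
    finally show ?thesis .
  qed
  have b3: "cmod (\<theta>\<^sup>2 * w * (e - 1)) \<le> \<theta>\<^sup>2 * (2 * W * ?m)"
  proof -
    have "cmod (\<theta>\<^sup>2 * w * (e - 1)) = \<theta>\<^sup>2 * (\<bar>w\<bar> * cmod (e - 1))"
      by (simp add: norm_mult norm_power mult.assoc)
    also have "\<dots> \<le> \<theta>\<^sup>2 * (W * (2 * min 1 \<bar>z\<bar>))"
      unfolding e_def by (intro mult_left_mono mult_mono w norm_iexp_minus_1 W) auto
    finally show ?thesis
      by (simp add: z_def mult_ac)
  qed
  have b4: "cmod (s * \<theta>\<^sup>2 / 2 * (\<i> * \<theta> * (H + u) + \<theta>\<^sup>2 * w')) \<le> \<theta>\<^sup>2 * (s * \<bar>\<theta>\<bar> * (\<bar>H + u\<bar> + W))"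
  proof -
    have "\<theta>\<^sup>2 \<le> \<bar>\<theta>\<bar>"
      using mult_left_mono[OF \<theta>, of "\<bar>\<theta>\<bar>"] by (simp add: power2_eq_square flip: abs_mult)
    then have "\<theta>\<^sup>2 * \<bar>w'\<bar> \<le> \<bar>\<theta>\<bar> * W"
      using w by (intro mult_mono) auto
    moreover have "cmod (\<i> * \<theta> * (H + u) + \<theta>\<^sup>2 * w') \<le> cmod (\<i> * \<theta> * (H + u)) + cmod (\<theta>\<^sup>2 * w')"
      by (rule norm_triangle_ineq)
    moreover have "cmod (\<i> * \<theta> * (H + u)) = \<bar>\<theta>\<bar> * \<bar>H + u\<bar>" "cmod (\<theta>\<^sup>2 * w') = \<theta>\<^sup>2 * \<bar>w'\<bar>"
      by (simp_all add: norm_mult norm_power flip: of_real_add)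
    ultimately have "cmod (\<i> * \<theta> * (H + u) + \<theta>\<^sup>2 * w') \<le> \<bar>\<theta>\<bar> * (\<bar>H + u\<bar> + W)"
      by (simp add: distrib_left)
    then have "s * \<theta>\<^sup>2 / 2 * cmod (\<i> * \<theta> * (H + u) + \<theta>\<^sup>2 * w') \<le> s * \<theta>\<^sup>2 * (\<bar>\<theta>\<bar> * (\<bar>H + u\<bar> + W))"
      using s W by (intro mult_mono) auto
    moreover have "cmod (s * \<theta>\<^sup>2 / 2 * (\<i> * \<theta> * (H + u) + \<theta>\<^sup>2 * w'))
        = s * \<theta>\<^sup>2 / 2 * cmod (\<i> * \<theta> * (H + u) + \<theta>\<^sup>2 * w')"
      using s by (simp add: norm_mult norm_divide norm_power)
    ultimately show ?thesis
      by (simp add: mult_ac)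
  qed
  have b5: "cmod (\<theta>\<^sup>2 * ?d) = \<theta>\<^sup>2 * \<bar>?d\<bar>"
    by (simp only: norm_of_real abs_mult) simp
  have tri: "cmod (a + b + c - d + f) \<le> cmod a + cmod b + cmod c + cmod d + cmod f" for a b c d f
    using norm_triangle_ineq[of "a + b + c - d" f] norm_triangle_ineq4[of "a + b + c" d]
      norm_triangle_ineq[of "a + b" c] norm_triangle_ineq[of a b] by linarith
  have "cmod ?A \<le> cmod (e - 1 - \<i> * z + (complex_of_real z)\<^sup>2 / 2) + cmod (\<i> * \<theta> * u * (e - 1 - \<i> * z))
      + cmod (\<theta>\<^sup>2 * w * (e - 1)) + cmod (\<theta>\<^sup>2 * ?d) + cmod (s * \<theta>\<^sup>2 / 2 * (\<i> * \<theta> * (H + u) + \<theta>\<^sup>2 * w'))"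
    unfolding split by (rule tri)
  also have "\<dots> \<le> \<theta>\<^sup>2 * (H\<^sup>2 * ?m) + \<theta>\<^sup>2 * (2 * \<bar>u * H\<bar> * ?m) + \<theta>\<^sup>2 * (2 * W * ?m) + \<theta>\<^sup>2 * \<bar>?d\<bar>
      + \<theta>\<^sup>2 * (s * \<bar>\<theta>\<bar> * (\<bar>H + u\<bar> + W))"
    by (intro add_mono b1 b2 b3 b4 eq_refl[OF b5])
  finally show ?thesis
    by (simp add: distrib_left distrib_right add_ac)
qed

context stationary_kernel
begin

context
  fixes H :: "'a \<Rightarrow> real"
  assumes H_measurable [measurable]: "H \<in> borel_measurable borel"
begin

lemma integrable_phase:
  assumes g: "integrable \<mu> g"
  shows "integrable \<mu> (\<lambda>y. iexp (\<theta> * H y) * g y)"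
proof -
  note [measurable] = integrable_stationary_imp_measurable[OF g]
  show ?thesis
    by (rule Bochner_Integration.integrable_bound[OF g]) (auto simp: norm_mult)
qed

lemma integrable_tilted: "integrable \<mu> g \<Longrightarrow> integrable \<mu> (tilted_op P H \<theta> g)"
  unfolding tilted_op_def[abs_def] by (intro integrable_kernel_integral integrable_phase)

lemma norm_tilted_le:
  assumes g: "integrable \<mu> g"
  shows "(\<integral>x. norm (tilted_op P H \<theta> g x) \<partial>\<mu>) \<le> (\<integral>x. norm (g x) \<partial>\<mu>)"
  using norm_kernel_integral_le[OF integrable_phase[OF g, of \<theta>]]
  by (simp add: tilted_op_def norm_mult)

lemma tilted_diff:
  "integrable \<mu> f \<Longrightarrow> integrable \<mu> g \<Longrightarrow>
    tilted_op P H \<theta> (\<lambda>y. f y - g y) x = tilted_op P H \<theta> f x - tilted_op P H \<theta> g x"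
  unfolding tilted_op_def right_diff_distrib
  by (intro Bochner_Integration.integral_diff integrable_kernel integrable_phase)

lemma tilted_cmult: "tilted_op P H \<theta> (\<lambda>y. c * g y) x = c * tilted_op P H \<theta> g x"
  by (simp add: tilted_op_def mult.left_commute[of _ c])

lemma integrable_tilted_pow: "integrable \<mu> g \<Longrightarrow> integrable \<mu> ((tilted_op P H \<theta> ^^ k) g)"
  by (induction k) (auto intro: integrable_tilted)

lemma norm_tilted_pow_le:
  "integrable \<mu> g \<Longrightarrow> (\<integral>x. norm ((tilted_op P H \<theta> ^^ k) g x) \<partial>\<mu>) \<le> (\<integral>x. norm (g x) \<partial>\<mu>)"
  by (induction k) (auto intro: order_trans[OF norm_tilted_le] integrable_tilted_pow)

lemma tilted_pow_diff:
  "integrable \<mu> f \<Longrightarrow> integrable \<mu> g \<Longrightarrow>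
    (tilted_op P H \<theta> ^^ k) (\<lambda>y. f y - g y) = (\<lambda>x. (tilted_op P H \<theta> ^^ k) f x - (tilted_op P H \<theta> ^^ k) g x)"
  by (induction k) (auto simp: tilted_diff integrable_tilted_pow)

lemma measurable_tilted [measurable (raw)]:
  "g \<in> borel_measurable borel \<Longrightarrow> tilted_op P H \<theta> g \<in> borel_measurable borel"
  unfolding tilted_op_def[abs_def] by (rule measurable_kernel_integral) measurable

lemma norm_tilted_bounded:
  assumes "g \<in> borel_measurable borel" "\<And>y. cmod (g y) \<le> B"
  shows "cmod (tilted_op P H \<theta> g x) \<le> B"
proof -
  note [measurable] = assms(1)
  have "integrable (P x) (\<lambda>y. iexp (\<theta> * H y) * g y)"
    using assms by (intro P.integrable_const_bound[where B=B]) (auto simp: norm_mult)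
  then have "cmod (tilted_op P H \<theta> g x) \<le> (\<integral>y. cmod (iexp (\<theta> * H y) * g y) \<partial>P x)"
    unfolding tilted_op_def by (intro integral_norm_bound)
  also have "\<dots> \<le> B"
    using assms by (intro P.integral_le_const P.integrable_const_bound[where B=B]) (auto simp: norm_mult)
  finally show ?thesis .
qed

lemma tilted_pow_bounded:
  assumes "g \<in> borel_measurable borel" "\<And>y. cmod (g y) \<le> B"
  shows "(tilted_op P H \<theta> ^^ k) g \<in> borel_measurable borel \<and> (\<forall>x. cmod ((tilted_op P H \<theta> ^^ k) g x) \<le> B)"
  using assms by (induction k) (auto intro!: measurable_tilted norm_tilted_bounded)

text \<open>
  The defect of an approximate eigenfunction accumulates at most linearly, as the tilted operator
  does not increase the norm of \<open>L\<^sup>1(\<mu>)\<close>.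
\<close>

lemma quasi_eigenfunction_pow:
  assumes h: "integrable \<mu> h" and \<kappa>: "cmod \<kappa> \<le> 1"
  shows "(\<integral>x. norm ((tilted_op P H \<theta> ^^ m) h x - \<kappa> ^ m * h x) \<partial>\<mu>)
    \<le> real m * (\<integral>x. norm (tilted_op P H \<theta> h x - \<kappa> * h x) \<partial>\<mu>)"
proof (induction m)
  case 0
  show ?case by simp
next
  case (Suc m)
  let ?T = "tilted_op P H \<theta>"
  have Tm: "integrable \<mu> ((?T ^^ m) h)" and T: "integrable \<mu> (?T h)"
    by (intro integrable_tilted_pow integrable_tilted h)+
  define d where "d = (\<lambda>x. (?T ^^ m) h x - \<kappa> ^ m * h x)"
  have d: "integrable \<mu> d"
    unfolding d_def using Tm h by auto
  have step: "(?T ^^ Suc m) h x - \<kappa> ^ Suc m * h x = ?T d x + \<kappa> ^ m * (?T h x - \<kappa> * h x)" for x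
  proof -
    have "?T d x = ?T ((?T ^^ m) h) x - \<kappa> ^ m * ?T h x"
      unfolding d_def using Tm h by (subst tilted_diff) (auto simp: tilted_cmult)
    then show ?thesis
      by (simp add: algebra_simps)
  qed
  have "(\<integral>x. norm ((?T ^^ Suc m) h x - \<kappa> ^ Suc m * h x) \<partial>\<mu>)
      \<le> (\<integral>x. norm (?T d x) + norm (?T h x - \<kappa> * h x) \<partial>\<mu>)"
  proof (rule integral_mono)
    show "integrable \<mu> (\<lambda>x. norm ((?T ^^ Suc m) h x - \<kappa> ^ Suc m * h x))"
      unfolding step using integrable_tilted[OF d] T h by auto
    show "integrable \<mu> (\<lambda>x. norm (?T d x) + norm (?T h x - \<kappa> * h x))"
      using integrable_tilted[OF d] T h by auto
    show "norm ((?T ^^ Suc m) h x - \<kappa> ^ Suc m * h x) \<le> norm (?T d x) + norm (?T h x - \<kappa> * h x)" for x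
    proof -
      have "norm (\<kappa> ^ m * (?T h x - \<kappa> * h x)) \<le> 1 * norm (?T h x - \<kappa> * h x)"
        unfolding norm_mult norm_power using \<kappa> by (intro mult_right_mono power_le_one) auto
      then show ?thesis
        unfolding step using norm_triangle_ineq[of "?T d x" "\<kappa> ^ m * (?T h x - \<kappa> * h x)"] by linarith
    qed
  qed
  also have "\<dots> = (\<integral>x. norm (?T d x) \<partial>\<mu>) + (\<integral>x. norm (?T h x - \<kappa> * h x) \<partial>\<mu>)"
    using integrable_tilted[OF d] T h by (intro Bochner_Integration.integral_add) auto
  also have "(\<integral>x. norm (?T d x) \<partial>\<mu>) \<le> real m * (\<integral>x. norm (?T h x - \<kappa> * h x) \<partial>\<mu>)"
    using norm_tilted_le[OF d] Suc.IH by (auto simp: d_def intro: order_trans)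
  finally show ?case
    by (simp add: algebra_simps)
qed

end

end

section \<open>Loss of memory of the tilted operator\<close>

context ergodic_kernel
begin

text \<open>
  For fixed \<open>r\<close> the tilt disappears with \<open>\<theta>\<close>: each step costs at most the integral of \<open>2 \<bar>\<theta> H\<bar>\<close>.
  The functional \<open>\<phi>\<close> stands for the real or the imaginary part, since contraction is about
  real-valued functions.
\<close>

lemma tilted_pow_near_kernel_pow:
  assumes H [measurable]: "H \<in> borel_measurable borel" and c: "0 \<le> c" "\<And>x. \<bar>H x\<bar> \<le> c * V x"
    and g [measurable]: "g \<in> borel_measurable borel" and g1: "\<And>y. cmod (g y) \<le> 1"
    and \<phi>: "bounded_linear \<phi>" and \<phi>1: "\<And>z. \<bar>\<phi> z\<bar> \<le> cmod z"
  shows "\<bar>\<phi> ((tilted_op P H \<theta> ^^ r) g x) - (kernel_op P ^^ r) (\<lambda>y. \<phi> (g y)) x\<bar>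
    \<le> \<bar>\<theta>\<bar> * (2 * c * (\<Sum>i<r. D ^ Suc i)) * V x"
proof (induction r arbitrary: x)
  case 0
  show ?case by simp
next
  case (Suc r)
  let ?T = "tilted_op P H \<theta>" and ?E = "2 * c * (\<Sum>i<r. D ^ Suc i)"
  have E: "0 \<le> ?E"
    using c D_nonneg by (simp add: sum_nonneg)
  define G where "G = (?T ^^ r) g"
  have G [measurable]: "G \<in> borel_measurable borel" and G1: "\<And>y. cmod (G y) \<le> 1"
    using tilted_pow_bounded[of H g 1 r \<theta>] g1 by (auto simp: G_def)
  interpret \<phi>: bounded_linear \<phi> by (rule \<phi>)
  have [measurable]: "(\<lambda>y. \<phi> (k y)) \<in> borel_measurable borel" if "k \<in> borel_measurable borel" for k :: "'a \<Rightarrow> complex"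
    using that by (rule borel_measurable_continuous_on[OF linear_continuous_on[OF \<phi>]])
  define F where "F = (\<lambda>y. \<phi> (iexp (\<theta> * H y) * G y))"
  define K where "K = (kernel_op P ^^ r) (\<lambda>y. \<phi> (g y))"
  have bounded_int: "integrable \<mu> k" if "k \<in> borel_measurable borel" "\<And>y. norm (k y) \<le> 1"
    for k :: "'a \<Rightarrow> 'b::{banach, second_countable_topology}"
    using that by (intro \<mu>.integrable_const_bound[where B=1]) (auto simp: measurable_stationary)
  have [measurable]: "F \<in> borel_measurable borel" and [measurable]: "K \<in> borel_measurable borel"
    unfolding F_def K_def by (measurable, intro measurable_kernel_op_pow, measurable)
  have F: "integrable \<mu> F"
    using G1 by (intro bounded_int) (auto simp: F_def norm_mult intro!: order_trans[OF \<phi>1])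
  have K: "integrable \<mu> K"
    unfolding K_def using g1
    by (intro integrable_kernel_op_pow bounded_int) (auto intro!: order_trans[OF \<phi>1])
  have "\<phi> ((?T ^^ Suc r) g x) = kernel_op P F x"
  proof -
    have "integrable \<mu> (\<lambda>y. iexp (\<theta> * H y) * G y)"
      using G1 by (intro bounded_int) (auto simp: norm_mult)
    then have "integrable (P x) (\<lambda>y. iexp (\<theta> * H y) * G y)"
      by (rule integrable_kernel)
    then show ?thesis
      by (simp add: tilted_op_def kernel_op_def F_def integral_bounded_linear[OF \<phi>] flip: G_def)
  qed
  then have "\<phi> ((?T ^^ Suc r) g x) - (kernel_op P ^^ Suc r) (\<lambda>y. \<phi> (g y)) x
      = kernel_op P (\<lambda>y. F y - K y) x"
    using F K by (simp add: kernel_op_diff flip: K_def)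
  moreover have "\<bar>kernel_op P (\<lambda>y. F y - K y) x\<bar> \<le> \<bar>\<theta>\<bar> * (2 * c + ?E) * D * V x"
  proof (rule kernel_op_V_bound)
    fix y
    have "\<bar>F y - \<phi> (G y)\<bar> = \<bar>\<phi> ((iexp (\<theta> * H y) - 1) * G y)\<bar>"
      by (simp add: F_def \<phi>.diff left_diff_distrib)
    also have "\<dots> \<le> cmod (iexp (\<theta> * H y) - 1) * cmod (G y)"
      using \<phi>1 by (simp add: norm_mult[symmetric])
    also have "\<dots> \<le> (2 * \<bar>\<theta> * H y\<bar>) * 1"
      using norm_iexp_minus_1[of "\<theta> * H y"] G1[of y]
      by (intro mult_mono) (auto simp: min_def split: if_splits)
    also have "\<dots> \<le> \<bar>\<theta>\<bar> * (2 * c) * V y"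
      using mult_left_mono[OF c(2)[of y], of "2 * \<bar>\<theta>\<bar>"] by (simp add: abs_mult mult_ac)
    moreover have "\<bar>\<phi> (G y) - K y\<bar> \<le> \<bar>\<theta>\<bar> * ?E * V y"
      unfolding G_def K_def by (rule Suc.IH)
    ultimately have "\<bar>F y - K y\<bar> \<le> \<bar>\<theta>\<bar> * (2 * c) * V y + \<bar>\<theta>\<bar> * ?E * V y"
      by linarith
    then show "\<bar>F y - K y\<bar> \<le> \<bar>\<theta>\<bar> * (2 * c + ?E) * V y"
      by (simp only: distrib_left distrib_right)
  qed (use c E in auto)
  moreover have "(2 * c + ?E) * D = 2 * c * (\<Sum>i<Suc r. D ^ Suc i)"
    by (simp add: sum.lessThan_Suc_shift sum_distrib_left algebra_simps del: sum.lessThan_Suc)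
  ultimately show ?case
    by (metis mult.assoc)
qed

text \<open>
  Already \<open>r\<close> applications, nearly untilted, contract the oscillation of the function they are applied to.
  The bound is uniform in \<open>g\<close>, so \<open>g\<close> may itself be the result of many further applications.
\<close>

lemma tilted_pow_oscillation:
  assumes H: "H \<in> borel_measurable borel" and c: "0 \<le> c" "\<And>x. \<bar>H x\<bar> \<le> c * V x"
    and g: "g \<in> borel_measurable borel" and g1: "\<And>y. cmod (g y) \<le> 1"
  shows "cmod ((tilted_op P H \<theta> ^^ r) g x - (tilted_op P H \<theta> ^^ r) g y)
    \<le> 2 * (\<bar>\<theta>\<bar> * (2 * c * (\<Sum>i<r. D ^ Suc i)) * (V x + V y) + \<rho> ^ r * osc_weight \<beta> V x y)"
    (is "cmod (?G x - ?G y) \<le> 2 * ?B")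
proof -
  have part: "\<bar>\<phi> (?G x - ?G y)\<bar> \<le> ?B"
    if \<phi>: "bounded_linear \<phi>" and \<phi>1: "\<And>z. \<bar>\<phi> z\<bar> \<le> cmod z" for \<phi>
  proof -
    interpret \<phi>: bounded_linear \<phi> by (rule \<phi>)
    let ?K = "(kernel_op P ^^ r) (\<lambda>y. \<phi> (g y))"
    have meas: "(\<lambda>y. \<phi> (g y)) \<in> borel_measurable borel"
      by (rule borel_measurable_continuous_on[OF linear_continuous_on[OF \<phi>] g])
    have "\<bar>\<phi> (g u) - \<phi> (g v)\<bar> \<le> 1 * osc_weight \<beta> V u v" for u v
      using \<phi>1[of "g u"] \<phi>1[of "g v"] g1[of u] g1[of v] mult_nonneg_nonneg[OF less_imp_le[OF \<beta>_pos] V_nonneg]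
      unfolding osc_weight_def by (smt (verit))
    then have "\<bar>?K x - ?K y\<bar> \<le> \<rho> ^ r * 1 * osc_weight \<beta> V x y"
      by (intro contraction_pow meas) auto
    then show ?thesis
      using tilted_pow_near_kernel_pow[OF H c g g1 \<phi> \<phi>1, of r \<theta> x]
        tilted_pow_near_kernel_pow[OF H c g g1 \<phi> \<phi>1, of r \<theta> y]
      by (simp add: \<phi>.diff distrib_left)
  qed
  have "cmod (?G x - ?G y) \<le> \<bar>Re (?G x - ?G y)\<bar> + \<bar>Im (?G x - ?G y)\<bar>"
    by (rule cmod_le)
  also have "\<dots> \<le> ?B + ?B"
    by (intro add_mono part bounded_linear_Re bounded_linear_Im abs_Re_le_cmod abs_Im_le_cmod)
  finally show ?thesis
    by (simp only: mult_2)
qed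

lemma tilted_pow_forgets_start:
  assumes H: "V_bounded V H" and \<theta>: "\<theta> \<longlonglongrightarrow> 0"
  shows "(\<lambda>k. (tilted_op P H (\<theta> k) ^^ k) (\<lambda>_. 1) x - (\<integral>y. (tilted_op P H (\<theta> k) ^^ k) (\<lambda>_. 1) y \<partial>\<mu>)) \<longlonglongrightarrow> 0"
    (is "(\<lambda>k. ?g k x - (\<integral>y. ?g k y \<partial>\<mu>)) \<longlonglongrightarrow> 0")
proof (rule LIMSEQ_I)
  fix e :: real assume e: "0 < e"
  note [measurable] = V_bounded_measurable[OF H]
  define A where "A = V x + (\<integral>y. V y \<partial>\<mu>)"
  define B where "B = 2 + \<beta> * V x + \<beta> * (\<integral>y. V y \<partial>\<mu>)"
  have EV: "0 \<le> (\<integral>y. V y \<partial>\<mu>)"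
    using V_nonneg by simp
  have B: "0 < B"
    using EV \<beta>_pos V_nonneg[of x] by (auto simp: B_def intro!: add_pos_nonneg)
  (* First fix the number r of nearly untilted steps, then let the tilt disappear. *)
  obtain r where r: "\<rho> ^ r < e / (4 * B)"
    using real_arch_pow_inv[of "e / (4 * B)" \<rho>] e B \<rho>_less_1 by auto
  obtain c where c: "0 \<le> c" "\<And>x. \<bar>H x\<bar> \<le> c * V x"
    using H unfolding V_bounded_def by blast
  define E where "E = 2 * c * (\<Sum>i<r. D ^ Suc i)"
  have "(\<lambda>k. 2 * (\<bar>\<theta> k\<bar> * E * A)) \<longlonglongrightarrow> 2 * (\<bar>0\<bar> * E * A)"
    by (intro tendsto_intros \<theta>)
  from order_tendstoD(2)[OF this, of "e / 2"] e
  have "eventually (\<lambda>k. 2 * (\<bar>\<theta> k\<bar> * E * A) < e / 2) sequentially"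
    by simp
  then obtain N where N: "\<And>k. N \<le> k \<Longrightarrow> 2 * (\<bar>\<theta> k\<bar> * E * A) < e / 2"
    by (auto simp: eventually_sequentially)
  show "\<exists>N. \<forall>k\<ge>N. norm (?g k x - (\<integral>y. ?g k y \<partial>\<mu>) - 0) < e"
  proof (intro exI allI impI)
    fix k assume k: "max N r \<le> k"
    let ?T = "tilted_op P H (\<theta> k)"
    define g where "g = (?T ^^ (k - r)) (\<lambda>_. 1)"
    have split: "?g k = (?T ^^ r) g"
    proof -
      have "?T ^^ k = ?T ^^ r \<circ> ?T ^^ (k - r)"
        using k by (subst funpow_add[symmetric]) simp
      then show ?thesis
        by (simp add: g_def)
    qed
    have g: "g \<in> borel_measurable borel" "\<And>y. cmod (g y) \<le> 1"
      using tilted_pow_bounded[of H "\<lambda>_. 1" 1 "k - r" "\<theta> k"] by (auto simp: g_def)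
    have gk: "?g k \<in> borel_measurable borel" "\<And>y. cmod (?g k y) \<le> 1"
      using tilted_pow_bounded[of H "\<lambda>_. 1" 1 k "\<theta> k"] by auto
    have int: "integrable \<mu> (?g k)"
      using gk by (intro \<mu>.integrable_const_bound[where B=1]) (auto simp: measurable_stationary)
    have "?g k x - (\<integral>y. ?g k y \<partial>\<mu>) = (\<integral>y. ?g k x - ?g k y \<partial>\<mu>)"
      using int \<mu>.prob_space by simp
    also have "norm \<dots> \<le> (\<integral>y. norm (?g k x - ?g k y) \<partial>\<mu>)"
      by (rule integral_norm_bound)
    also have "\<dots> \<le> (\<integral>y. 2 * (\<bar>\<theta> k\<bar> * E * (V x + V y) + \<rho> ^ r * osc_weight \<beta> V x y) \<partial>\<mu>)"
    proof (rule integral_mono)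
      show "integrable \<mu> (\<lambda>y. 2 * (\<bar>\<theta> k\<bar> * E * (V x + V y) + \<rho> ^ r * osc_weight \<beta> V x y))"
        using V_integrable by (auto simp: osc_weight_def)
      show "norm (?g k x - ?g k y) \<le> 2 * (\<bar>\<theta> k\<bar> * E * (V x + V y) + \<rho> ^ r * osc_weight \<beta> V x y)" for y
        unfolding split E_def by (intro tilted_pow_oscillation c g) simp
    qed (use int in auto)
    also have "\<dots> = 2 * (\<bar>\<theta> k\<bar> * E * A) + 2 * (\<rho> ^ r * B)"
      using V_integrable \<mu>.prob_space by (simp add: osc_weight_def A_def B_def algebra_simps)
    also have "\<dots> < e / 2 + e / 2"
      using N[of k] k r B by (intro add_strict_mono) (auto simp: field_simps)
    finally show "norm (?g k x - (\<integral>y. ?g k y \<partial>\<mu>) - 0) < e"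
      by simp
  qed
qed

section \<open>The stationary characteristic function\<close>

text \<open>
  On \<open>L\<^sup>1(\<mu>)\<close> Poisson's equation may have no solution, but it has bounded approximate ones: truncate
  and centre \<open>g\<close>, and stop the series that solves Poisson's equation for the result after finitely many
  terms.
\<close>

lemma approximate_poisson_bounded:
  assumes g: "integrable \<mu> g" and e: "0 < e"
  shows "\<exists>w W. w \<in> borel_measurable borel \<and> (\<forall>x. \<bar>w x\<bar> \<le> W) \<and>
    (\<integral>x. \<bar>(w x - kernel_op P w x) - (g x - (\<integral>y. g y \<partial>\<mu>))\<bar> \<partial>\<mu>) < e"
proof -
  note [measurable] = integrable_stationary_imp_measurable[OF g]
  define gt where "gt = (\<lambda>n x. if \<bar>g x\<bar> \<le> real n then g x else 0)"
  have [measurable]: "gt n \<in> borel_measurable borel" for n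
    unfolding gt_def by measurable
  have gt: "integrable \<mu> (gt n)" for n
    by (rule Bochner_Integration.integrable_bound[OF g]) (auto simp: gt_def)
  have "(\<lambda>n. \<integral>x. \<bar>g x - gt n x\<bar> \<partial>\<mu>) \<longlonglongrightarrow> (\<integral>x. 0 \<partial>\<mu>)"
  proof (rule integral_dominated_convergence[where w="\<lambda>x. \<bar>g x\<bar>"])
    show "AE x in \<mu>. (\<lambda>n. \<bar>g x - gt n x\<bar>) \<longlonglongrightarrow> 0"
    proof (rule AE_I2)
      fix x
      obtain N where N: "\<bar>g x\<bar> \<le> real N"
        using real_arch_simple by blast
      have "eventually (\<lambda>n. \<bar>g x - gt n x\<bar> = 0) sequentially"
        using eventually_ge_at_top[of N] by eventually_elim (use N in \<open>auto simp: gt_def\<close>)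
      then show "(\<lambda>n. \<bar>g x - gt n x\<bar>) \<longlonglongrightarrow> 0"
        by (rule tendsto_eventually)
    qed
  qed (use g in \<open>auto simp: gt_def\<close>)
  then have "eventually (\<lambda>n. (\<integral>x. \<bar>g x - gt n x\<bar> \<partial>\<mu>) < e / 4) sequentially"
    using e by (intro order_tendstoD) auto
  then obtain n where n: "(\<integral>x. \<bar>g x - gt n x\<bar> \<partial>\<mu>) < e / 4"
    by (auto simp: eventually_sequentially)
  define f where "f = (\<lambda>x. gt n x - (\<integral>y. gt n y \<partial>\<mu>))"
  define B where "B = real n + \<bar>\<integral>y. gt n y \<partial>\<mu>\<bar>"
  have [measurable]: "f \<in> borel_measurable borel"
    unfolding f_def by measurable
  have fB: "\<bar>f x\<bar> \<le> B" for x
    by (auto simp: f_def gt_def B_def)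
  have B: "0 \<le> B"
    by (simp add: B_def)
  have Vf: "V_bounded V f"
  proof (rule V_boundedI[of _ B])
    fix x
    show "\<bar>f x\<bar> \<le> B * V x"
      using fB[of x] mult_left_mono[OF V_ge_1[of x] B] by simp
  qed (use B in auto)
  have f0: "(\<integral>x. f x \<partial>\<mu>) = 0"
    using gt[of n] \<mu>.prob_space by (simp add: f_def)
  obtain C where C: "0 \<le> C" "\<And>k x. \<bar>(kernel_op P ^^ k) f x\<bar> \<le> C * \<rho> ^ k * V x"
    using geometric_decay[OF Vf f0] by blast
  define M where "M = C * (\<integral>x. V x \<partial>\<mu>) + 1"
  have M: "0 < M"
    using C V_nonneg by (auto simp: M_def intro!: add_nonneg_pos)
  obtain r where r: "\<rho> ^ r < e / (4 * M)"
    using real_arch_pow_inv[of "e / (4 * M)" \<rho>] e M \<rho>_less_1 by auto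
  define w where "w = (\<lambda>x. \<Sum>j<r. (kernel_op P ^^ j) f x)"
  have Pj [measurable]: "(kernel_op P ^^ j) f \<in> borel_measurable borel" for j
    by (intro measurable_kernel_op_pow) simp
  have int: "integrable \<mu> ((kernel_op P ^^ j) f)" for j
    by (intro integrable_V_bounded V_bounded_kernel_op_pow Vf)
  have PjB: "\<bar>(kernel_op P ^^ j) f x\<bar> \<le> B" for j x
  proof (induction j arbitrary: x)
    case (Suc j)
    have "\<bar>kernel_op P ((kernel_op P ^^ j) f) x\<bar> \<le> kernel_op P (\<lambda>y. \<bar>(kernel_op P ^^ j) f y\<bar>) x"
      by (rule kernel_op_abs_le[OF int])
    also have "\<dots> \<le> kernel_op P (\<lambda>_. B) x"
      using Suc int by (intro kernel_op_mono) auto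
    finally show ?case
      by (simp add: kernel_op_const)
  qed (use fB in simp)
  have Pw: "w x - kernel_op P w x = f x - (kernel_op P ^^ r) f x" for x
  proof -
    have "kernel_op P w x = (\<Sum>j<r. kernel_op P ((kernel_op P ^^ j) f) x)"
      unfolding w_def kernel_op_def[of P _ x]
      by (intro Bochner_Integration.integral_sum integrable_kernel int)
    then have "kernel_op P w x = (\<Sum>j<r. (kernel_op P ^^ Suc j) f x)"
      by simp
    moreover have "w x - (\<Sum>j<r. (kernel_op P ^^ Suc j) f x)
        = (\<Sum>j<r. (kernel_op P ^^ j) f x - (kernel_op P ^^ Suc j) f x)"
      by (simp add: w_def sum_subtractf)
    ultimately show ?thesis
      using sum_lessThan_telescope'[of "\<lambda>j. (kernel_op P ^^ j) f x" r] by simp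
  qed
  show ?thesis
  proof (intro exI conjI allI)
    show "w \<in> borel_measurable borel"
      unfolding w_def by measurable
    show "\<bar>w x\<bar> \<le> real r * B" for x
      unfolding w_def using order_trans[OF sum_abs]
        sum_bounded_above[of "{..<r}" "\<lambda>j. \<bar>(kernel_op P ^^ j) f x\<bar>" B] PjB by simp
    have "(\<integral>x. \<bar>(w x - kernel_op P w x) - (g x - (\<integral>y. g y \<partial>\<mu>))\<bar> \<partial>\<mu>)
        \<le> (\<integral>x. (C * \<rho> ^ r * V x + \<bar>g x - gt n x\<bar>) + e / 4 \<partial>\<mu>)"
    proof (rule integral_mono)
      fix x
      have "\<bar>(\<integral>y. g y \<partial>\<mu>) - (\<integral>y. gt n y \<partial>\<mu>)\<bar> = \<bar>\<integral>y. g y - gt n y \<partial>\<mu>\<bar>"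
        using g gt[of n] by simp
      also have "\<dots> \<le> (\<integral>x. \<bar>g x - gt n x\<bar> \<partial>\<mu>)"
        by (rule integral_abs_bound)
      finally show "\<bar>(w x - kernel_op P w x) - (g x - (\<integral>y. g y \<partial>\<mu>))\<bar> \<le> (C * \<rho> ^ r * V x + \<bar>g x - gt n x\<bar>) + e / 4"
        using n C(2)[of r x] unfolding Pw by (simp add: f_def)
      show "integrable \<mu> (\<lambda>x. \<bar>(w x - kernel_op P w x) - (g x - (\<integral>y. g y \<partial>\<mu>))\<bar>)"
        unfolding Pw using g int[of r] integrable_V_bounded[OF Vf] by auto
    qed (use g gt[of n] V_integrable in auto)
    also have "\<dots> = \<rho> ^ r * (C * (\<integral>x. V x \<partial>\<mu>)) + (\<integral>x. \<bar>g x - gt n x\<bar> \<partial>\<mu>) + e / 4"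
      using g gt[of n] V_integrable \<mu>.prob_space by simp
    also have "\<rho> ^ r * (C * (\<integral>x. V x \<partial>\<mu>)) \<le> \<rho> ^ r * M"
      using \<rho>_nonneg by (intro mult_left_mono) (auto simp: M_def)
    also have "\<dots> \<le> e / 4"
      using r M by (simp add: field_simps)
    finally show "(\<integral>x. \<bar>(w x - kernel_op P w x) - (g x - (\<integral>y. g y \<partial>\<mu>))\<bar> \<partial>\<mu>) < e"
      using n e by simp
  qed
qed

end

context ergodic_kernel
begin

text \<open>
  Let \<open>u = P U\<close>, so \<open>U = H + u\<close>. An approximate eigenfunction of the tilted operator is sought in the form
  \<open>h = P h0\<close> with \<open>h0 = 1 + \<i> \<theta> U + \<theta>\<^sup>2 w'\<close>. Its defect is the image under \<open>P\<close> of
  \<open>exp (\<i> \<theta> H) h - (1 - s \<theta>\<^sup>2 / 2) h0\<close>. The second order term of the latter vanishes when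
  \<open>w' - P w' = s / 2 - (U\<^sup>2 - u\<^sup>2) / 2\<close>. The right-hand side has mean zero but is in general only
  integrable, hence a bounded approximate solution \<open>w'\<close>.
\<close>

lemma tilted_pow_mean_limit:
  fixes t :: real
  assumes H: "V_bounded V H" and U: "V_bounded V U" and poisson: "\<And>x. U x - kernel_op P U x = H x"
  defines "s \<equiv> (\<integral>x. (U x)\<^sup>2 \<partial>\<mu>) - (\<integral>x. (kernel_op P U x)\<^sup>2 \<partial>\<mu>)"
  shows "(\<lambda>k. \<integral>x. (tilted_op P H (t / sqrt (real k)) ^^ k) (\<lambda>_. 1) x \<partial>\<mu>)
    \<longlonglongrightarrow> complex_of_real (exp (- (s * t\<^sup>2 / 2)))"
proof -
  note [measurable] = V_bounded_measurable[OF H] V_bounded_measurable[OF U]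
  define u where "u = kernel_op P U"
  have u: "V_bounded V u"
    unfolding u_def by (rule V_bounded_kernel_op[OF U])
  note [measurable] = V_bounded_measurable[OF u]
  have Hu: "H x + u x = U x" for x
    using poisson[of x] by (simp add: u_def)
  have s_eq: "s = (\<integral>x. (U x)\<^sup>2 \<partial>\<mu>) - (\<integral>x. (u x)\<^sup>2 \<partial>\<mu>)"
    by (simp add: s_def u_def)
  have s: "0 \<le> s"
    using integral_kernel_op_square_le[OF _ integrable_V_bounded_square[OF U]] by (simp add: s_def)
  note int = integrable_V_bounded[OF H] integrable_V_bounded[OF U] integrable_V_bounded[OF u]
    integrable_V_bounded_square[OF H] integrable_V_bounded_square[OF U] integrable_V_bounded_square[OF u]
    integrable_mult_V_bounded[OF u H]
  define g where "g = (\<lambda>x. - (((U x)\<^sup>2 - (u x)\<^sup>2) / 2))"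
  have g: "integrable \<mu> g"
    unfolding g_def using int by auto
  have Eg: "(\<integral>x. g x \<partial>\<mu>) = - (s / 2)"
    unfolding g_def s_eq using int by simp
  define \<theta> where "\<theta> = (\<lambda>k. t / sqrt (real k))"
  have \<theta>0: "\<theta> \<longlonglongrightarrow> 0"
    unfolding \<theta>_def by real_asymp
  define \<kappa> where "\<kappa> = (\<lambda>k. 1 - s * (\<theta> k)\<^sup>2 / 2)"
  have k\<theta>: "real k * (\<theta> k)\<^sup>2 = t\<^sup>2" if "0 < k" for k
    using that by (simp add: \<theta>_def power_divide)
  let ?m = "\<lambda>k. \<integral>x. (tilted_op P H (\<theta> k) ^^ k) (\<lambda>_. 1) x \<partial>\<mu>"
  have \<kappa>_lim: "(\<lambda>k. \<kappa> k ^ k) \<longlonglongrightarrow> exp (- (s * t\<^sup>2 / 2))"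
  proof -
    have "(\<lambda>k. (1 + (- (s * t\<^sup>2 / 2)) / real k) ^ k) \<longlonglongrightarrow> exp (- (s * t\<^sup>2 / 2))"
      by (rule tendsto_exp_limit_sequentially)
    moreover have "eventually (\<lambda>k. (1 + (- (s * t\<^sup>2 / 2)) / real k) ^ k = \<kappa> k ^ k) sequentially"
      using eventually_gt_at_top[of 0]
      by eventually_elim (simp add: \<kappa>_def \<theta>_def power_divide mult.commute)
    ultimately show ?thesis
      by (rule Lim_transform_eventually)
  qed
  have \<theta>_small: "eventually (\<lambda>k. \<bar>\<theta> k\<bar> \<le> 1) sequentially"
  proof -
    have "(\<lambda>k. \<bar>\<theta> k\<bar>) \<longlonglongrightarrow> 0"
      using \<theta>0 by (rule tendsto_rabs_zero)
    from order_tendstoD(2)[OF this, of 1] show ?thesis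
      by (auto elim: eventually_mono)
  qed
  have \<kappa>_small: "eventually (\<lambda>k. \<bar>\<kappa> k\<bar> \<le> 1) sequentially"
  proof -
    have "(\<lambda>k. s * (\<theta> k)\<^sup>2 / 2) \<longlonglongrightarrow> s * 0\<^sup>2 / 2"
      by (intro tendsto_intros \<theta>0) simp
    from order_tendstoD(2)[OF this, of 2]
    have "eventually (\<lambda>k. s * (\<theta> k)\<^sup>2 / 2 < 2) sequentially"
      by simp
    then show ?thesis
      by eventually_elim (use s in \<open>auto simp: \<kappa>_def abs_le_iff\<close>)
  qed
  have main: "eventually (\<lambda>k. cmod (?m k - \<kappa> k ^ k) < e) sequentially" if e: "0 < e" for e
  proof -
    (* The defect of the approximate solution enters with the factor k * theta^2 = t^2. *)
    define e1 where "e1 = e / (2 * (t\<^sup>2 + 1))"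
    have t1: "0 < t\<^sup>2 + 1"
      by (intro add_nonneg_pos) auto
    have e1: "0 < e1"
      using e t1 by (simp add: e1_def)
    obtain w' W where w'_meas [measurable]: "w' \<in> borel_measurable borel" and w'W: "\<And>x. \<bar>w' x\<bar> \<le> W"
      and approx: "(\<integral>x. \<bar>(w' x - kernel_op P w' x) - (g x - (\<integral>y. g y \<partial>\<mu>))\<bar> \<partial>\<mu>) < e1"
      using approximate_poisson_bounded[OF g e1] by blast
    define w where "w = kernel_op P w'"
    have W: "0 \<le> W"
      using w'W[of undefined] by linarith
    have [measurable]: "w \<in> borel_measurable borel"
      by (simp add: w_def)
    have w': "integrable \<mu> w'"
      using w'W by (intro \<mu>.integrable_const_bound[where B=W]) (auto simp: measurable_stationary)
    have wW: "\<bar>w x\<bar> \<le> W" for x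
    proof -
      have "\<bar>w x\<bar> \<le> kernel_op P (\<lambda>y. \<bar>w' y\<bar>) x"
        unfolding w_def by (rule kernel_op_abs_le[OF w'])
      also have "\<dots> \<le> kernel_op P (\<lambda>_. W) x"
        using w'W w' by (intro kernel_op_mono) auto
      finally show ?thesis
        by (simp add: kernel_op_const)
    qed
    have w: "integrable \<mu> w"
      using wW by (intro \<mu>.integrable_const_bound[where B=W]) (auto simp: measurable_stationary)
    define d where "d = (\<lambda>x. (w' x - w x) - (s - ((U x)\<^sup>2 - (u x)\<^sup>2)) / 2)"
    have d: "integrable \<mu> d"
      unfolding d_def using w w' int by auto
    have d_small: "(\<integral>x. \<bar>d x\<bar> \<partial>\<mu>) < e1"
    proof -
      have "d x = (w' x - kernel_op P w' x) - (g x - (\<integral>y. g y \<partial>\<mu>))" for x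
        unfolding Eg by (simp add: d_def w_def g_def field_simps)
      then show ?thesis
        using approx by simp
    qed
    define A where "A = (\<lambda>x. (H x)\<^sup>2 + 2 * \<bar>u x * H x\<bar> + 2 * W)"
    have A: "integrable \<mu> A" "\<And>x. 0 \<le> A x"
      unfolding A_def using int W by auto
    have [measurable]: "A \<in> borel_measurable borel"
      unfolding A_def by measurable
    define c where "c = (\<integral>x. \<bar>U x\<bar> + W \<partial>\<mu>)"
    (* The part of the defect, relative to theta^2, that tends to 0. *)
    define R where "R = (\<lambda>k. (\<integral>x. A x * min 1 \<bar>\<theta> k * H x\<bar> \<partial>\<mu>) + s * \<bar>\<theta> k\<bar> * c)"
    have intAm: "integrable \<mu> (\<lambda>x. A x * min 1 \<bar>\<theta> k * H x\<bar>)" for k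
      by (rule Bochner_Integration.integrable_bound[OF A(1)])
        (use A(2) in \<open>auto simp: measurable_stationary abs_mult mult_left_le\<close>)
    have R0: "R \<longlonglongrightarrow> 0"
    proof -
      have "(\<lambda>k. \<integral>x. A x * min 1 \<bar>\<theta> k * H x\<bar> \<partial>\<mu>) \<longlonglongrightarrow> (\<integral>x. 0 \<partial>\<mu>)"
      proof (rule integral_dominated_convergence[where w=A])
        show "AE x in \<mu>. (\<lambda>k. A x * min 1 \<bar>\<theta> k * H x\<bar>) \<longlonglongrightarrow> 0"
        proof (rule AE_I2)
          fix x
          have "(\<lambda>k. A x * min 1 \<bar>\<theta> k * H x\<bar>) \<longlonglongrightarrow> A x * min 1 \<bar>0 * H x\<bar>"
            by (intro tendsto_intros \<theta>0)
          then show "(\<lambda>k. A x * min 1 \<bar>\<theta> k * H x\<bar>) \<longlonglongrightarrow> 0"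
            by simp
        qed
        show "AE x in \<mu>. norm (A x * min 1 \<bar>\<theta> k * H x\<bar>) \<le> A x" for k
          using A(2) by (auto simp: abs_mult mult_left_le)
      qed (use A in \<open>auto simp: measurable_stationary\<close>)
      moreover have "(\<lambda>k. s * \<bar>\<theta> k\<bar> * c) \<longlonglongrightarrow> s * \<bar>0\<bar> * c"
        by (intro tendsto_intros \<theta>0)
      ultimately have "R \<longlonglongrightarrow> (\<integral>x. 0 \<partial>\<mu>) + s * \<bar>0\<bar> * c"
        unfolding R_def by (rule tendsto_add)
      then show ?thesis
        by simp
    qed
    define N where "N = (\<integral>x. \<bar>u x\<bar> + W \<partial>\<mu>)"
    have bound: "cmod (?m k - \<kappa> k ^ k) \<le> 2 * (\<bar>\<theta> k\<bar> * N) + t\<^sup>2 * (e1 + R k)"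
      if \<theta>1: "\<bar>\<theta> k\<bar> \<le> 1" and \<kappa>1: "\<bar>\<kappa> k\<bar> \<le> 1" and k0: "0 < k" for k
    proof -
      let ?T = "tilted_op P H (\<theta> k)"
      define h0 h where "h0 = (\<lambda>x. 1 + \<i> * \<theta> k * complex_of_real (U x) + (\<theta> k)\<^sup>2 * complex_of_real (w' x))"
        and "h = (\<lambda>x. 1 + \<i> * \<theta> k * complex_of_real (u x) + (\<theta> k)\<^sup>2 * complex_of_real (w x))"
      have h: "integrable \<mu> h" and h0: "integrable \<mu> h0"
        unfolding h_def h0_def using int w w' by auto
      have h_eq: "h x = (\<integral>y. h0 y \<partial>P x)" for x
      proof -
        have "(\<integral>y. h0 y \<partial>P x) = (\<integral>y. 1 \<partial>P x) + (\<integral>y. \<i> * \<theta> k * complex_of_real (U y) \<partial>P x)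
            + (\<integral>y. (\<theta> k)\<^sup>2 * complex_of_real (w' y) \<partial>P x)"
          unfolding h0_def using integrable_kernel[OF int(2), of x] integrable_kernel[OF w', of x]
          by (subst Bochner_Integration.integral_add; simp)+
        then show ?thesis
          using P.prob_space[of x] by (simp add: h_def u_def w_def kernel_op_def)
      qed
      (* P a is the defect of h, so the norm of the defect is at most that of a. *)
      define a where "a = (\<lambda>x. iexp (\<theta> k * H x) * h x - \<kappa> k * h0 x)"
      have ph: "integrable \<mu> (\<lambda>x. iexp (\<theta> k * H x) * h x)"
        by (rule integrable_phase[OF _ h]) simp
      have a: "integrable \<mu> a"
        unfolding a_def using ph h0 by auto
      have Th: "?T h x - \<kappa> k * h x = (\<integral>y. a y \<partial>P x)" for x
        using integrable_kernel[OF ph, of x] integrable_kernel[OF h0, of x]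
        by (simp add: a_def tilted_op_def h_eq)
      have a_le: "cmod (a x) \<le> (\<theta> k)\<^sup>2 * (\<bar>d x\<bar> + A x * min 1 \<bar>\<theta> k * H x\<bar> + s * \<bar>\<theta> k\<bar> * (\<bar>U x\<bar> + W))" for x
        using quasi_eigenfunction_pointwise[OF \<theta>1 s wW[of x] w'W[of x], of "H x" "u x"]
        by (simp add: a_def h_def h0_def \<kappa>_def d_def A_def Hu flip: of_real_add)
      have na: "(\<integral>x. cmod (a x) \<partial>\<mu>) \<le> (\<theta> k)\<^sup>2 * (e1 + R k)"
      proof -
        have "(\<integral>x. cmod (a x) \<partial>\<mu>) \<le>
            (\<integral>x. (\<theta> k)\<^sup>2 * (\<bar>d x\<bar> + A x * min 1 \<bar>\<theta> k * H x\<bar> + s * \<bar>\<theta> k\<bar> * (\<bar>U x\<bar> + W)) \<partial>\<mu>)"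
          using a a_le d intAm int by (intro integral_mono) auto
        also have "\<dots> = (\<theta> k)\<^sup>2 * ((\<integral>x. \<bar>d x\<bar> \<partial>\<mu>) + (\<integral>x. A x * min 1 \<bar>\<theta> k * H x\<bar> \<partial>\<mu>) + s * \<bar>\<theta> k\<bar> * c)"
          unfolding c_def using d intAm int by simp
        also have "\<dots> \<le> (\<theta> k)\<^sup>2 * (e1 + R k)"
          using d_small by (intro mult_left_mono) (auto simp: R_def)
        finally show ?thesis .
      qed
      have "(\<integral>x. cmod ((?T ^^ k) h x - \<kappa> k ^ k * h x) \<partial>\<mu>)
          \<le> real k * (\<integral>x. cmod (?T h x - \<kappa> k * h x) \<partial>\<mu>)"
        using quasi_eigenfunction_pow[OF _ h, where H=H and \<kappa>="complex_of_real (\<kappa> k)" and \<theta>="\<theta> k" and m=k] \<kappa>1 by simp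
      also have "(\<integral>x. cmod (?T h x - \<kappa> k * h x) \<partial>\<mu>) \<le> (\<theta> k)\<^sup>2 * (e1 + R k)"
        unfolding Th using norm_kernel_integral_le[OF a] na by linarith
      finally have pow: "(\<integral>x. cmod ((?T ^^ k) h x - \<kappa> k ^ k * h x) \<partial>\<mu>) \<le> t\<^sup>2 * (e1 + R k)"
        using k\<theta>[OF k0] by (simp add: mult_left_mono flip: mult.assoc)
      (* Replace the constant 1 by h at the start and at the end. *)
      define b where "b = (\<lambda>x. 1 - h x)"
      have b: "integrable \<mu> b"
        unfolding b_def using h by auto
      have nb: "(\<integral>x. cmod (b x) \<partial>\<mu>) \<le> \<bar>\<theta> k\<bar> * N"
      proof -
        have "cmod (b x) \<le> \<bar>\<theta> k\<bar> * (\<bar>u x\<bar> + W)" for x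
        proof -
          have "cmod (b x) \<le> cmod (\<i> * \<theta> k * complex_of_real (u x)) + cmod ((\<theta> k)\<^sup>2 * complex_of_real (w x))"
          proof -
            have "b x = - (\<i> * \<theta> k * complex_of_real (u x) + (\<theta> k)\<^sup>2 * complex_of_real (w x))"
              by (simp add: b_def h_def)
            then show ?thesis
              by (simp only: norm_minus_cancel norm_triangle_ineq)
          qed
          also have "\<dots> = \<bar>\<theta> k\<bar> * \<bar>u x\<bar> + (\<bar>\<theta> k\<bar> * \<bar>\<theta> k\<bar>) * \<bar>w x\<bar>"
            by (simp add: norm_mult norm_power power2_eq_square)
          also have "(\<bar>\<theta> k\<bar> * \<bar>\<theta> k\<bar>) * \<bar>w x\<bar> \<le> (\<bar>\<theta> k\<bar> * 1) * W"
            using \<theta>1 wW W by (intro mult_mono) auto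
          finally show ?thesis
            by (simp add: distrib_left)
        qed
        then have "(\<integral>x. cmod (b x) \<partial>\<mu>) \<le> (\<integral>x. \<bar>\<theta> k\<bar> * (\<bar>u x\<bar> + W) \<partial>\<mu>)"
          using b int by (intro integral_mono) auto
        then show ?thesis
          by (simp add: N_def)
      qed
      have Tb: "integrable \<mu> ((?T ^^ k) b)" and Thk: "integrable \<mu> ((?T ^^ k) h)"
        and T1: "integrable \<mu> ((?T ^^ k) (\<lambda>_. 1))"
        using b h by (auto intro!: integrable_tilted_pow)
      have b_eq: "(?T ^^ k) b x = (?T ^^ k) (\<lambda>_. 1) x - (?T ^^ k) h x" for x
        unfolding b_def using h by (subst tilted_pow_diff) auto
      have split: "(?T ^^ k) (\<lambda>_. 1) x - \<kappa> k ^ k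
          = (?T ^^ k) b x + ((?T ^^ k) h x - \<kappa> k ^ k * h x) - \<kappa> k ^ k * b x" for x
        unfolding b_eq by (simp add: b_def algebra_simps)
      have "?m k - \<kappa> k ^ k = (\<integral>x. (?T ^^ k) (\<lambda>_. 1) x - \<kappa> k ^ k \<partial>\<mu>)"
        using T1 \<mu>.prob_space by simp
      also have "cmod \<dots> \<le> (\<integral>x. cmod ((?T ^^ k) (\<lambda>_. 1) x - \<kappa> k ^ k) \<partial>\<mu>)"
        by (rule integral_norm_bound)
      also have "\<dots> \<le> (\<integral>x. cmod ((?T ^^ k) b x) + cmod ((?T ^^ k) h x - \<kappa> k ^ k * h x) + cmod (b x) \<partial>\<mu>)"
      proof (rule integral_mono)
        fix x
        have "cmod (\<kappa> k ^ k * b x) \<le> 1 * cmod (b x)"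
          unfolding norm_mult using \<kappa>1 by (intro mult_right_mono) (auto simp: norm_power power_le_one)
        then show "cmod ((?T ^^ k) (\<lambda>_. 1) x - \<kappa> k ^ k)
            \<le> cmod ((?T ^^ k) b x) + cmod ((?T ^^ k) h x - \<kappa> k ^ k * h x) + cmod (b x)"
          unfolding split
          using norm_triangle_ineq4[of "(?T ^^ k) b x + ((?T ^^ k) h x - \<kappa> k ^ k * h x)" "\<kappa> k ^ k * b x"]
            norm_triangle_ineq[of "(?T ^^ k) b x" "(?T ^^ k) h x - \<kappa> k ^ k * h x"] by linarith
      qed (use T1 Tb Thk h b in auto)
      also have "\<dots> = (\<integral>x. cmod ((?T ^^ k) b x) \<partial>\<mu>) + (\<integral>x. cmod ((?T ^^ k) h x - \<kappa> k ^ k * h x) \<partial>\<mu>)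
          + (\<integral>x. cmod (b x) \<partial>\<mu>)"
        using Tb Thk h b by simp
      also have "\<dots> \<le> (\<integral>x. cmod (b x) \<partial>\<mu>) + t\<^sup>2 * (e1 + R k) + (\<integral>x. cmod (b x) \<partial>\<mu>)"
        using pow norm_tilted_pow_le[OF _ b, where H=H and \<theta>="\<theta> k" and k=k] by simp
      finally show ?thesis
        using nb by linarith
    qed
    have "(\<lambda>k. 2 * (\<bar>\<theta> k\<bar> * N) + t\<^sup>2 * (e1 + R k)) \<longlonglongrightarrow> 2 * (\<bar>0\<bar> * N) + t\<^sup>2 * (e1 + 0)"
      by (intro tendsto_intros \<theta>0 R0)
    moreover have "2 * (\<bar>0\<bar> * N) + t\<^sup>2 * (e1 + 0) < e"
    proof -
      have "t\<^sup>2 * e1 \<le> (t\<^sup>2 + 1) * e1"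
        using e1 by simp
      also have "\<dots> = e / 2"
        using t1 by (simp add: e1_def field_simps)
      finally show ?thesis
        using e by simp
    qed
    ultimately have "eventually (\<lambda>k. 2 * (\<bar>\<theta> k\<bar> * N) + t\<^sup>2 * (e1 + R k) < e) sequentially"
      by (rule order_tendstoD)
    with \<theta>_small \<kappa>_small eventually_gt_at_top[of 0] show ?thesis
      by eventually_elim (use bound in \<open>auto intro: le_less_trans\<close>)
  qed
  have "(\<lambda>k. ?m k - \<kappa> k ^ k) \<longlonglongrightarrow> 0"
    using main by (simp add: tendsto_iff dist_norm)
  moreover have "(\<lambda>k. complex_of_real (\<kappa> k ^ k)) \<longlonglongrightarrow> complex_of_real (exp (- (s * t\<^sup>2 / 2)))"
    by (intro tendsto_of_real \<kappa>_lim)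
  ultimately have "(\<lambda>k. (?m k - \<kappa> k ^ k) + complex_of_real (\<kappa> k ^ k)) \<longlonglongrightarrow> 0 + complex_of_real (exp (- (s * t\<^sup>2 / 2)))"
    by (rule tendsto_add)
  then show ?thesis
    by (simp add: \<theta>_def)
qed

end

section \<open>Markov chains and the central limit theorem\<close>

text \<open>
  The generating family in the definition of \<^const>\<open>history\<close> consists of subsets of the whole space,
  so the sigma algebra is the expected one.
\<close>

lemma
  fixes \<Phi> :: "nat \<Rightarrow> 'b \<Rightarrow> 'a::topological_space"
  shows space_history: "space (history M \<Phi> i) = space M"
    and sets_history: "sets (history M \<Phi> i) =
      sigma_sets (space M) (\<Union>j\<le>i. {\<Phi> j -` B \<inter> space M | B. B \<in> sets borel})"
proof -
  have sub: "(\<Union>j\<le>i. {\<Phi> j -` B \<inter> space M | B. B \<in> sets borel}) \<subseteq> Pow (space M)"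
    by blast
  show "space (history M \<Phi> i) = space M"
    unfolding history_def by (rule space_measure_of[OF sub])
  show "sets (history M \<Phi> i) =
      sigma_sets (space M) (\<Union>j\<le>i. {\<Phi> j -` B \<inter> space M | B. B \<in> sets borel})"
    unfolding history_def by (rule sets_measure_of[OF sub])
qed

lemma measurable_history:
  fixes \<Phi> :: "nat \<Rightarrow> 'b \<Rightarrow> 'a::topological_space"
  assumes "j \<le> i"
  shows "\<Phi> j \<in> history M \<Phi> i \<rightarrow>\<^sub>M borel"
proof (rule measurableI)
  fix A :: "'a set" assume "A \<in> sets borel"
  with assms have "\<Phi> j -` A \<inter> space M \<in> (\<Union>j\<le>i. {\<Phi> j -` B \<inter> space M | B. B \<in> sets borel})"
    by blast
  then show "\<Phi> j -` A \<inter> space (history M \<Phi> i) \<in> sets (history M \<Phi> i)"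
    unfolding space_history sets_history by (rule sigma_sets.Basic)
qed simp

lemma subalgebra_history:
  fixes \<Phi> :: "nat \<Rightarrow> 'b \<Rightarrow> 'a::topological_space"
  assumes "\<And>i. \<Phi> i \<in> M \<rightarrow>\<^sub>M borel"
  shows "subalgebra M (history M \<Phi> i)"
proof -
  have "(\<Union>j\<le>i. {\<Phi> j -` B \<inter> space M | B. B \<in> sets borel}) \<subseteq> sets M"
    using measurable_sets[OF assms] by blast
  then show ?thesis
    unfolding subalgebra_def space_history sets_history by (simp add: sets.sigma_sets_subset)
qed

context stationary_kernel
begin

context
  fixes M :: "'b measure" and \<Phi> :: "nat \<Rightarrow> 'b \<Rightarrow> 'a"
  assumes chain: "markov_chain M \<Phi> P"
begin

lemma prob_chain: "prob_space M"
  using chain by (simp add: markov_chain_def)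

lemma measurable_chain: "\<Phi> i \<in> M \<rightarrow>\<^sub>M borel"
  using chain by (simp add: markov_chain_def)

lemma measurable_history_chain: "Z \<in> borel_measurable (history M \<Phi> i) \<Longrightarrow> Z \<in> borel_measurable M"
  using subalgebra_history[OF measurable_chain] by (rule measurable_from_subalg)

lemma markov_property_indicator:
  fixes Z :: "'b \<Rightarrow> real"
  assumes Z: "Z \<in> borel_measurable (history M \<Phi> i)" "\<And>\<omega>. \<bar>Z \<omega>\<bar> \<le> c" and A: "A \<in> sets borel"
  shows "(\<integral>\<omega>. Z \<omega> * indicator A (\<Phi> (Suc i) \<omega>) \<partial>M) = (\<integral>\<omega>. Z \<omega> * measure (P (\<Phi> i \<omega>)) A \<partial>M)"
proof -
  interpret M: prob_space M by (rule prob_chain)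
  interpret finite_measure_subalgebra M "history M \<Phi> i"
    using subalgebra_history[OF measurable_chain] by unfold_locales
  note [measurable] = measurable_chain measurable_history_chain[OF Z(1)] A
  let ?g = "indicator (\<Phi> (Suc i) -` A) :: 'b \<Rightarrow> real"
  have g [measurable]: "?g \<in> borel_measurable M"
    using measurable_sets[OF measurable_chain A, of "Suc i"] by (simp add: borel_measurable_indicator_iff)
  have int: "integrable M (\<lambda>\<omega>. Z \<omega> * ?g \<omega>)"
    using Z(2) by (intro M.integrable_const_bound[where B="c"])
      (auto simp: abs_mult indicator_def intro: order_trans[OF abs_ge_zero])
  have "(\<integral>\<omega>. Z \<omega> * measure (P (\<Phi> i \<omega>)) A \<partial>M) = (\<integral>\<omega>. Z \<omega> * real_cond_exp M (history M \<Phi> i) ?g \<omega> \<partial>M)"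
  proof (rule integral_cong_AE)
    have "AE \<omega> in M. real_cond_exp M (history M \<Phi> i) ?g \<omega> = measure (P (\<Phi> i \<omega>)) A"
      using chain A by (simp add: markov_chain_def)
    then show "AE \<omega> in M. Z \<omega> * measure (P (\<Phi> i \<omega>)) A = Z \<omega> * real_cond_exp M (history M \<Phi> i) ?g \<omega>"
      by eventually_elim simp
    have "(\<lambda>x. measure (P x) A) \<in> borel_measurable borel"
      using measurable_kernel_integral[of "indicator A :: 'a \<Rightarrow> real"] A by simp
    then have "(\<lambda>\<omega>. measure (P (\<Phi> i \<omega>)) A) \<in> borel_measurable M"
      by (rule measurable_compose[OF measurable_chain])
    then show "(\<lambda>\<omega>. Z \<omega> * measure (P (\<Phi> i \<omega>)) A) \<in> borel_measurable M"
      by measurable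
  qed measurable
  also have "\<dots> = (\<integral>\<omega>. Z \<omega> * ?g \<omega> \<partial>M)"
    by (rule real_cond_exp_intg(2)[OF int Z(1) g])
  finally show ?thesis
    by (simp add: indicator_def)
qed

text \<open>
  For nonnegative \<open>Z\<close> the statement compares two measures: the law of the next state under the
  density \<open>Z\<close>, and the law of the present state under \<open>Z\<close>, moved on by \<open>P\<close>. They agree on sets by the
  definition of a Markov chain.
\<close>

lemma markov_property_nonneg:
  fixes Z :: "'b \<Rightarrow> real" and f :: "'a \<Rightarrow> real"
  assumes Z: "Z \<in> borel_measurable (history M \<Phi> i)" "\<And>\<omega>. 0 \<le> Z \<omega>" "\<And>\<omega>. Z \<omega> \<le> c"
    and f: "f \<in> borel_measurable borel" "\<And>x. \<bar>f x\<bar> \<le> B"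
  shows "(\<integral>\<omega>. Z \<omega> * f (\<Phi> (Suc i) \<omega>) \<partial>M) = (\<integral>\<omega>. Z \<omega> * kernel_op P f (\<Phi> i \<omega>) \<partial>M)"
proof -
  interpret M: prob_space M by (rule prob_chain)
  note [measurable] = measurable_chain measurable_history_chain[OF Z(1)] f(1) measurable_kernel_op[OF f(1)]
  let ?D = "density M (\<lambda>\<omega>. ennreal (Z \<omega>))"
  define N1 where "N1 = distr ?D borel (\<Phi> (Suc i))"
  define N2 where "N2 = distr ?D borel (\<Phi> i) \<bind> P"
  have D_fin: "finite_measure ?D"
  proof
    have "emeasure ?D (space ?D) = (\<integral>\<^sup>+\<omega>. ennreal (Z \<omega>) \<partial>M)"
      by (simp add: emeasure_density)
    also have "\<dots> \<le> (\<integral>\<^sup>+\<omega>. ennreal c \<partial>M)"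
      using Z by (intro nn_integral_mono ennreal_leI)
    also have "\<dots> < \<infinity>"
      by (simp add: M.emeasure_space_1)
    finally show "emeasure ?D (space ?D) \<noteq> \<infinity>" by simp
  qed
  have P [measurable]: "P \<in> borel \<rightarrow>\<^sub>M subprob_algebra borel"
    by (rule measurable_prob_algebraD[OF kernel])
  have absZ: "\<bar>Z \<omega>\<bar> \<le> c" for \<omega>
    using Z(2,3)[of \<omega>] by simp
  have c: "0 \<le> c"
    using Z(2,3) by (rule order_trans)
  have eq: "N1 = N2"
  proof (rule measure_eqI)
    show "sets N1 = sets N2"
      unfolding N1_def N2_def by (subst sets_bind[where N=borel]) auto
    fix A assume "A \<in> sets N1"
    then have A [measurable]: "A \<in> sets borel"
      by (simp add: N1_def)
    have PA [measurable]: "(\<lambda>x. measure (P x) A) \<in> borel_measurable borel"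
      using measurable_kernel_integral[of "indicator A :: 'a \<Rightarrow> real"] A by simp
    have "emeasure N1 A = (\<integral>\<^sup>+x. indicator A x \<partial>N1)"
      using A by (simp add: N1_def)
    also have "\<dots> = (\<integral>\<^sup>+\<omega>. ennreal (Z \<omega>) * indicator A (\<Phi> (Suc i) \<omega>) \<partial>M)"
      unfolding N1_def by (simp add: nn_integral_distr nn_integral_density del: nn_integral_indicator)
    also have "\<dots> = (\<integral>\<^sup>+\<omega>. ennreal (Z \<omega> * indicator A (\<Phi> (Suc i) \<omega>)) \<partial>M)"
      by (intro nn_integral_cong) (auto simp: indicator_def)
    also have "\<dots> = ennreal (\<integral>\<omega>. Z \<omega> * indicator A (\<Phi> (Suc i) \<omega>) \<partial>M)"
      using Z absZ c by (intro nn_integral_eq_integral M.integrable_const_bound[where B=c])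
        (auto simp: indicator_def)
    also have "\<dots> = ennreal (\<integral>\<omega>. Z \<omega> * measure (P (\<Phi> i \<omega>)) A \<partial>M)"
      using markov_property_indicator[OF Z(1) absZ A] by simp
    also have "\<dots> = (\<integral>\<^sup>+\<omega>. ennreal (Z \<omega> * measure (P (\<Phi> i \<omega>)) A) \<partial>M)"
    proof (intro nn_integral_eq_integral[symmetric] M.integrable_const_bound[where B=c])
      have "\<bar>Z \<omega> * measure (P (\<Phi> i \<omega>)) A\<bar> \<le> c * 1" for \<omega>
        unfolding abs_mult using absZ by (intro mult_mono) (auto intro: order_trans[OF abs_ge_zero])
      then show "AE \<omega> in M. norm (Z \<omega> * measure (P (\<Phi> i \<omega>)) A) \<le> c"
        by simp
    qed (use Z in auto)
    also have "\<dots> = (\<integral>\<^sup>+\<omega>. ennreal (Z \<omega>) * emeasure (P (\<Phi> i \<omega>)) A \<partial>M)"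
      using Z by (intro nn_integral_cong) (simp add: P.emeasure_eq_measure ennreal_mult)
    also have "\<dots> = (\<integral>\<^sup>+x. emeasure (P x) A \<partial>distr ?D borel (\<Phi> i))"
      by (simp add: nn_integral_distr nn_integral_density P.emeasure_eq_measure)
    also have "\<dots> = emeasure N2 A"
      unfolding N2_def by (subst emeasure_bind[where N=borel]) auto
    finally show "emeasure N1 A = emeasure N2 A" .
  qed
  have "(\<integral>\<omega>. Z \<omega> * f (\<Phi> (Suc i) \<omega>) \<partial>M) = (\<integral>x. f x \<partial>N1)"
    unfolding N1_def using Z by (simp add: integral_distr integral_density)
  also have "\<dots> = (\<integral>x. kernel_op P f x \<partial>distr ?D borel (\<Phi> i))"
    unfolding eq N2_def kernel_op_def
    using f D_fin P.emeasure_space_1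
    by (intro integral_bind[where K=borel and B=B and B'=1]) (auto intro!: finite_measure.finite_measure_distr simp del: space_kernel)
  also have "\<dots> = (\<integral>\<omega>. Z \<omega> * kernel_op P f (\<Phi> i \<omega>) \<partial>M)"
    using Z by (simp add: integral_distr integral_density)
  finally show ?thesis .
qed

lemma kernel_integral_bounded:
  fixes f :: "'a \<Rightarrow> 'c::{banach, second_countable_topology}"
  assumes f: "f \<in> borel_measurable borel" "\<And>x. norm (f x) \<le> B"
  shows "norm (\<integral>y. f y \<partial>P x) \<le> B"
proof -
  have int: "integrable (P x) f"
    using f by (intro P.integrable_const_bound[where B=B]) auto
  then have "norm (\<integral>y. f y \<partial>P x) \<le> (\<integral>y. norm (f y) \<partial>P x)"
    by (intro integral_norm_bound)
  also have "\<dots> \<le> B"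
    using f int by (intro P.integral_le_const) auto
  finally show ?thesis .
qed

lemma integrable_chain_product:
  fixes Z :: "'b \<Rightarrow> 'c::{real_normed_algebra, banach, second_countable_topology}"
  assumes Z: "Z \<in> borel_measurable (history M \<Phi> i)" "\<And>\<omega>. norm (Z \<omega>) \<le> c"
    and f: "f \<in> borel_measurable borel" "\<And>x. norm (f x) \<le> B"
  shows "integrable M (\<lambda>\<omega>. Z \<omega> * f (\<Phi> j \<omega>))"
proof -
  interpret M: prob_space M by (rule prob_chain)
  note [measurable] = measurable_chain measurable_history_chain[OF Z(1)] f(1)
  have "norm (Z \<omega> * f (\<Phi> j \<omega>)) \<le> c * B" for \<omega>
    by (rule order_trans[OF norm_mult_ineq]) (intro mult_mono Z f norm_ge_zero order_trans[OF norm_ge_zero Z(2)])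
  then show ?thesis
    by (intro M.integrable_const_bound[where B="c * B"]) auto
qed

text \<open>
  Shift \<open>Z\<close> by a constant to make it nonnegative.
\<close>

lemma markov_property_real:
  fixes Z :: "'b \<Rightarrow> real" and f :: "'a \<Rightarrow> real"
  assumes Z: "Z \<in> borel_measurable (history M \<Phi> i)" "\<And>\<omega>. \<bar>Z \<omega>\<bar> \<le> c"
    and f: "f \<in> borel_measurable borel" "\<And>x. \<bar>f x\<bar> \<le> B"
  shows "(\<integral>\<omega>. Z \<omega> * f (\<Phi> (Suc i) \<omega>) \<partial>M) = (\<integral>\<omega>. Z \<omega> * kernel_op P f (\<Phi> i \<omega>) \<partial>M)"
proof -
  interpret M: prob_space M by (rule prob_chain)
  note [measurable] = Z(1)
  have Pf: "kernel_op P f \<in> borel_measurable borel" "\<And>x. \<bar>kernel_op P f x\<bar> \<le> B"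
    using f kernel_integral_bounded[of f B] by (auto simp: kernel_op_def[abs_def] intro: measurable_kernel_integral)
  have c: "0 \<le> c"
    using Z(2) abs_ge_zero by (rule order_trans[rotated])
  have sum: "(\<integral>\<omega>. (Z \<omega> + c) * h (\<Phi> j \<omega>) \<partial>M) = (\<integral>\<omega>. Z \<omega> * h (\<Phi> j \<omega>) \<partial>M) + (\<integral>\<omega>. c * h (\<Phi> j \<omega>) \<partial>M)"
    if "h \<in> borel_measurable borel" "\<And>x. \<bar>h x\<bar> \<le> B" for h j
    unfolding distrib_right
    using integrable_chain_product[of Z i c h B j] integrable_chain_product[of "\<lambda>_. c" i c h B j] Z that c
    by (intro Bochner_Integration.integral_add) auto
  have bound: "0 \<le> Z \<omega> + c" "Z \<omega> + c \<le> 2 * c" for \<omega>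
    using Z(2)[of \<omega>] by auto
  have "(\<integral>\<omega>. (Z \<omega> + c) * f (\<Phi> (Suc i) \<omega>) \<partial>M) = (\<integral>\<omega>. (Z \<omega> + c) * kernel_op P f (\<Phi> i \<omega>) \<partial>M)"
    using bound f by (intro markov_property_nonneg[where c="2 * c" and B=B]) auto
  moreover have "(\<integral>\<omega>. c * f (\<Phi> (Suc i) \<omega>) \<partial>M) = (\<integral>\<omega>. c * kernel_op P f (\<Phi> i \<omega>) \<partial>M)"
    using c f by (intro markov_property_nonneg[where c=c and B=B]) auto
  ultimately show ?thesis
    using sum[OF f, of "Suc i"] sum[OF Pf, of i] by linarith
qed

lemma markov_property_complex:
  fixes Z :: "'b \<Rightarrow> complex" and f :: "'a \<Rightarrow> complex"
  assumes Z: "Z \<in> borel_measurable (history M \<Phi> i)" "\<And>\<omega>. cmod (Z \<omega>) \<le> c"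
    and f: "f \<in> borel_measurable borel" "\<And>x. cmod (f x) \<le> B"
  shows "(\<integral>\<omega>. Z \<omega> * f (\<Phi> (Suc i) \<omega>) \<partial>M) = (\<integral>\<omega>. Z \<omega> * (\<integral>y. f y \<partial>P (\<Phi> i \<omega>)) \<partial>M)"
proof -
  interpret M: prob_space M by (rule prob_chain)
  define g where "g = (\<lambda>x. \<integral>y. f y \<partial>P x)"
  have g: "g \<in> borel_measurable borel" "\<And>x. cmod (g x) \<le> B"
    unfolding g_def by (auto intro: measurable_kernel_integral kernel_integral_bounded f)
  have coord: "X \<in> borel_measurable borel" "\<bar>X z\<bar> \<le> cmod z" if "X \<in> {Re, Im}" for X z
    using that abs_Re_le_cmod abs_Im_le_cmod by auto
  have XZ: "(\<lambda>\<omega>. X (Z \<omega>)) \<in> borel_measurable (history M \<Phi> i)" "\<bar>X (Z \<omega>)\<bar> \<le> c" if "X \<in> {Re, Im}" for X \<omega>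
    using measurable_compose[OF Z(1) coord(1)[OF that]] order_trans[OF coord(2)[OF that] Z(2)] by auto
  have Yf: "(\<lambda>x. Y (h x)) \<in> borel_measurable borel" "\<bar>Y (h x)\<bar> \<le> B" if "Y \<in> {Re, Im}" "h \<in> {f, g}" for Y h x
    using that measurable_compose[OF _ coord(1)[OF that(1)], of h borel] order_trans[OF coord(2)[OF that(1), of "h x"]] f g
    by auto
  have int: "integrable M (\<lambda>\<omega>. X (Z \<omega>) * Y (h (\<Phi> j \<omega>)))"
    if X: "X \<in> {Re, Im}" and Y: "Y \<in> {Re, Im}" "h \<in> {f, g}" for X Y h j
    by (rule integrable_chain_product[OF XZ(1)[OF X] _ Yf(1)[OF Y]])
      (use XZ(2)[OF X] Yf(2)[OF Y] in auto)
  have step: "(\<integral>\<omega>. X (Z \<omega>) * Y (f (\<Phi> (Suc i) \<omega>)) \<partial>M) = (\<integral>\<omega>. X (Z \<omega>) * Y (g (\<Phi> i \<omega>)) \<partial>M)"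
    if X: "X \<in> {Re, Im}" and Y: "Y \<in> {Re, Im}" for X Y
  proof -
    have "integrable (P x) f" for x
      using f by (intro P.integrable_const_bound[where B=B]) auto
    then have "Y (g x) = kernel_op P (\<lambda>y. Y (f y)) x" for x
      using Y by (auto simp: g_def kernel_op_def)
    then show ?thesis
      using markov_property_real[OF XZ[OF X] Yf[OF Y, of f]] by simp
  qed
  have split: "(\<integral>\<omega>. Z \<omega> * h (\<Phi> j \<omega>) \<partial>M) = Complex
      ((\<integral>\<omega>. Re (Z \<omega>) * Re (h (\<Phi> j \<omega>)) \<partial>M) - (\<integral>\<omega>. Im (Z \<omega>) * Im (h (\<Phi> j \<omega>)) \<partial>M))
      ((\<integral>\<omega>. Re (Z \<omega>) * Im (h (\<Phi> j \<omega>)) \<partial>M) + (\<integral>\<omega>. Im (Z \<omega>) * Re (h (\<Phi> j \<omega>)) \<partial>M))"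
    if h: "h \<in> {f, g}" for h j
  proof -
    have "integrable M (\<lambda>\<omega>. Z \<omega> * h (\<Phi> j \<omega>))"
      by (rule integrable_chain_product[OF Z]) (use h f g in auto)
    then show ?thesis
      using int[OF _ _ h, of Re Re j] int[OF _ _ h, of Im Im j] int[OF _ _ h, of Re Im j] int[OF _ _ h, of Im Re j]
      by (intro complex_eqI) (simp_all flip: integral_Re integral_Im)
  qed
  show ?thesis
    using split[of f "Suc i"] split[of g i] step by (simp add: g_def)
qed

text \<open>
  Conditioning on the history peels off the last step of the sum and turns it into one application of
  the tilted operator to \<open>g\<close>.
\<close>

lemma chain_characteristic_function:
  fixes H :: "'a \<Rightarrow> real"
  assumes H [measurable]: "H \<in> borel_measurable borel"
    and g: "g \<in> borel_measurable borel" "\<And>x. cmod (g x) \<le> B"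
  shows "(\<integral>\<omega>. iexp (\<theta> * (\<Sum>j=1..k. H (\<Phi> j \<omega>))) * g (\<Phi> k \<omega>) \<partial>M)
    = (\<integral>\<omega>. (tilted_op P H \<theta> ^^ k) g (\<Phi> 0 \<omega>) \<partial>M)"
  using g
proof (induction k arbitrary: g)
  case 0
  then show ?case by simp
next
  case (Suc k)
  note [measurable] = Suc.prems(1)
  have Z: "(\<lambda>\<omega>. iexp (\<theta> * (\<Sum>j=1..k. H (\<Phi> j \<omega>)))) \<in> borel_measurable (history M \<Phi> k)"
  proof -
    have "(\<lambda>\<omega>. H (\<Phi> j \<omega>)) \<in> borel_measurable (history M \<Phi> k)" if "j \<in> {1..k}" for j
      using that by (intro measurable_compose[OF measurable_history H]) auto
    then have "(\<lambda>\<omega>. \<Sum>j=1..k. H (\<Phi> j \<omega>)) \<in> borel_measurable (history M \<Phi> k)"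
      by (rule borel_measurable_sum)
    then show ?thesis
      by measurable
  qed
  have "(\<integral>\<omega>. iexp (\<theta> * (\<Sum>j=1..Suc k. H (\<Phi> j \<omega>))) * g (\<Phi> (Suc k) \<omega>) \<partial>M)
      = (\<integral>\<omega>. iexp (\<theta> * (\<Sum>j=1..k. H (\<Phi> j \<omega>))) * (iexp (\<theta> * H (\<Phi> (Suc k) \<omega>)) * g (\<Phi> (Suc k) \<omega>)) \<partial>M)"
    by (simp add: distrib_left exp_add mult_ac)
  also have "\<dots> = (\<integral>\<omega>. iexp (\<theta> * (\<Sum>j=1..k. H (\<Phi> j \<omega>))) * tilted_op P H \<theta> g (\<Phi> k \<omega>) \<partial>M)"
    unfolding tilted_op_def using Suc.prems
    by (intro markov_property_complex[where c=1 and B=B and f="\<lambda>y. iexp (\<theta> * H y) * g y"] Z) (auto simp: norm_mult)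
  also have "\<dots> = (\<integral>\<omega>. (tilted_op P H \<theta> ^^ k) (tilted_op P H \<theta> g) (\<Phi> 0 \<omega>) \<partial>M)"
    using Suc.prems by (intro Suc.IH measurable_tilted norm_tilted_bounded H) auto
  finally show ?case
    by (simp add: funpow_swap1)
qed

end

end

text \<open>
  By Levy's theorem it is enough that characteristic functions converge. That of the normalised sum is
  the mean of \<open>T\<^sup>k 1\<close> over the initial law; \<open>T\<^sup>k 1\<close> converges pointwise to the Gaussian limit and is
  bounded by 1.
\<close>

lemma (in ergodic_kernel) is_asymptotic_variance_poisson:
  assumes F: "V_bounded V F" and U: "V_bounded V U"
    and poisson: "\<And>x. U x - kernel_op P U x = F x - (\<integral>y. F y \<partial>\<mu>)"
  shows "is_asymptotic_variance P \<mu> F ((\<integral>x. (U x)\<^sup>2 \<partial>\<mu>) - (\<integral>x. (kernel_op P U x)\<^sup>2 \<partial>\<mu>))"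
proof -
  define s where "s = (\<integral>x. (U x)\<^sup>2 \<partial>\<mu>) - (\<integral>x. (kernel_op P U x)\<^sup>2 \<partial>\<mu>)"
  define m where "m = (\<integral>y. F y \<partial>\<mu>)"
  define H where "H = (\<lambda>x. F x - m)"
  have H: "V_bounded V H"
    unfolding H_def by (intro V_bounded_diff F V_bounded_const)
  note [measurable] = V_bounded_measurable[OF F] V_bounded_measurable[OF U] V_bounded_measurable[OF H]
  have s: "0 \<le> s"
    using integral_kernel_op_square_le[OF _ integrable_V_bounded_square[OF U]] by (simp add: s_def)
  have conv: "weak_conv_m
      (\<lambda>k. distr M borel (\<lambda>\<omega>. sqrt (real k) * (ergodic_average \<Phi> F k \<omega> - m)))
      (distr std_normal_distribution borel (\<lambda>z. sqrt s * z))"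
    if chain: "markov_chain M \<Phi> P" for M :: "(nat \<Rightarrow> 'a) measure" and \<Phi>
  proof -
    interpret M: prob_space M by (rule prob_chain[OF chain])
    note [measurable] = measurable_chain[OF chain]
    interpret N: prob_space std_normal_distribution
      by (rule prob_space_normal_density) simp
    have avg: "sqrt (real k) * (ergodic_average \<Phi> F k \<omega> - m) = (\<Sum>j=1..k. H (\<Phi> j \<omega>)) / sqrt (real k)" for k \<omega>
    proof (cases "k = 0")
      case False
      then have "ergodic_average \<Phi> F k \<omega> - m = (\<Sum>j=1..k. H (\<Phi> j \<omega>)) / real k"
        by (simp add: ergodic_average_def H_def sum_subtractf field_simps)
      then have "sqrt (real k) * (ergodic_average \<Phi> F k \<omega> - m) = sqrt (real k) / real k * (\<Sum>j=1..k. H (\<Phi> j \<omega>))"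
        by simp
      then have *: "sqrt (real k) * (ergodic_average \<Phi> F k \<omega> - m) = inverse (sqrt (real k)) * (\<Sum>j=1..k. H (\<Phi> j \<omega>))"
        by (simp only: sqrt_divide_self_eq[OF of_nat_0_le_iff])
      show ?thesis
        unfolding * by (simp add: divide_inverse)
    qed simp
    have meas [measurable]: "(\<lambda>\<omega>. (\<Sum>j=1..k. H (\<Phi> j \<omega>)) / sqrt (real k)) \<in> borel_measurable M" for k
      by measurable
    show ?thesis
      unfolding avg
    proof (rule levy_continuity)
      show "real_distribution (distr M borel (\<lambda>\<omega>. (\<Sum>j=1..k. H (\<Phi> j \<omega>)) / sqrt (real k)))" for k
        by (rule M.real_distribution_distr) measurable
      show "real_distribution (distr std_normal_distribution borel (\<lambda>z. sqrt s * z))"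
        by (rule N.real_distribution_distr) measurable
      fix t :: real
      define \<theta> where "\<theta> = (\<lambda>k. t / sqrt (real k))"
      let ?G = "\<lambda>k. (tilted_op P H (\<theta> k) ^^ k) (\<lambda>_. 1)"
      have G: "?G k \<in> borel_measurable borel" "\<And>x. cmod (?G k x) \<le> 1" for k
        using tilted_pow_bounded[of H "\<lambda>_. 1" 1 k "\<theta> k"] by auto
      have \<theta>0: "\<theta> \<longlonglongrightarrow> 0"
        unfolding \<theta>_def by real_asymp
      have char: "char (distr M borel (\<lambda>\<omega>. (\<Sum>j=1..k. H (\<Phi> j \<omega>)) / sqrt (real k))) t
          = (\<integral>\<omega>. ?G k (\<Phi> 0 \<omega>) \<partial>M)" for k
      proof -
        have "char (distr M borel (\<lambda>\<omega>. (\<Sum>j=1..k. H (\<Phi> j \<omega>)) / sqrt (real k))) t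
            = (\<integral>\<omega>. iexp (\<theta> k * (\<Sum>j=1..k. H (\<Phi> j \<omega>))) * 1 \<partial>M)"
          by (simp add: char_def integral_distr \<theta>_def)
        also have "\<dots> = (\<integral>\<omega>. ?G k (\<Phi> 0 \<omega>) \<partial>M)"
          by (rule chain_characteristic_function[OF chain, where B=1 and g="\<lambda>_. 1"]) auto
        finally show ?thesis .
      qed
      have lim: "(\<lambda>k. ?G k x) \<longlonglongrightarrow> complex_of_real (exp (- (s * t\<^sup>2 / 2)))" for x
      proof -
        have "(\<lambda>k. \<integral>y. ?G k y \<partial>\<mu>) \<longlonglongrightarrow> complex_of_real (exp (- (s * t\<^sup>2 / 2)))"
          unfolding s_def \<theta>_def using poisson
          by (intro tilted_pow_mean_limit H U) (simp add: H_def m_def)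
        from tendsto_add[OF tilted_pow_forgets_start[OF H \<theta>0, of x] this] show ?thesis
          by simp
      qed
      have "(\<lambda>k. \<integral>\<omega>. ?G k (\<Phi> 0 \<omega>) \<partial>M) \<longlonglongrightarrow> (\<integral>\<omega>. complex_of_real (exp (- (s * t\<^sup>2 / 2))) \<partial>M)"
      proof (rule integral_dominated_convergence[where w="\<lambda>_. 1"])
        show "(\<lambda>\<omega>. ?G k (\<Phi> 0 \<omega>)) \<in> borel_measurable M" for k
          by (rule measurable_compose[OF measurable_chain[OF chain] G(1)])
      qed (use G lim in auto)
      moreover have "char (distr std_normal_distribution borel (\<lambda>z. sqrt s * z)) t
          = complex_of_real (exp (- (s * t\<^sup>2 / 2)))"
      proof -
        have "char (distr std_normal_distribution borel (\<lambda>z. sqrt s * z)) t = char std_normal_distribution (t * sqrt s)"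
          by (simp add: char_def integral_distr mult_ac)
        then show ?thesis
          using s by (simp add: char_std_normal_distribution power_mult_distrib mult.commute)
      qed
      ultimately show "(\<lambda>k. char (distr M borel (\<lambda>\<omega>. (\<Sum>j=1..k. H (\<Phi> j \<omega>)) / sqrt (real k))) t)
          \<longlonglongrightarrow> char (distr std_normal_distribution borel (\<lambda>z. sqrt s * z)) t"
        unfolding char by (simp add: M.prob_space)
    qed
  qed
  show ?thesis
    unfolding is_asymptotic_variance_def using s conv by (auto simp: s_def m_def)
qed

section \<open>Spectral gap and variance bound for reversible kernels\<close>

text \<open>
  Log-convexity makes the ratio of consecutive terms nondecreasing, so the first ratio cannot exceed
  the rate of the eventual exponential decay, whatever the constant \<open>C\<close> is.
\<close>

lemma log_convex_geometric_bound:
  fixes a :: "nat \<Rightarrow> real"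
  assumes nonneg: "\<And>k. 0 \<le> a k" and convex: "\<And>k. (a (Suc k))\<^sup>2 \<le> a k * a (Suc (Suc k))"
    and x: "0 \<le> x" and bound: "\<And>k. a k \<le> C * x ^ k"
  shows "a 1 \<le> x * a 0"
proof (rule ccontr)
  assume less: "\<not> a 1 \<le> x * a 0"
  have a0: "0 < a 0"
  proof (rule ccontr)
    assume "\<not> 0 < a 0"
    then have "a 0 = 0"
      using nonneg[of 0] by simp
    then show False
      using convex[of 0] less by simp
  qed
  define r where "r = a 1 / a 0"
  have r: "x < r"
    using less a0 by (simp add: r_def field_simps)
  have r0: "0 < r"
    using x r by simp
  have growth: "0 < a k \<and> r * a k \<le> a (Suc k)" for k
  proof (induction k)
    case 0
    show ?case using a0 by (simp add: r_def)
  next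
    case (Suc k)
    have pos: "0 < a (Suc k)"
      using Suc r0 by (auto intro: less_le_trans[OF mult_pos_pos])
    have "r * a (Suc k) * a k \<le> a (Suc k) * a (Suc k)"
      using Suc pos by (simp add: mult.commute mult.left_commute)
    also have "\<dots> \<le> a (Suc (Suc k)) * a k"
      using convex[of k] by (simp add: power2_eq_square mult.commute)
    finally show ?case
      using pos Suc by (simp add: mult_le_cancel_right_pos)
  qed
  have lower: "r ^ k * a 0 \<le> a k" for k
  proof (induction k)
    case (Suc k)
    have "r ^ Suc k * a 0 \<le> r * a k"
      using mult_left_mono[OF Suc, of r] r0 by (simp add: mult.assoc)
    then show ?case
      using growth[of k] by simp
  qed simp
  have "a 0 \<le> C * (x / r) ^ k" for k
  proof -
    have "r ^ k * a 0 \<le> C * x ^ k"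
      using lower bound by (rule order_trans)
    then show ?thesis
      using r0 by (simp add: power_divide field_simps)
  qed
  moreover have "(\<lambda>k. C * (x / r) ^ k) \<longlonglongrightarrow> C * 0"
    using x r r0 by (intro tendsto_mult tendsto_const LIMSEQ_realpow_zero) auto
  ultimately have "a 0 \<le> C * 0"
    by (intro LIMSEQ_le_const) auto
  then show False
    using a0 by simp
qed

lemma integral_product_square_le:
  fixes f g :: "'a \<Rightarrow> real"
  assumes [measurable]: "f \<in> borel_measurable M" "g \<in> borel_measurable M"
    and int: "integrable M (\<lambda>x. (f x)\<^sup>2)" "integrable M (\<lambda>x. (g x)\<^sup>2)" "integrable M (\<lambda>x. f x * g x)"
  shows "(\<integral>x. f x * g x \<partial>M)\<^sup>2 \<le> (\<integral>x. (f x)\<^sup>2 \<partial>M) * (\<integral>x. (g x)\<^sup>2 \<partial>M)"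
proof -
  have "ennreal ((\<integral>x. \<bar>f x * g x\<bar> \<partial>M)\<^sup>2) = (ennreal (\<integral>x. \<bar>f x * g x\<bar> \<partial>M))\<^sup>2"
    by (simp add: ennreal_power)
  also have "ennreal (\<integral>x. \<bar>f x * g x\<bar> \<partial>M) = (\<integral>\<^sup>+x. ennreal \<bar>f x * g x\<bar> \<partial>M)"
    using int by (intro nn_integral_eq_integral[symmetric]) auto
  also have "\<dots> = (\<integral>\<^sup>+x. ennreal \<bar>f x\<bar> * ennreal \<bar>g x\<bar> \<partial>M)"
    by (simp add: abs_mult ennreal_mult)
  also have "\<dots>\<^sup>2 \<le> (\<integral>\<^sup>+x. (ennreal \<bar>f x\<bar>)\<^sup>2 \<partial>M) * (\<integral>\<^sup>+x. (ennreal \<bar>g x\<bar>)\<^sup>2 \<partial>M)"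
    by (rule Cauchy_Schwarz_nn_integral) measurable
  also have "\<dots> = ennreal (\<integral>x. (f x)\<^sup>2 \<partial>M) * ennreal (\<integral>x. (g x)\<^sup>2 \<partial>M)"
    using int by (simp add: ennreal_power nn_integral_eq_integral)
  also have "\<dots> = ennreal ((\<integral>x. (f x)\<^sup>2 \<partial>M) * (\<integral>x. (g x)\<^sup>2 \<partial>M))"
    by (simp add: ennreal_mult)
  finally have "(\<integral>x. \<bar>f x * g x\<bar> \<partial>M)\<^sup>2 \<le> (\<integral>x. (f x)\<^sup>2 \<partial>M) * (\<integral>x. (g x)\<^sup>2 \<partial>M)"
    by (subst (asm) ennreal_le_iff) auto
  moreover have "(\<integral>x. f x * g x \<partial>M)\<^sup>2 \<le> (\<integral>x. \<bar>f x * g x\<bar> \<partial>M)\<^sup>2"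
    using integral_abs_bound[of M "\<lambda>x. f x * g x"] by (simp add: abs_le_square_iff[symmetric])
  ultimately show ?thesis
    by linarith
qed

locale reversible_ergodic_kernel = ergodic_kernel +
  assumes reversible: "\<And>f g. f \<in> borel_measurable borel \<Longrightarrow> g \<in> borel_measurable borel \<Longrightarrow>
    (\<integral>\<^sup>+x. f x * (\<integral>\<^sup>+y. g y \<partial>P x) \<partial>\<mu>) = (\<integral>\<^sup>+x. g x * (\<integral>\<^sup>+y. f y \<partial>P x) \<partial>\<mu>)"
begin

lemma self_adjoint_nonneg:
  assumes f: "V_bounded V f" "\<And>x. 0 \<le> f x" and g: "V_bounded V g" "\<And>x. 0 \<le> g x"
  shows "(\<integral>x. f x * kernel_op P g x \<partial>\<mu>) = (\<integral>x. g x * kernel_op P f x \<partial>\<mu>)"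
proof -
  have eq: "ennreal (\<integral>x. f x * kernel_op P g x \<partial>\<mu>)
      = (\<integral>\<^sup>+x. ennreal (f x) * (\<integral>\<^sup>+y. ennreal (g y) \<partial>P x) \<partial>\<mu>)"
    if f: "V_bounded V f" "\<And>x. 0 \<le> f x" and g: "V_bounded V g" "\<And>x. 0 \<le> g x" for f g
  proof -
    have Pg: "0 \<le> kernel_op P g x" for x
      unfolding kernel_op_def using g(2) by simp
    have "ennreal (\<integral>x. f x * kernel_op P g x \<partial>\<mu>) = (\<integral>\<^sup>+x. ennreal (f x * kernel_op P g x) \<partial>\<mu>)"
      using f(2) Pg integrable_mult_V_bounded[OF f(1) V_bounded_kernel_op[OF g(1)]]
      by (intro nn_integral_eq_integral[symmetric]) auto
    also have "\<dots> = (\<integral>\<^sup>+x. ennreal (f x) * (\<integral>\<^sup>+y. ennreal (g y) \<partial>P x) \<partial>\<mu>)"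
    proof (rule nn_integral_cong)
      fix x
      have "(\<integral>\<^sup>+y. ennreal (g y) \<partial>P x) = ennreal (kernel_op P g x)"
        unfolding kernel_op_def using g(2) integrable_kernel[OF integrable_V_bounded[OF g(1)]]
        by (intro nn_integral_eq_integral) auto
      then show "ennreal (f x * kernel_op P g x) = ennreal (f x) * (\<integral>\<^sup>+y. ennreal (g y) \<partial>P x)"
        using f(2) Pg by (simp add: ennreal_mult)
    qed
    finally show ?thesis .
  qed
  note [measurable] = V_bounded_measurable[OF f(1)] V_bounded_measurable[OF g(1)]
  have "0 \<le> kernel_op P f x" "0 \<le> kernel_op P g x" for x
    unfolding kernel_op_def using f(2) g(2) by simp_all
  then have nonneg: "0 \<le> (\<integral>x. f x * kernel_op P g x \<partial>\<mu>)" "0 \<le> (\<integral>x. g x * kernel_op P f x \<partial>\<mu>)"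
    using f(2) g(2) by simp_all
  have "ennreal (\<integral>x. f x * kernel_op P g x \<partial>\<mu>) = ennreal (\<integral>x. g x * kernel_op P f x \<partial>\<mu>)"
    unfolding eq[OF f g] eq[OF g f] by (rule reversible) measurable
  then show ?thesis
    using nonneg by (simp add: ennreal_inj)
qed

lemma V_bounded_pos_part: "V_bounded V f \<Longrightarrow> V_bounded V (\<lambda>x. max 0 (f x))"
proof -
  assume f: "V_bounded V f"
  obtain c where c: "0 \<le> c" "\<And>x. \<bar>f x\<bar> \<le> c * V x"
    using f unfolding V_bounded_def by blast
  have "\<bar>max 0 (f x)\<bar> \<le> c * V x" for x
    using c(2)[of x] by linarith
  then show ?thesis
    using c(1) V_bounded_measurable[OF f] by (intro V_boundedI[of _ c]) auto
qed

text \<open>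
  Both sides are bilinear, so the nonnegative case suffices.
\<close>

lemma self_adjoint:
  assumes f: "V_bounded V f" and g: "V_bounded V g"
  shows "(\<integral>x. f x * kernel_op P g x \<partial>\<mu>) = (\<integral>x. g x * kernel_op P f x \<partial>\<mu>)"
proof -
  have expand: "(\<integral>x. (f1 x - f2 x) * kernel_op P (\<lambda>y. g1 y - g2 y) x \<partial>\<mu>)
      = (\<integral>x. f1 x * kernel_op P g1 x \<partial>\<mu>) - (\<integral>x. f1 x * kernel_op P g2 x \<partial>\<mu>)
        - (\<integral>x. f2 x * kernel_op P g1 x \<partial>\<mu>) + (\<integral>x. f2 x * kernel_op P g2 x \<partial>\<mu>)"
    if *: "V_bounded V f1" "V_bounded V f2" "V_bounded V g1" "V_bounded V g2" for f1 f2 g1 g2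
  proof -
    have int: "integrable \<mu> (\<lambda>x. f x * kernel_op P g x)" if "f \<in> {f1, f2}" "g \<in> {g1, g2}" for f g
      using that * by (intro integrable_mult_V_bounded V_bounded_kernel_op) auto
    have "(\<integral>x. (f1 x - f2 x) * kernel_op P (\<lambda>y. g1 y - g2 y) x \<partial>\<mu>)
        = (\<integral>x. (f1 x * kernel_op P g1 x - f1 x * kernel_op P g2 x) - (f2 x * kernel_op P g1 x - f2 x * kernel_op P g2 x) \<partial>\<mu>)"
      using * by (intro Bochner_Integration.integral_cong)
        (auto simp: kernel_op_diff integrable_V_bounded algebra_simps)
    then show ?thesis
      using int[of f1 g1] int[of f1 g2] int[of f2 g1] int[of f2 g2] by simp
  qed
  define f1 f2 g1 g2 where "f1 = (\<lambda>x. max 0 (f x))" and "f2 = (\<lambda>x. max 0 ((-1) * f x))"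
    and "g1 = (\<lambda>x. max 0 (g x))" and "g2 = (\<lambda>x. max 0 ((-1) * g x))"
  have V: "V_bounded V f1" "V_bounded V f2" "V_bounded V g1" "V_bounded V g2"
    unfolding f1_def f2_def g1_def g2_def by (intro V_bounded_pos_part V_bounded_cmult f g)+
  have nonneg: "0 \<le> f1 x" "0 \<le> f2 x" "0 \<le> g1 x" "0 \<le> g2 x" for x
    by (simp_all add: f1_def f2_def g1_def g2_def)
  have eq: "f = (\<lambda>x. f1 x - f2 x)" "g = (\<lambda>x. g1 x - g2 x)"
    by (auto simp: f1_def f2_def g1_def g2_def)
  show ?thesis
    unfolding eq expand[OF V] expand[OF V(3,4,1,2)] 
    using self_adjoint_nonneg[OF V(1) nonneg(1) V(3) nonneg(3)] self_adjoint_nonneg[OF V(1) nonneg(1) V(4) nonneg(4)]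
      self_adjoint_nonneg[OF V(2) nonneg(2) V(3) nonneg(3)] self_adjoint_nonneg[OF V(2) nonneg(2) V(4) nonneg(4)]
    by linarith
qed

text \<open>
  By self-adjointness and the Cauchy-Schwarz inequality the squared norms of \<open>P\<^sup>k f\<close> are log-convex
  in \<open>k\<close>; they decay like \<open>\<rho>\<^bsup>2k\<^esup>\<close> with a constant that depends on \<open>f\<close>.
  Log-convexity removes this constant from the first step.
\<close>

lemma spectral_gap:
  assumes f: "V_bounded V f" and zero: "(\<integral>x. f x \<partial>\<mu>) = 0"
  shows "(\<integral>x. (kernel_op P f x)\<^sup>2 \<partial>\<mu>) \<le> \<rho>\<^sup>2 * (\<integral>x. (f x)\<^sup>2 \<partial>\<mu>)"
proof -
  define a where "a = (\<lambda>k. \<integral>x. ((kernel_op P ^^ k) f x)\<^sup>2 \<partial>\<mu>)"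
  have Vk: "V_bounded V ((kernel_op P ^^ k) f)" for k
    by (rule V_bounded_kernel_op_pow[OF f])
  obtain C where C: "0 \<le> C" "\<And>k x. \<bar>(kernel_op P ^^ k) f x\<bar> \<le> C * \<rho> ^ k * V x"
    using geometric_decay[OF assms] by blast
  have "a 1 \<le> \<rho>\<^sup>2 * a 0"
  proof (rule log_convex_geometric_bound)
    show "0 \<le> a k" for k
      by (simp add: a_def)
    show "(a (Suc k))\<^sup>2 \<le> a k * a (Suc (Suc k))" for k
    proof -
      have "a (Suc k) = (\<integral>x. (kernel_op P ^^ Suc k) f x * kernel_op P ((kernel_op P ^^ k) f) x \<partial>\<mu>)"
        by (simp add: a_def power2_eq_square)
      also have "\<dots> = (\<integral>x. (kernel_op P ^^ k) f x * kernel_op P ((kernel_op P ^^ Suc k) f) x \<partial>\<mu>)"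
        by (rule self_adjoint[OF Vk Vk])
      also have "\<dots> = (\<integral>x. (kernel_op P ^^ k) f x * (kernel_op P ^^ Suc (Suc k)) f x \<partial>\<mu>)"
        by simp
      finally show ?thesis
        unfolding a_def
        by (simp only:) (intro integral_product_square_le integrable_V_bounded_square
            integrable_mult_V_bounded measurable_stationary V_bounded_measurable[OF Vk] Vk)
    qed
    show "a k \<le> (C\<^sup>2 * (\<integral>x. (V x)\<^sup>2 \<partial>\<mu>)) * (\<rho>\<^sup>2) ^ k" for k
    proof -
      have "a k \<le> (\<integral>x. (C * \<rho> ^ k)\<^sup>2 * (V x)\<^sup>2 \<partial>\<mu>)"
        unfolding a_def
      proof (rule integral_mono)
        show "((kernel_op P ^^ k) f x)\<^sup>2 \<le> (C * \<rho> ^ k)\<^sup>2 * (V x)\<^sup>2" for x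
          using power_mono[OF C(2)[of k x], of 2] by (simp add: power_mult_distrib)
      qed (use integrable_V_bounded_square[OF Vk] V_square_integrable in auto)
      then show ?thesis
        by (simp add: power_mult_distrib mult_ac flip: power_mult)
    qed
  qed simp
  then show ?thesis
    by (simp add: a_def)
qed

text \<open>
  Let \<open>U\<close> solve Poisson's equation for \<open>H = F - m\<close> and let \<open>v\<close> be the asymptotic variance. The spectral gap gives
  \<open>(1 - \<rho>\<^sup>2) \<integral> U\<^sup>2 d\<mu> \<le> v\<close>, and \<open>U\<^sup>2 - (P U)\<^sup>2 = 2 H U - H\<^sup>2\<close> gives \<open>v \<le> 2 \<integral> H U d\<mu>\<close>.
  Young's inequality then absorbs \<open>U\<close> into the left-hand side. The mean \<open>m\<close> may be replaced by any
  \<open>c\<close>, as it minimises the mean square.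
\<close>

lemma asymptotic_variance_bound:
  assumes F: "V_bounded V F"
  shows "\<exists>v. is_asymptotic_variance P \<mu> F v \<and> v \<le> 4 / (1 - \<rho>\<^sup>2) * (\<integral>x. (F x - c)\<^sup>2 \<partial>\<mu>)"
proof -
  define m where "m = (\<integral>x. F x \<partial>\<mu>)"
  define H where "H = (\<lambda>x. F x - m)"
  have H: "V_bounded V H"
    unfolding H_def by (intro V_bounded_diff F V_bounded_const)
  have H0: "(\<integral>x. H x \<partial>\<mu>) = 0"
    using integrable_V_bounded[OF F] \<mu>.prob_space by (simp add: H_def m_def)
  obtain U where U: "V_bounded V U" "(\<integral>x. U x \<partial>\<mu>) = 0" and poisson: "\<And>x. U x - kernel_op P U x = H x"
    using poisson_equation[OF H H0] by blast
  define v where "v = (\<integral>x. (U x)\<^sup>2 \<partial>\<mu>) - (\<integral>x. (kernel_op P U x)\<^sup>2 \<partial>\<mu>)"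
  have av: "is_asymptotic_variance P \<mu> F v"
    unfolding v_def using poisson by (intro is_asymptotic_variance_poisson F U) (simp add: H_def m_def)
  note int = integrable_V_bounded_square[OF U(1)] integrable_V_bounded_square[OF H] integrable_mult_V_bounded[OF H U(1)]
    integrable_V_bounded_square[OF V_bounded_kernel_op[OF U(1)]]
  (* The weight in Young's inequality: half of the gap is absorbed. *)
  define b where "b = (1 - \<rho>\<^sup>2) / 2"
  have b: "0 < b"
    using \<rho>_nonneg \<rho>_less_1 by (simp add: b_def power_less_one_iff)
  have gap: "2 * b * (\<integral>x. (U x)\<^sup>2 \<partial>\<mu>) \<le> v"
    using spectral_gap[OF U] by (simp add: v_def b_def field_simps)
  have "v = (\<integral>x. (U x)\<^sup>2 - (kernel_op P U x)\<^sup>2 \<partial>\<mu>)"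
    unfolding v_def using int by simp
  also have "\<dots> \<le> (\<integral>x. (H x)\<^sup>2 / b + b * (U x)\<^sup>2 \<partial>\<mu>)"
  proof (rule integral_mono)
    fix x
    have "(U x)\<^sup>2 - (kernel_op P U x)\<^sup>2 = 2 * (H x * U x) - (H x)\<^sup>2"
      unfolding poisson[of x, symmetric] by (simp add: power2_eq_square algebra_simps)
    also have "\<dots> \<le> 2 * (H x * U x)"
      by simp
    also have "\<dots> \<le> (H x)\<^sup>2 / b + b * (U x)\<^sup>2"
    proof -
      have "0 \<le> (H x - b * U x)\<^sup>2 / b"
        using b by simp
      also have "\<dots> = (H x)\<^sup>2 / b + b * (U x)\<^sup>2 - 2 * (H x * U x)"
        using b by (simp add: power2_eq_square field_simps)
      finally show ?thesis
        by simp
    qed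
    finally show "(U x)\<^sup>2 - (kernel_op P U x)\<^sup>2 \<le> (H x)\<^sup>2 / b + b * (U x)\<^sup>2" .
  qed (use int in auto)
  also have "\<dots> = (\<integral>x. (H x)\<^sup>2 \<partial>\<mu>) / b + b * (\<integral>x. (U x)\<^sup>2 \<partial>\<mu>)"
    using int by simp
  finally have "v \<le> 2 / b * (\<integral>x. (H x)\<^sup>2 \<partial>\<mu>)"
    using gap by simp
  also have "2 / b = 4 / (1 - \<rho>\<^sup>2)"
    using b by (simp add: b_def)
  also have "4 / (1 - \<rho>\<^sup>2) * (\<integral>x. (H x)\<^sup>2 \<partial>\<mu>) \<le> 4 / (1 - \<rho>\<^sup>2) * (\<integral>x. (F x - c)\<^sup>2 \<partial>\<mu>)"
  proof (intro mult_left_mono)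
    have "(\<integral>x. (F x - c)\<^sup>2 \<partial>\<mu>) = (\<integral>x. ((H x)\<^sup>2 + 2 * (m - c) * H x) + (m - c)\<^sup>2 \<partial>\<mu>)"
      by (intro Bochner_Integration.integral_cong) (auto simp: H_def power2_eq_square algebra_simps)
    also have "\<dots> = (\<integral>x. (H x)\<^sup>2 \<partial>\<mu>) + (m - c)\<^sup>2"
      using int integrable_V_bounded[OF H] H0 \<mu>.prob_space by simp
    finally show "(\<integral>x. (H x)\<^sup>2 \<partial>\<mu>) \<le> (\<integral>x. (F x - c)\<^sup>2 \<partial>\<mu>)"
      by simp
    show "0 \<le> 4 / (1 - \<rho>\<^sup>2)"
      using b by (simp add: b_def)
  qed
  finally show ?thesis
    using av by blast
qed

end

section \<open>The Metropolis-Hastings kernel\<close>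

text \<open>
  Needed because the Metropolis-Hastings kernel is given by its values on sets, as the sum of an
  absolutely continuous part and an atom.
\<close>

lemma nn_integral_sum_measure:
  assumes sets: "sets M1 = sets N" "sets M2 = sets N"
    and eq: "\<And>A. A \<in> sets N \<Longrightarrow> emeasure N A = emeasure M1 A + c * emeasure M2 A"
    and f: "f \<in> borel_measurable N"
  shows "(\<integral>\<^sup>+x. f x \<partial>N) = (\<integral>\<^sup>+x. f x \<partial>M1) + c * (\<integral>\<^sup>+x. f x \<partial>M2)"
  using f
proof (induction f rule: borel_measurable_induct)
  note [measurable_cong] = sets
  have space: "space M1 = space N" "space M2 = space N"
    using sets by (auto dest: sets_eq_imp_space_eq)
  case (cong f g)
  have "(\<integral>\<^sup>+x. f x \<partial>N) = (\<integral>\<^sup>+x. g x \<partial>N)" "(\<integral>\<^sup>+x. f x \<partial>M1) = (\<integral>\<^sup>+x. g x \<partial>M1)"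
    "(\<integral>\<^sup>+x. f x \<partial>M2) = (\<integral>\<^sup>+x. g x \<partial>M2)"
    using cong(3) by (auto intro!: nn_integral_cong simp: space)
  then show ?case
    using cong(4) by (simp only:)
next
  case (set A)
  then show ?case
    using eq sets by simp
next
  note [measurable_cong] = sets
  case (mult u a)
  note [measurable] = mult(2)
  show ?case
    using mult by (simp add: nn_integral_cmult distrib_left mult_ac)
next
  note [measurable_cong] = sets
  case (add u v)
  note [measurable] = add(1,4)
  show ?case
    using add by (simp add: nn_integral_add distrib_left add_ac)
next
  note [measurable_cong] = sets
  case (seq U)
  note [measurable] = seq(1)
  have inc: "incseq U"
    by (rule seq)
  have mono: "incseq (\<lambda>i. \<integral>\<^sup>+x. U i x \<partial>M)" for M
    using inc by (auto simp: incseq_def le_fun_def intro!: nn_integral_mono)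
  have swap: "(\<integral>\<^sup>+x. (SUP i. U i) x \<partial>M) = (SUP i. \<integral>\<^sup>+x. U i x \<partial>M)" if "sets M = sets N" for M
  proof -
    note [measurable_cong] = that
    show ?thesis
      unfolding SUP_apply using inc by (intro nn_integral_monotone_convergence_SUP) auto
  qed
  have "(\<integral>\<^sup>+x. (SUP i. U i) x \<partial>N) = (SUP i. (\<integral>\<^sup>+x. U i x \<partial>M1) + c * (\<integral>\<^sup>+x. U i x \<partial>M2))"
    by (simp only: swap[OF refl] seq.IH)
  also have "\<dots> = (SUP i. \<integral>\<^sup>+x. U i x \<partial>M1) + (SUP i. c * (\<integral>\<^sup>+x. U i x \<partial>M2))"
    using mono by (intro ennreal_SUP_add) (auto simp: incseq_def mult_left_mono)
  also have "(SUP i. c * (\<integral>\<^sup>+x. U i x \<partial>M2)) = c * (SUP i. \<integral>\<^sup>+x. U i x \<partial>M2)"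
    by (simp add: SUP_mult_left_ennreal)
  finally show ?case
    by (simp only: swap[OF sets(1)] swap[OF sets(2)])
qed

lemma integral_sum_measure:
  fixes f :: "'a \<Rightarrow> real"
  assumes sets: "sets M1 = sets N" "sets M2 = sets N" and c: "0 \<le> c"
    and eq: "\<And>A. A \<in> sets N \<Longrightarrow> emeasure N A = emeasure M1 A + ennreal c * emeasure M2 A"
    and f: "integrable M1 f" "integrable M2 f"
  shows "integrable N f" "(\<integral>x. f x \<partial>N) = (\<integral>x. f x \<partial>M1) + c * (\<integral>x. f x \<partial>M2)"
proof -
  note [measurable_cong] = sets[symmetric]
  have fM [measurable]: "f \<in> borel_measurable N"
    using borel_measurable_integrable[OF f(1)] by (simp add: measurable_cong_sets[OF sets(1) refl])
  have nn: "(\<integral>\<^sup>+x. ennreal (g (f x)) \<partial>N) = (\<integral>\<^sup>+x. ennreal (g (f x)) \<partial>M1) + ennreal c * (\<integral>\<^sup>+x. ennreal (g (f x)) \<partial>M2)"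
    if "g \<in> borel_measurable borel" for g
    using measurable_compose[OF measurable_compose[OF fM that] measurable_ennreal]
    by (intro nn_integral_sum_measure sets eq) auto
  show int: "integrable N f"
    using nn[of norm] f by (auto simp: integrable_iff_bounded ennreal_mult_less_top)
  have fin: "(\<integral>\<^sup>+x. ennreal (f x) \<partial>M) < \<infinity>" "(\<integral>\<^sup>+x. ennreal (- f x) \<partial>M) < \<infinity>" if "integrable M f" for M
    using that by (auto simp: real_integrable_def less_top)
  have part: "enn2real (a + ennreal c * b) = enn2real a + c * enn2real b" if "a < \<infinity>" "b < \<infinity>" for a b
    using that c by (simp add: enn2real_plus enn2real_mult ennreal_mult_less_top)
  show "(\<integral>x. f x \<partial>N) = (\<integral>x. f x \<partial>M1) + c * (\<integral>x. f x \<partial>M2)"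
    using nn[of "\<lambda>x. x"] nn[of uminus]
    by (simp add: real_lebesgue_integral_def[OF int] real_lebesgue_integral_def[OF f(1)]
        real_lebesgue_integral_def[OF f(2)] part[OF fin(1)[OF f(1)] fin(1)[OF f(2)]]
        part[OF fin(2)[OF f(1)] fin(2)[OF f(2)]] algebra_simps)
qed

locale metropolis_hastings =
  fixes p :: "'a::euclidean_space \<Rightarrow> real" and q :: "'a \<Rightarrow> 'a \<Rightarrow> real" and B :: real
  assumes p_density: "is_density p"
    and q_density: "\<And>x. is_density (q x)"
    and p_continuous: "continuous_on UNIV p" and p_pos: "\<And>x. 0 < p x"
    and q_continuous: "continuous_on UNIV (\<lambda>(x, y). q x y)" and q_pos: "\<And>x y. 0 < q x y"
    and q_le: "\<And>x y. q x y \<le> B"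
begin

abbreviation "P \<equiv> mh_kernel p q"
abbreviation "\<mu> \<equiv> target p"

definition move :: "'a \<Rightarrow> 'a \<Rightarrow> real" where
  "move x y = acceptance p q x y * q x y"

definition stay :: "'a \<Rightarrow> real" where
  "stay x = 1 - (\<integral>z. move x z \<partial>lborel)"

lemma p_measurable [measurable]: "p \<in> borel_measurable borel"
  by (intro borel_measurable_continuous_onI p_continuous)

text \<open>
  This form shows that the accepted proposals have a jointly continuous, strictly positive density, although
  \<^const>\<open>acceptance\<close> is defined by cases.
\<close>

lemma move_eq: "move x y = min (q x y) (p y * q y x / p x)"
  using p_pos[of x] p_pos[of y] q_pos[of x y] q_pos[of y x]
  by (auto simp: move_def acceptance_def min_def field_simps)

lemma move_pos: "0 < move x y"
  using p_pos[of x] p_pos[of y] q_pos[of x y] q_pos[of y x] by (simp add: move_eq)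

lemma move_le: "move x y \<le> q x y" "move x y \<le> B / p x * p y"
proof -
  show "move x y \<le> q x y"
    by (simp add: move_eq)
  have "move x y \<le> p y * q y x / p x"
    by (simp add: move_eq)
  also have "\<dots> \<le> p y * B / p x"
    using p_pos[of x] p_pos[of y] q_le[of y x] by (intro divide_right_mono mult_left_mono) auto
  finally show "move x y \<le> B / p x * p y"
    by (simp add: mult.commute)
qed

lemma detailed_balance: "p x * move x y = p y * move y x"
  using p_pos[of x] p_pos[of y] by (auto simp: move_eq min_def field_simps)

lemma move_continuous: "continuous_on UNIV (\<lambda>(x, y). move x y)"
proof -
  have "continuous_on UNIV (\<lambda>z. q (fst z) (snd z))" "continuous_on UNIV (\<lambda>z. q (snd z) (fst z))"
    using q_continuous continuous_on_compose2[OF q_continuous continuous_on_swap]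
    by (simp_all add: split_beta')
  moreover have "continuous_on UNIV (\<lambda>z::'a \<times> 'a. p (fst z))" "continuous_on UNIV (\<lambda>z::'a \<times> 'a. p (snd z))"
    by (auto intro!: continuous_on_compose2[OF p_continuous] continuous_intros)
  ultimately show ?thesis
    using p_pos unfolding split_beta move_eq by (intro continuous_intros) (auto simp: less_imp_neq[symmetric])
qed

lemma move_measurable [measurable]: "(\<lambda>(x, y). move x y) \<in> borel_measurable (borel \<Otimes>\<^sub>M borel)"
  using borel_measurable_continuous_onI[OF move_continuous] by (simp add: borel_prod)

lemma nn_integral_move_le: "(\<integral>\<^sup>+y. ennreal (move x y) \<partial>lborel) \<le> 1"
proof -
  have "(\<integral>\<^sup>+y. ennreal (move x y) \<partial>lborel) \<le> (\<integral>\<^sup>+y. ennreal (q x y) \<partial>lborel)"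
    by (intro nn_integral_mono ennreal_leI move_le)
  then show ?thesis
    using q_density[of x] by (simp add: is_density_def)
qed

lemma integrable_move: "integrable lborel (move x)"
proof (rule integrableI_bounded)
  have "(\<integral>\<^sup>+y. ennreal (norm (move x y)) \<partial>lborel) = (\<integral>\<^sup>+y. ennreal (move x y) \<partial>lborel)"
    using move_pos by (intro nn_integral_cong) (simp add: less_imp_le)
  then show "(\<integral>\<^sup>+y. ennreal (norm (move x y)) \<partial>lborel) < \<infinity>"
    using nn_integral_move_le[of x] by (simp add: le_less_trans[OF _ ennreal_one_less_top])
qed measurable

lemma nn_integral_move: "(\<integral>\<^sup>+y. ennreal (move x y) \<partial>lborel) = ennreal (1 - stay x)"
  using integrable_move[of x] move_pos[of x]
  by (simp add: nn_integral_eq_integral less_imp_le stay_def)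

lemma stay_bounds: "0 \<le> stay x" "stay x \<le> 1"
proof -
  have "0 \<le> (\<integral>z. move x z \<partial>lborel)"
    using move_pos[of x] by (simp add: less_imp_le)
  then show "stay x \<le> 1"
    by (simp add: stay_def)
  have "ennreal (1 - stay x) \<le> ennreal 1"
    using nn_integral_move_le[of x] by (simp add: nn_integral_move)
  then show "0 \<le> stay x"
    by (subst (asm) ennreal_le_iff) auto
qed

lemma stay_measurable [measurable]: "stay \<in> borel_measurable borel"
  unfolding stay_def[abs_def] by measurable

lemma sets_mh_kernel [simp, measurable_cong]: "sets (P x) = sets borel"
  unfolding mh_kernel_def using sets.sigma_sets_eq[of "borel :: 'a measure"] by simp

lemma space_mh_kernel [simp]: "space (P x) = UNIV"
  using sets_eq_imp_space_eq[OF sets_mh_kernel] by simp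

lemma emeasure_mh_kernel:
  assumes A: "A \<in> sets borel"
  shows "emeasure (P x) A = emeasure (density lborel (\<lambda>y. ennreal (move x y))) A
    + ennreal (stay x) * emeasure (return borel x) A"
proof -
  let ?D = "density lborel (\<lambda>y. ennreal (move x y))" and ?R = "return borel x"
  let ?m = "\<lambda>A. emeasure ?D A + ennreal (stay x) * emeasure ?R A"
  have eq: "(\<integral>\<^sup>+y\<in>A. ennreal (acceptance p q x y * q x y) \<partial>lborel)
      + ennreal (1 - (\<integral>z. acceptance p q x z * q x z \<partial>lborel)) * indicator A x = ?m A"
    if "A \<in> sets borel" for A
    using that by (simp add: emeasure_density flip: move_def stay_def)
  show ?thesis
  proof (subst emeasure_measure_of[OF mh_kernel_def])
    show "countably_additive (sets (P x)) (\<lambda>A. (\<integral>\<^sup>+y\<in>A. ennreal (acceptance p q x y * q x y) \<partial>lborel)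
      + ennreal (1 - (\<integral>z. acceptance p q x z * q x z \<partial>lborel)) * indicator A x)"
    proof (rule countably_additiveI)
      fix A :: "nat \<Rightarrow> 'a set"
      assume A: "range A \<subseteq> sets (P x)" "disjoint_family A" "(\<Union>i. A i) \<in> sets (P x)"
      then have Ai: "A i \<in> sets borel" for i
        by auto
      have "(\<Sum>i. emeasure ?D (A i)) = emeasure ?D (\<Union>i. A i)"
        and "(\<Sum>i. emeasure ?R (A i)) = emeasure ?R (\<Union>i. A i)"
        using A by (intro suminf_emeasure; simp)+
      then have "?m (\<Union>i. A i) = (\<Sum>i. emeasure ?D (A i)) + (\<Sum>i. ennreal (stay x) * emeasure ?R (A i))"
        by (simp only: ennreal_suminf_cmult)
      also have "\<dots> = (\<Sum>i. ?m (A i))"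
        by (intro suminf_add summableI)
      finally have "(\<Sum>i. ?m (A i)) = ?m (\<Union>i. A i)"
        by (rule sym)
      then show "(\<Sum>i. (\<integral>\<^sup>+y\<in>A i. ennreal (acceptance p q x y * q x y) \<partial>lborel)
            + ennreal (1 - (\<integral>z. acceptance p q x z * q x z \<partial>lborel)) * indicator (A i) x)
          = (\<integral>\<^sup>+y\<in>\<Union>i. A i. ennreal (acceptance p q x y * q x y) \<partial>lborel)
            + ennreal (1 - (\<integral>z. acceptance p q x z * q x z \<partial>lborel)) * indicator (\<Union>i. A i) x"
        using Ai A(3) by (simp only: eq sets_mh_kernel)
    qed
  qed (use A in \<open>auto simp: positive_def eq\<close>)
qed

lemma nn_integral_mh_kernel:
  assumes [measurable]: "f \<in> borel_measurable borel"
  shows "(\<integral>\<^sup>+y. f y \<partial>P x) = (\<integral>\<^sup>+y. ennreal (move x y) * f y \<partial>lborel) + ennreal (stay x) * f x"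
  using nn_integral_sum_measure[where N="P x" and f=f, OF _ _ emeasure_mh_kernel]
  by (simp add: nn_integral_density nn_integral_return)

text \<open>
  Boundedness of \<open>f\<close> makes both parts of the kernel integrable; step functions such as the output of
  the scheme are the intended use.
\<close>

lemma kernel_op_bounded:
  fixes f :: "'a \<Rightarrow> real"
  assumes [measurable]: "f \<in> borel_measurable borel" and "\<And>x. \<bar>f x\<bar> \<le> b"
  shows "integrable lborel (\<lambda>y. move x y * f y)"
    and "kernel_op P f x = (\<integral>y. move x y * f y \<partial>lborel) + stay x * f x"
proof -
  have "\<bar>move x y * f y\<bar> \<le> b * move x y" for y
    using assms(2)[of y] move_pos[of x y] by (simp add: abs_mult mult.commute mult_left_mono)
  then show int: "integrable lborel (\<lambda>y. move x y * f y)"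
    by (intro Bochner_Integration.integrable_bound[OF integrable_mult_right[OF integrable_move[of x], of b]])
      (auto intro: order_trans[OF _ abs_ge_self])
  have "integrable (return borel x) f"
    using assms(2) by (intro finite_measure.integrable_const_bound[where B=b] prob_space.finite_measure prob_space_return) auto
  moreover have "integrable (density lborel (\<lambda>y. ennreal (move x y))) f"
    using int move_pos[of x] by (subst integrable_density) (auto simp: less_imp_le)
  ultimately have "kernel_op P f x = (\<integral>y. f y \<partial>density lborel (\<lambda>y. ennreal (move x y))) + stay x * (\<integral>y. f y \<partial>return borel x)"
    unfolding kernel_op_def using stay_bounds(1)
    by (intro integral_sum_measure(2)[where N="P x", OF _ _ _ emeasure_mh_kernel]) auto
  then show "kernel_op P f x = (\<integral>y. move x y * f y \<partial>lborel) + stay x * f x"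
    using move_pos[of x] by (simp add: integral_density integral_return less_imp_le)
qed

lemma prob_space_mh_kernel: "prob_space (P x)"
proof
  have "emeasure (P x) (space (P x)) = (\<integral>\<^sup>+y. 1 \<partial>P x)"
    by simp
  also have "\<dots> = ennreal (1 - stay x) + ennreal (stay x)"
    by (subst nn_integral_mh_kernel) (auto simp: nn_integral_move)
  also have "\<dots> = 1"
    using stay_bounds by (simp flip: ennreal_plus)
  finally show "emeasure (P x) (space (P x)) = 1" .
qed

lemma mh_kernel_measurable [measurable]: "P \<in> borel \<rightarrow>\<^sub>M prob_algebra borel"
proof (rule measurable_prob_algebraI[OF prob_space_mh_kernel measurable_subprob_algebra])
  show "subprob_space (P x)" for x
    by (intro prob_space_imp_subprob_space prob_space_mh_kernel)
  fix A :: "'a set" assume [measurable]: "A \<in> sets borel"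
  have "emeasure (P x) A = (\<integral>\<^sup>+y. ennreal (move x y) * indicator A y \<partial>lborel) + ennreal (stay x) * indicator A x" for x
    using nn_integral_mh_kernel[of "indicator A" x] by simp
  then show "(\<lambda>x. emeasure (P x) A) \<in> borel_measurable borel"
    by simp
qed simp

lemma nn_integral_target:
  "f \<in> borel_measurable borel \<Longrightarrow> (\<integral>\<^sup>+x. f x \<partial>\<mu>) = (\<integral>\<^sup>+x. ennreal (p x) * f x \<partial>lborel)"
  by (simp add: target_def nn_integral_density)

text \<open>
  The diagonal part of the kernel is symmetric for trivial reasons, and detailed balance makes the flow
  \<open>p x * move x y\<close> symmetric, so Fubini's theorem exchanges the roles of \<open>f\<close> and \<open>g\<close>.
\<close>

lemma mh_reversible:
  assumes [measurable]: "f \<in> borel_measurable borel" "g \<in> borel_measurable borel"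
  shows "(\<integral>\<^sup>+x. f x * (\<integral>\<^sup>+y. g y \<partial>P x) \<partial>\<mu>) = (\<integral>\<^sup>+x. g x * (\<integral>\<^sup>+y. f y \<partial>P x) \<partial>\<mu>)"
proof -
  have flow: "(\<integral>\<^sup>+x. f x * (\<integral>\<^sup>+y. g y \<partial>P x) \<partial>\<mu>)
      = (\<integral>\<^sup>+x. \<integral>\<^sup>+y. ennreal (p x * move x y) * (f x * g y) \<partial>lborel \<partial>lborel)
        + (\<integral>\<^sup>+x. ennreal (p x) * ennreal (stay x) * (f x * g x) \<partial>lborel)"
    if [measurable]: "f \<in> borel_measurable borel" "g \<in> borel_measurable borel" for f g :: "'a \<Rightarrow> ennreal"
  proof -
    have "(\<integral>\<^sup>+x. f x * (\<integral>\<^sup>+y. g y \<partial>P x) \<partial>\<mu>)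
        = (\<integral>\<^sup>+x. ennreal (p x) * (f x * ((\<integral>\<^sup>+y. ennreal (move x y) * g y \<partial>lborel) + ennreal (stay x) * g x)) \<partial>lborel)"
      by (simp add: nn_integral_mh_kernel nn_integral_target)
    also have "\<dots> = (\<integral>\<^sup>+x. (ennreal (p x) * f x) * (\<integral>\<^sup>+y. ennreal (move x y) * g y \<partial>lborel)
        + ennreal (p x) * ennreal (stay x) * (f x * g x) \<partial>lborel)"
      by (intro nn_integral_cong) (simp add: distrib_left mult_ac)
    also have "\<dots> = (\<integral>\<^sup>+x. (ennreal (p x) * f x) * (\<integral>\<^sup>+y. ennreal (move x y) * g y \<partial>lborel) \<partial>lborel)
        + (\<integral>\<^sup>+x. ennreal (p x) * ennreal (stay x) * (f x * g x) \<partial>lborel)"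
      by (intro nn_integral_add) measurable
    also have "(\<integral>\<^sup>+x. (ennreal (p x) * f x) * (\<integral>\<^sup>+y. ennreal (move x y) * g y \<partial>lborel) \<partial>lborel)
        = (\<integral>\<^sup>+x. \<integral>\<^sup>+y. ennreal (p x * move x y) * (f x * g y) \<partial>lborel \<partial>lborel)"
    proof (rule nn_integral_cong)
      fix x
      have "(ennreal (p x) * f x) * (\<integral>\<^sup>+y. ennreal (move x y) * g y \<partial>lborel)
          = (\<integral>\<^sup>+y. (ennreal (p x) * f x) * (ennreal (move x y) * g y) \<partial>lborel)"
        by (intro nn_integral_cmult[symmetric]) measurable
      also have "\<dots> = (\<integral>\<^sup>+y. ennreal (p x * move x y) * (f x * g y) \<partial>lborel)"
        using p_pos[of x] move_pos[of x] by (intro nn_integral_cong) (simp add: ennreal_mult less_imp_le mult_ac)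
      finally show "(ennreal (p x) * f x) * (\<integral>\<^sup>+y. ennreal (move x y) * g y \<partial>lborel)
          = (\<integral>\<^sup>+y. ennreal (p x * move x y) * (f x * g y) \<partial>lborel)" .
    qed
    finally show ?thesis .
  qed
  have "(\<integral>\<^sup>+x. \<integral>\<^sup>+y. ennreal (p x * move x y) * (f x * g y) \<partial>lborel \<partial>lborel)
      = (\<integral>\<^sup>+y. \<integral>\<^sup>+x. ennreal (p x * move x y) * (f x * g y) \<partial>lborel \<partial>lborel)"
    by (intro lborel_pair.Fubini'[symmetric]) measurable
  also have "\<dots> = (\<integral>\<^sup>+y. \<integral>\<^sup>+x. ennreal (p y * move y x) * (g y * f x) \<partial>lborel \<partial>lborel)"
    by (simp add: detailed_balance mult.commute)
  finally have "(\<integral>\<^sup>+x. \<integral>\<^sup>+y. ennreal (p x * move x y) * (f x * g y) \<partial>lborel \<partial>lborel)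
      = (\<integral>\<^sup>+y. \<integral>\<^sup>+x. ennreal (p y * move y x) * (g y * f x) \<partial>lborel \<partial>lborel)" .
  moreover have "(\<integral>\<^sup>+x. ennreal (p x) * ennreal (stay x) * (f x * g x) \<partial>lborel)
      = (\<integral>\<^sup>+x. ennreal (p x) * ennreal (stay x) * (g x * f x) \<partial>lborel)"
    by (simp add: mult.commute)
  ultimately show ?thesis
    unfolding flow[OF assms] flow[OF assms(2,1)] by (simp only:)
qed

lemma prob_space_target: "prob_space \<mu>"
  using p_density unfolding target_def is_density_def
  by (intro prob_spaceI) (simp add: emeasure_density)

sublocale stationary_kernel P \<mu>
proof (rule stationary_kernel.intro)
  show "P \<in> borel \<rightarrow>\<^sub>M prob_algebra borel"
    by (rule mh_kernel_measurable)
  show "prob_space \<mu>"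
    by (rule prob_space_target)
  show "sets \<mu> = sets borel"
    by (simp add: target_def)
  show "(\<integral>\<^sup>+x. \<integral>\<^sup>+y. f y \<partial>P x \<partial>\<mu>) = (\<integral>\<^sup>+x. f x \<partial>\<mu>)" if "f \<in> borel_measurable borel" for f
    using mh_reversible[of "\<lambda>_. 1" f] that by (simp add: prob_space.emeasure_space_1[OF prob_space_mh_kernel, simplified])
  fix x
  show "\<exists>c::real. \<forall>f\<in>borel_measurable borel. (\<integral>\<^sup>+y. f y \<partial>P x) \<le> ennreal c * (\<integral>\<^sup>+y. f y \<partial>\<mu>) + f x"
  proof (intro exI ballI)
    fix f :: "'a \<Rightarrow> ennreal" assume [measurable]: "f \<in> borel_measurable borel"
    have B: "0 \<le> B / p x"
      using q_le[of x x] q_pos[of x x] p_pos[of x] by simp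
    have "(\<integral>\<^sup>+y. ennreal (move x y) * f y \<partial>lborel) \<le> (\<integral>\<^sup>+y. ennreal (B / p x) * (ennreal (p y) * f y) \<partial>lborel)"
    proof (rule nn_integral_mono)
      fix y
      have "ennreal (move x y) \<le> ennreal (B / p x) * ennreal (p y)"
        using move_le(2)[of x y] B p_pos[of y] by (subst ennreal_mult[symmetric]) (auto intro: ennreal_leI less_imp_le)
      then show "ennreal (move x y) * f y \<le> ennreal (B / p x) * (ennreal (p y) * f y)"
        by (simp add: mult_right_mono flip: mult.assoc)
    qed
    also have "\<dots> = ennreal (B / p x) * (\<integral>\<^sup>+y. f y \<partial>\<mu>)"
      by (simp add: nn_integral_target nn_integral_cmult)
    finally have "(\<integral>\<^sup>+y. ennreal (move x y) * f y \<partial>lborel) \<le> ennreal (B / p x) * (\<integral>\<^sup>+y. f y \<partial>\<mu>)" .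
    moreover have "ennreal (stay x) * f x \<le> 1 * f x"
      using stay_bounds[of x] by (intro mult_right_mono) auto
    ultimately show "(\<integral>\<^sup>+y. f y \<partial>P x) \<le> ennreal (B / p x) * (\<integral>\<^sup>+y. f y \<partial>\<mu>) + f x"
      by (subst nn_integral_mh_kernel) (auto intro: add_mono)
  qed
qed

text \<open>
  The accepted density is continuous and positive, hence bounded below by some \<open>e > 0\<close> on a compact
  product of balls. The minorising measure is \<open>e\<close> times Lebesgue measure on the unit ball.
\<close>

lemma bounded_set_small:
  assumes S: "bounded S"
  shows "\<exists>\<nu> \<epsilon>. sets \<nu> = sets borel \<and> 0 < \<epsilon> \<and> ennreal \<epsilon> \<le> emeasure \<nu> (space \<nu>) \<and>
    (\<forall>x\<in>S. \<forall>f\<in>borel_measurable borel. (\<integral>\<^sup>+y. f y \<partial>\<nu>) \<le> (\<integral>\<^sup>+y. f y \<partial>P x))"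
proof -
  obtain r where r: "0 < r" "S \<subseteq> cball 0 r"
    using S unfolding bounded_pos by (auto simp: subset_eq)
  let ?T = "cball (0::'a) r \<times> cball (0::'a) 1"
  have "compact ?T" "?T \<noteq> {}"
    using r by (auto intro!: compact_Times)
  moreover have "continuous_on ?T (\<lambda>(x, y). move x y)"
    using move_continuous by (rule continuous_on_subset) simp
  ultimately obtain z where z: "z \<in> ?T" "\<And>w. w \<in> ?T \<Longrightarrow> (case z of (x, y) \<Rightarrow> move x y) \<le> (case w of (x, y) \<Rightarrow> move x y)"
    using continuous_attains_inf by metis
  define e where "e = (case z of (x, y) \<Rightarrow> move x y)"
  have e: "0 < e" "\<And>x y. x \<in> cball 0 r \<Longrightarrow> y \<in> cball 0 1 \<Longrightarrow> e \<le> move x y"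
    using move_pos z(2) by (auto simp: e_def split: prod.split)
  define \<nu> where "\<nu> = density lborel (\<lambda>y::'a. ennreal e * indicator (cball (0::'a) 1) y)"
  let ?c = "measure lborel (cball (0::'a) 1)"
  have [measurable]: "(\<lambda>y. ennreal e * indicator (cball (0::'a) 1) y) \<in> borel_measurable borel"
    by (intro borel_measurable_times_ennreal borel_measurable_indicator) auto
  have "emeasure \<nu> (space \<nu>) = (\<integral>\<^sup>+y. ennreal e * indicator (cball (0::'a) 1) y \<partial>lborel)"
    unfolding \<nu>_def by (subst emeasure_density) auto
  also have "\<dots> = ennreal e * emeasure lborel (cball (0::'a) 1)"
    by (simp add: nn_integral_cmult_indicator)
  also have "\<dots> = ennreal (e * ?c)"
    using e(1) emeasure_lborel_cball_finite[of "0::'a" 1]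
    by (simp add: emeasure_eq_ennreal_measure ennreal_mult less_top)
  finally have mass: "emeasure \<nu> (space \<nu>) = ennreal (e * ?c)" .
  have "(\<integral>\<^sup>+y. f y \<partial>\<nu>) \<le> (\<integral>\<^sup>+y. f y \<partial>P x)" if x: "x \<in> S" and [measurable]: "f \<in> borel_measurable borel" for x f
  proof -
    have "(\<integral>\<^sup>+y. f y \<partial>\<nu>) = (\<integral>\<^sup>+y. ennreal e * indicator (cball (0::'a) 1) y * f y \<partial>lborel)"
      by (simp add: \<nu>_def nn_integral_density)
    also have "\<dots> \<le> (\<integral>\<^sup>+y. ennreal (move x y) * f y \<partial>lborel)"
      using e(2)[of x] subsetD[OF r(2) x]
      by (intro nn_integral_mono mult_right_mono) (auto simp: indicator_def intro!: ennreal_leI)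
    also have "\<dots> \<le> (\<integral>\<^sup>+y. f y \<partial>P x)"
      by (simp add: nn_integral_mh_kernel)
    finally show ?thesis .
  qed
  moreover have "0 < e * ?c"
    using e(1) by (simp add: content_cball_pos)
  moreover have "sets \<nu> = sets borel"
    by (simp add: \<nu>_def)
  ultimately show ?thesis
    using mass by (intro exI[of _ \<nu>] exI[of _ "e * ?c"]) auto
qed

end

section \<open>Allotments\<close>

lemma rep_map_eq:
  assumes X: "is_allotment X" and j: "j \<le> asize X" and x: "x \<in> cell X j"
  shows "rep_map X x = rep X j"
proof -
  have "indicator (cell X i) x = (if i = j then 1 else 0 :: real)" if "i \<le> asize X" for i
    using X j x that by (auto simp: is_allotment_def disjoint_family_on_def indicator_def)
  then have "rep_map X x = (\<Sum>i\<le>asize X. (if i = j then rep X i else 0))"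
    unfolding rep_map_def by (intro sum.cong) auto
  then show ?thesis
    using j by simp
qed

lemma allotment_cellE:
  assumes "is_allotment X"
  obtains j where "j \<le> asize X" "x \<in> cell X j"
  using assms by (auto simp: is_allotment_def set_eq_iff)

lemma rep_map_measurable:
  assumes X: "is_allotment X"
  shows "rep_map X \<in> borel_measurable borel"
proof -
  have [measurable]: "cell X j \<in> sets borel" if "j \<in> {..asize X}" for j
    using X that by (auto simp: is_allotment_def)
  show ?thesis
    unfolding rep_map_def[abs_def]
    by (intro borel_measurable_sum borel_measurable_scaleR borel_measurable_indicator) auto
qed

text \<open>
  This is what the second half of the mesh is for: passing to representatives hardly raises \<open>W\<close>, also
  in the unbounded cell.
\<close>

lemma rep_map_weight_le:
  assumes X: "is_allotment X" and W: "\<And>x. 0 < W x" and mesh: "mesh X W \<le> ennreal \<delta>" and \<delta>: "0 \<le> \<delta>"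
  shows "W (rep_map X x) \<le> (1 + \<delta>) * W x"
proof -
  obtain j where j: "j \<le> asize X" "x \<in> cell X j"
    using allotment_cellE[OF X] by blast
  have "ennreal (W (rep X j) / W x - 1) \<le> (SUP y\<in>cell X j. ennreal (W (rep X j) / W y - 1))"
    using j by (intro SUP_upper)
  also have "\<dots> \<le> (SUP j\<in>{..asize X}. SUP y\<in>cell X j. ennreal (W (rep X j) / W y - 1))"
    using j by (intro SUP_upper) auto
  also have "\<dots> \<le> ennreal \<delta>"
    using mesh by (simp add: mesh_def)
  finally have "W (rep X j) / W x - 1 \<le> \<delta>"
    using \<delta> by (cases "W (rep X j) / W x - 1 \<ge> 0") (auto simp: ennreal_le_iff)
  then show ?thesis
    using W[of x] rep_map_eq[OF X j] by (simp add: field_simps)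
qed

section \<open>Bounds obtained in the limit\<close>

text \<open>
  Serves to turn a bound that improves at each application of a contraction into the bound at the fixed
  point.
\<close>

lemma geometric_improvement_bound:
  fixes z w L0 L' \<rho> :: real
  assumes \<rho>: "0 \<le> \<rho>" "\<rho> < 1" and bound: "\<And>k. z \<le> (\<rho> ^ k * L0 + L' / (1 - \<rho>)) * w"
  shows "z \<le> L' / (1 - \<rho>) * w"
proof -
  have "(\<lambda>k. (\<rho> ^ k * L0 + L' / (1 - \<rho>)) * w) \<longlonglongrightarrow> (0 * L0 + L' / (1 - \<rho>)) * w"
    using \<rho> by (intro tendsto_intros LIMSEQ_realpow_zero) auto
  then have "z \<le> (0 * L0 + L' / (1 - \<rho>)) * w"
    using bound by (intro LIMSEQ_le_const) auto
  then show ?thesis by simp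
qed

text \<open>
  In \<^typ>\<open>ennreal\<close> the quotient by 0 is infinite unless the numerator is 0, and the quotient by infinity
  is 0; both cases are compatible with the product bound, for positive \<open>c\<close>.
\<close>

lemma limsup_divide_finite:
  fixes a b :: "nat \<Rightarrow> ennreal"
  assumes "limsup (\<lambda>n. a n / b n) < \<infinity>"
  shows "\<exists>c::real. 0 \<le> c \<and> eventually (\<lambda>n. a n \<le> ennreal c * b n) sequentially"
proof -
  obtain c where c: "limsup (\<lambda>n. a n / b n) < c" "c < \<infinity>"
    using dense[OF assms] by blast
  have c0: "c \<noteq> 0"
    using c(1) by auto
  have *: "x \<le> c * y" if "x / y < c" for x y :: ennreal
  proof -
    consider "y = 0" | "y = \<infinity>" | "y \<noteq> 0" "y < \<infinity>"
      by (auto simp: less_top[symmetric])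
    then show ?thesis
    proof cases
      case 1
      have "x = 0"
      proof (rule ccontr)
        assume "x \<noteq> 0"
        then have "x / y = \<infinity>"
          using 1 by (simp add: divide_ennreal_def ennreal_mult_top)
        then show False
          using that by simp
      qed
      then show ?thesis by simp
    next
      case 2
      then show ?thesis
        using c0 by (simp add: ennreal_mult_top)
    next
      case 3
      have "x = x / y * y"
        using 3 by (simp add: ennreal_divide_times ennreal_divide_self)
      also have "\<dots> \<le> c * y"
        using that by (intro mult_right_mono) auto
      finally show ?thesis .
    qed
  qed
  have "eventually (\<lambda>n. a n / b n < c) sequentially"
    using c(1) by (rule Limsup_lessD)
  then have "eventually (\<lambda>n. a n \<le> ennreal (enn2real c) * b n) sequentially"
    by eventually_elim (use c(2) * in auto)
  then show ?thesis
    by (intro exI[of _ "enn2real c"]) auto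
qed

text \<open>
  Each of the finitely many remaining indices has its own constant because \<open>R n\<close> is positive.
\<close>

lemma uniform_constant_of_eventual:
  fixes R :: "nat \<Rightarrow> ennreal"
  assumes R: "\<And>n. 0 < R n" and ex: "\<And>n. \<exists>v. Q n v"
    and ev: "eventually (\<lambda>n. \<exists>v. Q n v \<and> ennreal v \<le> ennreal C * R n) sequentially"
  shows "\<exists>C0::real. C0 > 0 \<and> (\<forall>n. \<exists>v. Q n v \<and> ennreal v \<le> ennreal C0 * R n)"
proof -
  obtain N where N: "\<And>n. N \<le> n \<Longrightarrow> \<exists>v. Q n v \<and> ennreal v \<le> ennreal C * R n"
    using ev by (auto simp: eventually_sequentially)
  have single: "\<exists>c v. 0 \<le> c \<and> Q n v \<and> ennreal v \<le> ennreal c * R n" for n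
  proof -
    obtain v where v: "Q n v"
      using ex by blast
    show ?thesis
    proof (cases "R n" rule: ennreal_cases)
      case (real r)
      then have r: "0 < r"
        using R[of n] by simp
      have "ennreal v \<le> ennreal (\<bar>v\<bar> / r * r)"
        using r by (intro ennreal_leI) simp
      also have "\<dots> = ennreal (\<bar>v\<bar> / r) * R n"
        unfolding real(2) using r by (intro ennreal_mult) auto
      finally show ?thesis
        using v r by (intro exI[of _ "\<bar>v\<bar> / r"] exI[of _ v] conjI) simp_all
    next
      case top
      then show ?thesis
        using v by (intro exI[of _ 1] exI[of _ v] conjI) (simp_all add: ennreal_mult_top)
    qed
  qed
  then obtain c where c: "\<And>n. 0 \<le> c n" "\<And>n. \<exists>v. Q n v \<and> ennreal v \<le> ennreal (c n) * R n"
    by metis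
  define C0 where "C0 = 1 + \<bar>C\<bar> + (\<Sum>n<N. c n)"
  have sum0: "0 \<le> (\<Sum>n<N. c n)"
    by (intro sum_nonneg c)
  have "\<exists>v. Q n v \<and> ennreal v \<le> ennreal C0 * R n" for n
  proof -
    obtain C' v where v: "Q n v" "ennreal v \<le> ennreal C' * R n" and C': "C' \<le> C0"
    proof (cases "N \<le> n")
      case True
      have "C \<le> C0"
        using sum0 by (auto simp: C0_def)
      then show ?thesis
        using N[OF True] that by blast
    next
      case False
      have "c n \<le> (\<Sum>n<N. c n)"
        using False c(1) by (intro member_le_sum) auto
      then have "c n \<le> C0"
        by (simp add: C0_def)
      then show ?thesis
        using c(2)[of n] that by blast
    qed
    have "ennreal C' * R n \<le> ennreal C0 * R n"
      using C' by (intro mult_right_mono ennreal_leI) auto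
    then show ?thesis
      using v by (blast intro: order_trans)
  qed
  moreover have "0 < C0"
    using sum0 by (simp add: C0_def)
  ultimately show ?thesis
    by blast
qed

section \<open>The output of the scheme\<close>

context metropolis_hastings
begin

text \<open>
  The matrix of the scheme acts on step functions exactly as the kernel does at representatives.
\<close>

lemma scheme_output_poisson:
  assumes X: "is_allotment X" and G: "scheme_output P F X G"
  shows "G \<in> borel_measurable borel" "\<exists>b. \<forall>x. \<bar>G x\<bar> \<le> b" "\<And>x. G (rep_map X x) = G x"
    "\<exists>c. \<forall>x. G x - kernel_op P G (rep_map X x) = F (rep_map X x) - c"
proof -
  let ?J = "{..asize X}"
  obtain w fhat where
    eq: "\<And>i. i \<le> asize X \<Longrightarrow> fhat (rep X i) - (\<Sum>j\<in>?J. scheme_matrix P X i j * fhat (rep X j))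
           = F (rep X i) - (\<Sum>j\<in>?J. w j * F (rep X j))"
    and G_def: "G = (\<lambda>x. \<Sum>j\<in>?J. fhat (rep X j) * indicator (cell X j) x)"
    using G unfolding scheme_output_def by blast
  have cell: "cell X j \<in> sets borel" if "j \<in> ?J" for j
    using X that by (auto simp: is_allotment_def)
  show "G \<in> borel_measurable borel"
    unfolding G_def using cell by (intro borel_measurable_sum borel_measurable_times borel_measurable_indicator) auto
  have G_rep: "G x = fhat (rep X j)" if j: "j \<le> asize X" and x: "x \<in> cell X j" for x j
  proof -
    have "indicator (cell X i) x = (if i = j then 1 else 0 :: real)" if "i \<in> ?J" for i
      using X j x that by (auto simp: is_allotment_def disjoint_family_on_def indicator_def)
    then have "G x = (\<Sum>i\<in>?J. (if i = j then fhat (rep X i) else 0))"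
      unfolding G_def by (intro sum.cong) auto
    then show ?thesis
      using j by simp
  qed
  have rep: "rep X j \<in> cell X j" if "j \<le> asize X" for j
    using X that by (auto simp: is_allotment_def)
  show "G (rep_map X x) = G x" for x
  proof -
    obtain j where j: "j \<le> asize X" "x \<in> cell X j"
      using allotment_cellE[OF X] by blast
    then show ?thesis
      by (simp add: rep_map_eq[OF X] G_rep rep)
  qed
  have "\<bar>G x\<bar> \<le> (\<Sum>j\<in>?J. \<bar>fhat (rep X j)\<bar>)" for x
    unfolding G_def by (intro order_trans[OF sum_abs] sum_mono) (auto simp: abs_mult indicator_def)
  then show "\<exists>b. \<forall>x. \<bar>G x\<bar> \<le> b"
    by blast
  have PG: "kernel_op P G z = (\<Sum>j\<in>?J. measure (P z) (cell X j) * fhat (rep X j))" for z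
  proof -
    have "kernel_op P G z = (\<Sum>j\<in>?J. \<integral>y. fhat (rep X j) * indicator (cell X j) y \<partial>P z)"
      unfolding kernel_op_def G_def using cell
      by (intro Bochner_Integration.integral_sum integrable_mult_right) (auto intro!: integrable_real_indicator simp: P.emeasure_finite less_top[symmetric])
    also have "\<dots> = (\<Sum>j\<in>?J. measure (P z) (cell X j) * fhat (rep X j))"
      using cell by (intro sum.cong) auto
    finally show ?thesis .
  qed
  have "G x - kernel_op P G (rep_map X x) = F (rep_map X x) - (\<Sum>j\<in>?J. w j * F (rep X j))" for x
  proof -
    obtain j where j: "j \<le> asize X" "x \<in> cell X j"
      using allotment_cellE[OF X] by blast
    then show ?thesis
      using eq[OF j(1)] by (simp add: rep_map_eq[OF X] G_rep PG scheme_matrix_def)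
  qed
  then show "\<exists>c. \<forall>x. G x - kernel_op P G (rep_map X x) = F (rep_map X x) - c"
    by blast
qed

text \<open>
  As \<open>G\<close> has the same value at \<open>x\<close> and at its representative, the rejection parts combine with the
  moves, and the difference is the integral over \<open>y\<close> of \<open>G y - G x\<close> against the difference of the accepted densities.
  Constants cancel in \<open>G y - G x\<close>, so only \<open>G - s\<close> counts.
\<close>

lemma kernel_op_discretization_error:
  assumes [measurable]: "G \<in> borel_measurable borel" "V \<in> borel_measurable borel" and b: "\<And>y. \<bar>G y\<bar> \<le> b"
    and GV: "\<And>y. \<bar>G y - s\<bar> \<le> K * V y" and K: "0 \<le> K" and X: "is_allotment X"
    and G_rep: "\<And>x. G (rep_map X x) = G x" and V: "\<And>y. 0 \<le> V y"
  shows "ennreal \<bar>kernel_op P G x - kernel_op P G (rep_map X x)\<bar>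
    \<le> ennreal K * (\<integral>\<^sup>+y. ennreal ((V x + V y) * proposal_gap p q X x y) \<partial>lborel)"
proof -
  define a where "a = rep_map X x"
  note int = kernel_op_bounded(1)[of G b x] kernel_op_bounded(1)[of G b a] integrable_move[of x] integrable_move[of a]
  have "kernel_op P G x - kernel_op P G a
      = ((\<integral>y. move x y * G y \<partial>lborel) - (\<integral>y. move a y * G y \<partial>lborel))
        - ((\<integral>y. move x y \<partial>lborel) - (\<integral>y. move a y \<partial>lborel)) * G x"
    using kernel_op_bounded(2)[of G b x] kernel_op_bounded(2)[of G b a] b G_rep[of x]
    by (simp add: stay_def a_def algebra_simps)
  also have "\<dots> = (\<integral>y. (move x y * G y - move a y * G y) - (move x y - move a y) * G x \<partial>lborel)"
    using int b by simp
  also have "\<dots> = (\<integral>y. (move x y - move a y) * (G y - G x) \<partial>lborel)"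
    by (simp add: algebra_simps)
  finally have eq: "kernel_op P G x - kernel_op P G a = (\<integral>y. (move x y - move a y) * (G y - G x) \<partial>lborel)" .
  have gap: "proposal_gap p q X x y = \<bar>move x y - move a y\<bar>" for y
    by (simp add: proposal_gap_def a_def abs_minus_commute flip: move_def)
  have "integrable lborel (\<lambda>y. (move x y - move a y) * (G y - G x))"
  proof -
    have "integrable lborel (\<lambda>y. (move x y * G y - move a y * G y) - (move x y - move a y) * G x)"
      using int b by auto
    then show ?thesis
      by (simp add: algebra_simps)
  qed
  then have "ennreal \<bar>kernel_op P G x - kernel_op P G a\<bar>
      \<le> (\<integral>\<^sup>+y. ennreal (norm ((move x y - move a y) * (G y - G x))) \<partial>lborel)"
    unfolding eq real_norm_def[symmetric] by (rule integral_norm_bound_ennreal)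
  also have "\<dots> \<le> (\<integral>\<^sup>+y. ennreal K * ennreal ((V x + V y) * proposal_gap p q X x y) \<partial>lborel)"
  proof (rule nn_integral_mono)
    fix y
    have "\<bar>G y - G x\<bar> \<le> K * (V x + V y)"
      using GV[of x] GV[of y] by (simp add: distrib_left)
    then have "\<bar>move x y - move a y\<bar> * \<bar>G y - G x\<bar> \<le> \<bar>move x y - move a y\<bar> * (K * (V x + V y))"
      by (rule mult_left_mono) simp
    then have "norm ((move x y - move a y) * (G y - G x)) \<le> K * ((V x + V y) * proposal_gap p q X x y)"
      by (simp add: abs_mult gap mult_ac)
    then show "ennreal (norm ((move x y - move a y) * (G y - G x))) \<le> ennreal K * ennreal ((V x + V y) * proposal_gap p q X x y)"
      using K V[of x] V[of y] by (subst ennreal_mult[symmetric]) (auto simp: gap intro: ennreal_leI)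
  qed
  also have "\<dots> = ennreal K * (\<integral>\<^sup>+y. ennreal ((V x + V y) * proposal_gap p q X x y) \<partial>lborel)"
    unfolding gap by (intro nn_integral_cmult) measurable
  finally show ?thesis
    by (simp add: a_def)
qed

end

section \<open>Bounds that are uniform in the allotment\<close>

locale metropolis_hastings_drift = metropolis_hastings p q B
  for p :: "'a::euclidean_space \<Rightarrow> real" and q B +
  fixes V :: "'a \<Rightarrow> real" and lam K :: real
  assumes V_continuous: "continuous_on UNIV V" and V_ge_1: "\<And>x. 1 \<le> V x"
    and V_square: "(\<integral>\<^sup>+x. ennreal ((V x)\<^sup>2) \<partial>\<mu>) < \<infinity>"
    and V_sublevel: "\<And>c. 1 \<le> c \<Longrightarrow> bounded (V -` {1..c})"
    and lam: "0 < lam" "lam < 1" and K: "0 < K"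
    and drift: "\<And>x. (\<integral>\<^sup>+y. ennreal (V y) \<partial>P x) \<le> ennreal (lam * V x + K)"
begin

lemma V_meas [measurable]: "V \<in> borel_measurable borel"
  by (intro borel_measurable_continuous_onI V_continuous)

lemma V_pos: "0 < V x"
  using V_ge_1[of x] by linarith

text \<open>
  Moving the starting point by \<open>a\<close> costs a factor \<open>1 + \<delta>\<close> in \<open>V\<close>. For small \<open>\<delta>\<close> the drift still holds
  with the rate \<open>\<gamma>\<close> half-way between \<open>lam\<close> and 1, and the minorisation holds on \<open>V \<le> R\<close> if it is
  arranged on \<open>V \<le> 2 R\<close>. So the contraction constants do not depend on \<open>a\<close>.
\<close>

lemma uniform_contraction:
  "\<exists>\<beta> \<rho> \<delta>. 0 < \<beta> \<and> 0 \<le> \<rho> \<and> \<rho> < 1 \<and> 0 < \<delta> \<and> \<delta> \<le> 1 \<and>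
    (\<forall>a. (\<forall>x. V (a x) \<le> (1 + \<delta>) * V x) \<longrightarrow>
      (\<forall>\<phi> L x y. \<phi> \<in> borel_measurable borel \<longrightarrow> 0 \<le> L \<longrightarrow>
        (\<forall>x y. \<bar>\<phi> x - \<phi> y\<bar> \<le> L * osc_weight \<beta> V x y) \<longrightarrow>
        \<bar>kernel_op P \<phi> (a x) - kernel_op P \<phi> (a y)\<bar> \<le> \<rho> * (L * osc_weight \<beta> V x y)))"
proof -
  define \<gamma> where "\<gamma> = (1 + lam) / 2"
  (* Chosen such that lam * (1 + delta) is at most gamma. *)
  define \<delta> where "\<delta> = min 1 ((1 - lam) / (2 * lam))"
  define R where "R = 4 * K / (1 - \<gamma>)"
  have \<gamma>: "0 \<le> \<gamma>" "\<gamma> < 1"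
    using lam by (auto simp: \<gamma>_def)
  have \<delta>: "0 < \<delta>" "\<delta> \<le> 1"
    using lam by (auto simp: \<delta>_def)
  have lam\<delta>: "lam * (1 + \<delta>) \<le> \<gamma>"
  proof -
    have "lam * \<delta> \<le> lam * ((1 - lam) / (2 * lam))"
      using lam by (intro mult_left_mono) (auto simp: \<delta>_def)
    also have "\<dots> = (1 - lam) / 2"
      using lam by simp
    finally show ?thesis
      by (simp add: \<gamma>_def distrib_left field_simps)
  qed
  have "0 < K / (1 - \<gamma>)"
    using K \<gamma> by simp
  then have R: "2 * K / (1 - \<gamma>) < R" "0 < R"
    by (auto simp: R_def)
  have "{x. V x \<le> 2 * R} \<subseteq> V -` {1..max 1 (2 * R)}"
    using V_ge_1 by auto
  then have "bounded {x. V x \<le> 2 * R}"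
    using V_sublevel[of "max 1 (2 * R)"] by (rule bounded_subset[rotated]) simp
  from bounded_set_small[OF this] obtain \<nu> \<epsilon> where \<nu>: "sets \<nu> = sets borel" "ennreal \<epsilon> \<le> emeasure \<nu> (space \<nu>)"
    and \<epsilon>: "0 < \<epsilon>" and minor: "\<And>x f. V x \<le> 2 * R \<Longrightarrow> f \<in> borel_measurable borel \<Longrightarrow>
      (\<integral>\<^sup>+y. f y \<partial>\<nu>) \<le> (\<integral>\<^sup>+y. f y \<partial>P x)"
    by auto
  define \<beta> \<rho> where "\<beta> = \<epsilon> / (2 * K)" and "\<rho> = contraction_rate \<gamma> K R \<epsilon>"
  have \<rho>: "0 \<le> \<rho>" "\<rho> < 1"
    unfolding \<rho>_def using contraction_rate_bounds[OF \<gamma> K R(1) \<epsilon>] by auto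
  have "\<bar>kernel_op P \<phi> (a x) - kernel_op P \<phi> (a y)\<bar> \<le> \<rho> * (L * osc_weight \<beta> V x y)"
    if a: "\<And>x. V (a x) \<le> (1 + \<delta>) * V x" and \<phi>: "\<phi> \<in> borel_measurable borel" "0 \<le> L"
      "\<And>x y. \<bar>\<phi> x - \<phi> y\<bar> \<le> L * osc_weight \<beta> V x y" for a \<phi> L x y
    unfolding kernel_op_def \<rho>_def \<beta>_def
  proof (rule weighted_oscillation_contraction[where Q="\<lambda>x. P (a x)" and \<nu>=\<nu>, OF \<gamma> K R(1) \<epsilon>])
    show "prob_space (P (a x))" "sets (P (a x)) = sets borel" for x
      by (simp_all add: prob_space_mh_kernel)
    show "(\<integral>\<^sup>+y. ennreal (V y) \<partial>P (a x)) \<le> ennreal (\<gamma> * V x + K)" for x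
    proof (rule order_trans[OF drift ennreal_leI])
      have "lam * V (a x) \<le> lam * ((1 + \<delta>) * V x)"
        using a lam by (intro mult_left_mono) auto
      also have "\<dots> \<le> \<gamma> * V x"
        using mult_right_mono[OF lam\<delta>, of "V x"] V_pos[of x] by (simp add: mult.assoc)
      finally show "lam * V (a x) + K \<le> \<gamma> * V x + K"
        by simp
    qed
    show "(\<integral>\<^sup>+y. f y \<partial>\<nu>) \<le> (\<integral>\<^sup>+y. f y \<partial>P (a x))" if "V x \<le> R" "f \<in> borel_measurable borel" for x f
    proof (rule minor[OF _ that(2)])
      have "(1 + \<delta>) * V x \<le> 2 * R"
        using \<delta> that(1) V_pos[of x] by (intro mult_mono) auto
      then show "V (a x) \<le> 2 * R"
        using a[of x] by linarith
    qed
  qed (use \<nu> \<phi> V_pos in \<open>auto simp: \<beta>_def less_imp_le\<close>)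
  moreover have "0 < \<beta>"
    using K \<epsilon> by (simp add: \<beta>_def)
  ultimately show ?thesis
    using \<rho> \<delta> by blast
qed

text \<open>
  The contraction is supplied by \<open>uniform_contraction\<close> with the identity for \<open>a\<close>. The last parameter
  bounds \<open>P V / V\<close>, since \<open>V \<ge> 1\<close>.
\<close>

lemma reversible_ergodic:
  assumes \<beta>: "0 < \<beta>" and \<rho>: "0 \<le> \<rho>" "\<rho> < 1"
    and contr: "\<And>\<phi> L x y. \<phi> \<in> borel_measurable borel \<Longrightarrow> 0 \<le> L \<Longrightarrow>
        (\<And>x y. \<bar>\<phi> x - \<phi> y\<bar> \<le> L * osc_weight \<beta> V x y) \<Longrightarrow>
        \<bar>kernel_op P \<phi> x - kernel_op P \<phi> y\<bar> \<le> \<rho> * (L * osc_weight \<beta> V x y)"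
  shows "reversible_ergodic_kernel P \<mu> V \<beta> \<rho> (lam + K)"
proof unfold_locales
  show "integrable \<mu> (\<lambda>x. (V x)\<^sup>2)"
    using V_square by (intro integrableI_bounded) (auto simp: measurable_stationary)
  show "kernel_op P V x \<le> (lam + K) * V x" for x
  proof -
    have V0: "0 \<le> V y" for y
      using V_pos[of y] by simp
    have int: "integrable (P x) V"
      using drift[of x] V0 by (intro integrableI_bounded) (auto simp: le_less_trans)
    have "ennreal (kernel_op P V x) = (\<integral>\<^sup>+y. ennreal (V y) \<partial>P x)"
      unfolding kernel_op_def using int V0 by (intro nn_integral_eq_integral[symmetric]) auto
    also note drift
    finally have "kernel_op P V x \<le> lam * V x + K"
      using lam K V0[of x] by (subst (asm) ennreal_le_iff) auto
    also have "\<dots> \<le> (lam + K) * V x"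
      using mult_left_mono[OF V_ge_1[of x], of K] K by (simp add: distrib_right)
    finally show ?thesis .
  qed
  show "\<bar>kernel_op P \<phi> x - kernel_op P \<phi> y\<bar> \<le> \<rho> * (L * osc_weight \<beta> V x y)"
    if "\<phi> \<in> borel_measurable borel" "0 \<le> L" "\<And>x y. \<bar>\<phi> x - \<phi> y\<bar> \<le> L * osc_weight \<beta> V x y" for \<phi> L x y
    using that by (rule contr)
  show "(\<integral>\<^sup>+x. f x * (\<integral>\<^sup>+y. g y \<partial>P x) \<partial>\<mu>) = (\<integral>\<^sup>+x. g x * (\<integral>\<^sup>+y. f y \<partial>P x) \<partial>\<mu>)"
    if "f \<in> borel_measurable borel" "g \<in> borel_measurable borel" for f g
    using that by (rule mh_reversible)
qed (use V_ge_1 \<beta> \<rho> in simp_all)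

text \<open>
  The kernel \<open>P (a x)\<close> contracts oscillations, so Poisson's equation bounds the oscillation of \<open>G\<close> by
  that of \<open>F \<circ> a\<close>, up to the factor \<open>1 / (1 - \<rho>)\<close>. A bound on \<open>\<bar>G\<bar>\<close> that depends on the allotment
  only starts the iteration and disappears from the result.
\<close>

lemma scheme_output_stability:
  assumes \<beta>: "0 < \<beta>" and \<rho>: "0 \<le> \<rho>" "\<rho> < 1" and X: "is_allotment X" and G: "scheme_output P F X G"
    and aV: "\<And>x. V (rep_map X x) \<le> 2 * V x" and F: "\<And>x. \<bar>F x\<bar> \<le> cF * V x"
    and contr: "\<And>\<phi> L x y. \<phi> \<in> borel_measurable borel \<Longrightarrow> 0 \<le> L \<Longrightarrow>
        (\<And>x y. \<bar>\<phi> x - \<phi> y\<bar> \<le> L * osc_weight \<beta> V x y) \<Longrightarrow>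
        \<bar>kernel_op P \<phi> (rep_map X x) - kernel_op P \<phi> (rep_map X y)\<bar> \<le> \<rho> * (L * osc_weight \<beta> V x y)"
  shows "\<exists>s. \<forall>x. \<bar>G x - s\<bar> \<le> (2 * cF / \<beta>) / (1 - \<rho>) * (1 + \<beta>) * V x"
proof -
  note G_props = scheme_output_poisson[OF X G]
  obtain b where b: "\<And>x. \<bar>G x\<bar> \<le> b"
    using G_props(2) by blast
  obtain c where c: "\<And>x. G x - kernel_op P G (rep_map X x) = F (rep_map X x) - c"
    using G_props(4) by blast
  have cF: "0 \<le> cF"
    using F[of undefined] V_pos[of undefined] by (meson abs_ge_zero order_trans zero_le_mult_iff not_le)
  have b0: "0 \<le> b"
    using b[of undefined] by linarith
  define L' where "L' = 2 * cF / \<beta>"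
  have L': "0 \<le> L'"
    using cF \<beta> by (simp add: L'_def)
  have w: "2 \<le> osc_weight \<beta> V x y" for x y
    using V_pos[of x] V_pos[of y] \<beta> by (simp add: osc_weight_def)
  have Fosc: "\<bar>F (rep_map X x) - F (rep_map X y)\<bar> \<le> L' * osc_weight \<beta> V x y" for x y
  proof -
    have "\<bar>F (rep_map X x) - F (rep_map X y)\<bar> \<le> cF * V (rep_map X x) + cF * V (rep_map X y)"
      using F[of "rep_map X x"] F[of "rep_map X y"] by linarith
    also have "\<dots> \<le> cF * (2 * V x) + cF * (2 * V y)"
      using aV cF by (intro add_mono mult_left_mono) auto
    also have "\<dots> \<le> L' * osc_weight \<beta> V x y"
      using \<beta> cF by (simp add: L'_def osc_weight_def field_simps)
    finally show ?thesis .
  qed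
  have iter: "\<bar>G x - G y\<bar> \<le> (\<rho> ^ k * b + L' / (1 - \<rho>)) * osc_weight \<beta> V x y" for k x y
  proof (induction k arbitrary: x y)
    case 0
    have "\<bar>G x - G y\<bar> \<le> b * 2"
      using b[of x] b[of y] by linarith
    also have "\<dots> \<le> (b + L' / (1 - \<rho>)) * osc_weight \<beta> V x y"
      using b0 L' \<rho> w by (intro mult_mono) auto
    finally show ?case by simp
  next
    case (Suc k)
    let ?L = "\<rho> ^ k * b + L' / (1 - \<rho>)"
    have "\<bar>kernel_op P G (rep_map X x) - kernel_op P G (rep_map X y)\<bar> \<le> \<rho> * (?L * osc_weight \<beta> V x y)"
      using Suc b0 L' \<rho> by (intro contr G_props(1)) auto
    moreover have "G x - G y = (kernel_op P G (rep_map X x) - kernel_op P G (rep_map X y))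
        + (F (rep_map X x) - F (rep_map X y))"
      using c[of x] c[of y] by linarith
    ultimately have "\<bar>G x - G y\<bar> \<le> \<rho> * (?L * osc_weight \<beta> V x y) + L' * osc_weight \<beta> V x y"
      using Fosc[of x y] by linarith
    also have "\<dots> = (\<rho> ^ Suc k * b + L' / (1 - \<rho>)) * osc_weight \<beta> V x y"
      using \<rho> by (simp add: field_simps)
    finally show ?case .
  qed
  have Gosc: "\<bar>G x - G y\<bar> \<le> L' / (1 - \<rho>) * osc_weight \<beta> V x y" for x y
    by (rule geometric_improvement_bound[OF \<rho> iter])
  define M where "M = L' / (1 - \<rho>)"
  have M: "0 \<le> M"
    using L' \<rho> by (simp add: M_def)
  have "\<exists>s. \<forall>x. \<bar>G x - s\<bar> \<le> M * (1 + \<beta> * V x)"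
    using Gosc by (intro recentering) (simp add: M_def osc_weight_def algebra_simps)
  then obtain s where s: "\<And>x. \<bar>G x - s\<bar> \<le> M * (1 + \<beta> * V x)"
    by blast
  have "M * (1 + \<beta> * V x) \<le> M * ((1 + \<beta>) * V x)" for x
    using V_ge_1[of x] M by (intro mult_left_mono) (auto simp: distrib_right)
  then have "\<bar>G x - s\<bar> \<le> M * (1 + \<beta>) * V x" for x
    using s[of x] order_trans by (simp only: mult.assoc) blast
  then show ?thesis
    unfolding M_def L'_def by blast
qed

lemma scheme_output_V_bounded:
  assumes "is_allotment X" "scheme_output P F X G"
  shows "V_bounded V G"
proof -
  obtain b where b: "\<And>x. \<bar>G x\<bar> \<le> b"
    using scheme_output_poisson(2)[OF assms] by blast
  have b0: "0 \<le> b"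
    using b[of undefined] by linarith
  have "\<bar>G x\<bar> \<le> b * V x" for x
    using b[of x] mult_left_mono[OF V_ge_1[of x] b0] by simp
  then show ?thesis
    using scheme_output_poisson(1)[OF assms] b0 by (intro V_boundedI[of _ b]) auto
qed

text \<open>
  The crude bound by \<open>A V\<close> is used on the cell \<open>J\<close>, which lies far out, and the finer bounds on its complement.
\<close>

lemma discretization_error_square_integral:
  fixes e0 e1 :: "'a \<Rightarrow> real" and m :: ennreal
  assumes [measurable]: "e0 \<in> borel_measurable borel" "e1 \<in> borel_measurable borel" "J \<in> sets borel"
    "I \<in> borel_measurable borel"
    and A: "\<And>x. \<bar>e0 x + e1 x\<bar> \<le> A * V x" "0 \<le> A"
    and e1: "\<And>x. ennreal \<bar>e1 x\<bar> \<le> ennreal M * I x" and M: "0 \<le> M"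
    and c0: "(\<integral>\<^sup>+x\<in>- J. ennreal (\<bar>e0 x\<bar>\<^sup>2) \<partial>\<mu>) \<le> ennreal c0 * m" "0 \<le> c0"
    and c1: "(\<integral>\<^sup>+x\<in>- J. (I x)\<^sup>2 \<partial>\<mu>) \<le> ennreal c1 * m" "0 \<le> c1"
  shows "(\<integral>\<^sup>+x. ennreal ((e0 x + e1 x)\<^sup>2) \<partial>\<mu>)
    \<le> ennreal (A\<^sup>2 + 2 * c0 + 2 * (M\<^sup>2 * c1)) * max (\<integral>\<^sup>+x\<in>J. ennreal ((V x)\<^sup>2) \<partial>\<mu>) m"
    (is "_ \<le> _ * ?R")
proof -
  have J [measurable]: "- J \<in> sets borel"
    using assms(3) by (rule borel_comp)
  have "(\<integral>\<^sup>+x. ennreal ((e0 x + e1 x)\<^sup>2) \<partial>\<mu>)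
      = (\<integral>\<^sup>+x. ennreal ((e0 x + e1 x)\<^sup>2) * indicator J x + ennreal ((e0 x + e1 x)\<^sup>2) * indicator (- J) x \<partial>\<mu>)"
    by (intro nn_integral_cong) (auto simp: indicator_def)
  also have "\<dots> \<le> (\<integral>\<^sup>+x. ennreal (A\<^sup>2) * (ennreal ((V x)\<^sup>2) * indicator J x)
      + (2 * (ennreal (\<bar>e0 x\<bar>\<^sup>2) * indicator (- J) x) + 2 * (ennreal (M\<^sup>2) * ((I x)\<^sup>2 * indicator (- J) x))) \<partial>\<mu>)"
  proof (intro nn_integral_mono add_mono)
    fix x
    have "(e0 x + e1 x)\<^sup>2 \<le> (A * V x)\<^sup>2"
      using A(1)[of x] by (rule abs_le_square_iff[THEN iffD1, OF order_trans[OF _ abs_ge_self]])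
    then have "ennreal ((e0 x + e1 x)\<^sup>2) \<le> ennreal (A\<^sup>2) * ennreal ((V x)\<^sup>2)"
      by (simp add: power_mult_distrib ennreal_mult[symmetric] ennreal_leI)
    then show "ennreal ((e0 x + e1 x)\<^sup>2) * indicator J x \<le> ennreal (A\<^sup>2) * (ennreal ((V x)\<^sup>2) * indicator J x)"
      by (auto simp: indicator_def)
    have "(e0 x + e1 x)\<^sup>2 \<le> 2 * \<bar>e0 x\<bar>\<^sup>2 + 2 * \<bar>e1 x\<bar>\<^sup>2"
      using zero_le_power2[of "e0 x - e1 x"] by (simp add: power2_eq_square algebra_simps)
    then have "ennreal ((e0 x + e1 x)\<^sup>2) \<le> ennreal (2 * \<bar>e0 x\<bar>\<^sup>2 + 2 * \<bar>e1 x\<bar>\<^sup>2)"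
      by (rule ennreal_leI)
    also have "\<dots> = 2 * ennreal (\<bar>e0 x\<bar>\<^sup>2) + 2 * (ennreal \<bar>e1 x\<bar>)\<^sup>2"
      by (simp add: ennreal_plus ennreal_mult ennreal_power)
    also have "(ennreal \<bar>e1 x\<bar>)\<^sup>2 \<le> (ennreal M * I x)\<^sup>2"
      using e1 by (rule power_mono_ennreal)
    also have "\<dots> = ennreal (M\<^sup>2) * (I x)\<^sup>2"
      using M by (simp add: power_mult_distrib ennreal_power)
    finally have "ennreal ((e0 x + e1 x)\<^sup>2) \<le> 2 * ennreal (\<bar>e0 x\<bar>\<^sup>2) + 2 * (ennreal (M\<^sup>2) * (I x)\<^sup>2)"
      by (simp add: mult_left_mono add_left_mono)
    then show "ennreal ((e0 x + e1 x)\<^sup>2) * indicator (- J) x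
        \<le> 2 * (ennreal (\<bar>e0 x\<bar>\<^sup>2) * indicator (- J) x) + 2 * (ennreal (M\<^sup>2) * ((I x)\<^sup>2 * indicator (- J) x))"
      by (auto simp: indicator_def)
  qed
  also have "\<dots> = ennreal (A\<^sup>2) * (\<integral>\<^sup>+x\<in>J. ennreal ((V x)\<^sup>2) \<partial>\<mu>)
      + (2 * (\<integral>\<^sup>+x\<in>- J. ennreal (\<bar>e0 x\<bar>\<^sup>2) \<partial>\<mu>) + 2 * (ennreal (M\<^sup>2) * (\<integral>\<^sup>+x\<in>- J. (I x)\<^sup>2 \<partial>\<mu>)))"
    by (subst nn_integral_add nn_integral_cmult; measurable)+
  also have "\<dots> \<le> ennreal (A\<^sup>2) * ?R + (2 * (ennreal c0 * ?R) + 2 * (ennreal (M\<^sup>2) * (ennreal c1 * ?R)))"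
    by (intro add_mono mult_left_mono order_trans[OF c0(1)] order_trans[OF c1(1)]) auto
  also have "\<dots> = (ennreal (A\<^sup>2) + 2 * ennreal c0 + 2 * (ennreal (M\<^sup>2) * ennreal c1)) * ?R"
    by (simp add: distrib_right mult.assoc add.assoc)
  also have "ennreal (A\<^sup>2) + 2 * ennreal c0 + 2 * (ennreal (M\<^sup>2) * ennreal c1) = ennreal (A\<^sup>2 + 2 * c0 + 2 * (M\<^sup>2 * c1))"
    using c0(2) c1(2) by (simp add: ennreal_plus ennreal_mult)
  finally show ?thesis .
qed

section \<open>The variance bound\<close>

text \<open>
  For fine allotments the uniform bounds apply and give one constant. For the other indices
  some constant works, because \<open>J\<^sub>0\<close> has positive Lebesgue measure and the target density is positive.
\<close>

lemma scheme_variance_bound: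
  assumes F: "V_bounded V F" and X: "\<And>n. is_allotment (X n)" and mesh: "(\<lambda>n. mesh (X n) V) \<longlonglongrightarrow> 0"
    and G: "\<And>n. scheme_output P F (X n) (G n)"
    and limsup_kernel: "limsup (\<lambda>n.
         (\<integral>\<^sup>+x\<in>- cell (X n) 0.
            (\<integral>\<^sup>+y. ennreal ((V x + V y) * proposal_gap p q (X n) x y) \<partial>lborel)\<^sup>2 \<partial>\<mu>)
         / (mesh (X n) V)\<^sup>2) < \<infinity>"
    and limsup_F: "limsup (\<lambda>n.
         (\<integral>\<^sup>+x\<in>- cell (X n) 0. ennreal (\<bar>F x - F (rep_map (X n) x)\<bar>\<^sup>2) \<partial>\<mu>)
         / (mesh (X n) V)\<^sup>2) < \<infinity>"
  shows "\<exists>C0::real. C0 > 0 \<and> (\<forall>n. \<exists>v.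
      is_asymptotic_variance P \<mu> (\<lambda>x. F x + kernel_op P (G n) x - G n x) v \<and>
      ennreal v \<le> ennreal C0 *
        max (\<integral>\<^sup>+x\<in>cell (X n) 0. ennreal ((V x)\<^sup>2) \<partial>\<mu>) ((mesh (X n) V)\<^sup>2))"
proof -
  obtain \<beta> \<rho> \<delta> where \<beta>: "0 < \<beta>" and \<rho>: "0 \<le> \<rho>" "\<rho> < 1" and \<delta>: "0 < \<delta>" "\<delta> \<le> 1"
    and contr: "\<And>a \<phi> L x y. (\<And>x. V (a x) \<le> (1 + \<delta>) * V x) \<Longrightarrow> \<phi> \<in> borel_measurable borel \<Longrightarrow> 0 \<le> L \<Longrightarrow>
        (\<And>x y. \<bar>\<phi> x - \<phi> y\<bar> \<le> L * osc_weight \<beta> V x y) \<Longrightarrow>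
        \<bar>kernel_op P \<phi> (a x) - kernel_op P \<phi> (a y)\<bar> \<le> \<rho> * (L * osc_weight \<beta> V x y)"
    using uniform_contraction by metis
  define D where "D = lam + K"
  interpret E: reversible_ergodic_kernel P \<mu> V \<beta> \<rho> D
    unfolding D_def
  proof (rule reversible_ergodic[OF \<beta> \<rho>])
    show "\<bar>kernel_op P \<phi> x - kernel_op P \<phi> y\<bar> \<le> \<rho> * (L * osc_weight \<beta> V x y)"
      if "\<phi> \<in> borel_measurable borel" "0 \<le> L" "\<And>x y. \<bar>\<phi> x - \<phi> y\<bar> \<le> L * osc_weight \<beta> V x y" for \<phi> L x y
      using contr[of "\<lambda>x. x" \<phi> L x y] that \<delta> V_pos by (simp add: distrib_right less_imp_le)
  qed
  obtain cF where cF: "0 \<le> cF" "\<And>x. \<bar>F x\<bar> \<le> cF * V x"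
    using F unfolding V_bounded_def by blast
  note [measurable] = V_bounded_measurable[OF F]
  have VG: "V_bounded V (G n)" for n
    by (rule scheme_output_V_bounded[OF X G])
  define H where "H = (\<lambda>n x. F x + kernel_op P (G n) x - G n x)"
  have VH: "V_bounded V (H n)" for n
    unfolding H_def by (intro V_bounded_diff V_bounded_add F VG E.V_bounded_kernel_op)
  define R where "R = (\<lambda>n. max (\<integral>\<^sup>+x\<in>cell (X n) 0. ennreal ((V x)\<^sup>2) \<partial>\<mu>) ((mesh (X n) V)\<^sup>2))"
  have J0: "cell (X n) 0 \<in> sets borel" "0 < emeasure lborel (cell (X n) 0)" for n
    using X[of n] by (auto simp: is_allotment_def)
  have R_pos: "0 < R n" for n
  proof -
    note [measurable] = J0(1)[of n]
    have "(\<integral>\<^sup>+x\<in>cell (X n) 0. ennreal ((V x)\<^sup>2) \<partial>\<mu>) \<noteq> 0"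
    proof
      assume "(\<integral>\<^sup>+x\<in>cell (X n) 0. ennreal ((V x)\<^sup>2) \<partial>\<mu>) = 0"
      then have "(\<integral>\<^sup>+x. ennreal (p x) * (ennreal ((V x)\<^sup>2) * indicator (cell (X n) 0) x) \<partial>lborel) = 0"
        by (subst (asm) nn_integral_target) measurable
      then have "AE x in lborel. ennreal (p x) * (ennreal ((V x)\<^sup>2) * indicator (cell (X n) 0) x) = 0"
        by (subst (asm) nn_integral_0_iff_AE) measurable
      then have "AE x in lborel. x \<notin> cell (X n) 0"
      proof eventually_elim
        case (elim x)
        then show ?case
          using p_pos[of x] V_pos[of x] by (auto simp: indicator_def)
      qed
      then have "emeasure lborel (cell (X n) 0) = 0"
        using AE_iff_measurable[of "cell (X n) 0" lborel "\<lambda>x. x \<notin> cell (X n) 0"] J0(1)[of n] by auto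
      then show False
        using J0(2)[of n] by simp
    qed
    then show ?thesis
      by (auto simp: R_def less_max_iff_disj zero_less_iff_neq_zero)
  qed
  obtain c0 where c0: "0 \<le> c0" and ev0: "eventually (\<lambda>n.
      (\<integral>\<^sup>+x\<in>- cell (X n) 0. ennreal (\<bar>F x - F (rep_map (X n) x)\<bar>\<^sup>2) \<partial>\<mu>) \<le> ennreal c0 * (mesh (X n) V)\<^sup>2) sequentially"
    using limsup_divide_finite[OF limsup_F] by blast
  obtain c1 where c1: "0 \<le> c1" and ev1: "eventually (\<lambda>n.
      (\<integral>\<^sup>+x\<in>- cell (X n) 0. (\<integral>\<^sup>+y. ennreal ((V x + V y) * proposal_gap p q (X n) x y) \<partial>lborel)\<^sup>2 \<partial>\<mu>)
        \<le> ennreal c1 * (mesh (X n) V)\<^sup>2) sequentially"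
    using limsup_divide_finite[OF limsup_kernel] by blast
  have ev2: "eventually (\<lambda>n. mesh (X n) V \<le> ennreal \<delta>) sequentially"
    using order_tendstoD(2)[OF mesh, of "ennreal \<delta>"] \<delta> by (auto elim: eventually_mono)
  define M where "M = (2 * cF / \<beta>) / (1 - \<rho>) * (1 + \<beta>)"
  have M: "0 \<le> M"
    using cF \<beta> \<rho> by (simp add: M_def)
  (* A point and its representative contribute V x and at most 2 * V x. *)
  define A where "A = 3 * cF + 3 * (M * D)"
  have A: "0 \<le> A"
    using cF M E.D_nonneg by (simp add: A_def)
  define C where "C = 4 / (1 - \<rho>\<^sup>2) * (A\<^sup>2 + 2 * c0 + 2 * (M\<^sup>2 * c1))"
  have gap0: "0 \<le> 4 / (1 - \<rho>\<^sup>2)"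
    using \<rho> by (simp add: abs_square_le_1)
  have "eventually (\<lambda>n. \<exists>v. is_asymptotic_variance P \<mu> (H n) v \<and> ennreal v \<le> ennreal C * R n) sequentially"
    using ev0 ev1 ev2
  proof eventually_elim
    case (elim n)
    let ?a = "rep_map (X n)"
    note [measurable] = J0(1)[of n] rep_map_measurable[OF X, of n] V_bounded_measurable[OF VG, of n]
    have aV: "V (?a x) \<le> (1 + \<delta>) * V x" for x
      using \<delta> V_pos by (intro rep_map_weight_le X elim) auto
    have aV2: "V (?a x) \<le> 2 * V x" for x
      using aV[of x] mult_right_mono[of "1 + \<delta>" 2 "V x"] \<delta> V_pos[of x] by linarith
    note G_props = scheme_output_poisson[OF X[of n] G[of n]]
    obtain b where b: "\<And>x. \<bar>G n x\<bar> \<le> b"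
      using G_props(2) by blast
    obtain c where c: "\<And>x. G n x - kernel_op P (G n) (?a x) = F (?a x) - c"
      using G_props(4) by blast
    obtain s where s: "\<And>x. \<bar>G n x - s\<bar> \<le> M * V x"
      unfolding M_def using scheme_output_stability[OF \<beta> \<rho> X G aV2 cF(2) contr[OF aV]] by blast
    define e0 e1 where "e0 = (\<lambda>x. F x - F (?a x))" and "e1 = (\<lambda>x. kernel_op P (G n) x - kernel_op P (G n) (?a x))"
    have [measurable]: "kernel_op P (G n) \<in> borel_measurable borel"
      by (rule measurable_kernel_op) measurable
    have meas: "e0 \<in> borel_measurable borel" "e1 \<in> borel_measurable borel"
      unfolding e0_def e1_def by measurable
    have Hc: "H n x - c = e0 x + e1 x" for x
      using c[of x] by (simp add: H_def e0_def e1_def)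
    have e0_le: "\<bar>e0 x\<bar> \<le> 3 * cF * V x" for x
      using cF(2)[of x] cF(2)[of "?a x"] mult_left_mono[OF aV2[of x] cF(1)] unfolding e0_def by linarith
    have e1_le: "\<bar>e1 x\<bar> \<le> 3 * (M * D) * V x" for x
    proof -
      have PG: "kernel_op P (\<lambda>y. G n y - s) x = kernel_op P (G n) x - s" for x
        using kernel_op_diff[OF E.integrable_V_bounded[OF VG] E.integrable_V_bounded[OF E.V_bounded_const], of n s]
        by (simp add: kernel_op_const)
      have "\<bar>kernel_op P (G n) x - s\<bar> \<le> M * D * V x" for x
        unfolding PG[symmetric] by (rule E.kernel_op_V_bound) (use M s in auto)
      from this[of x] this[of "?a x"] mult_left_mono[OF aV2[of x] mult_nonneg_nonneg[OF M E.D_nonneg]]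
      show ?thesis
        unfolding e1_def by linarith
    qed
    let ?I = "\<lambda>x. \<integral>\<^sup>+y. ennreal ((V x + V y) * proposal_gap p q (X n) x y) \<partial>lborel"
    have I [measurable]: "?I \<in> borel_measurable borel"
      unfolding proposal_gap_def move_def[symmetric] by measurable
    have square: "(\<integral>\<^sup>+x. ennreal ((e0 x + e1 x)\<^sup>2) \<partial>\<mu>) \<le> ennreal (A\<^sup>2 + 2 * c0 + 2 * (M\<^sup>2 * c1)) * R n"
      unfolding R_def
    proof (rule discretization_error_square_integral[OF meas J0(1) I])
      show "\<bar>e0 x + e1 x\<bar> \<le> A * V x" for x
        using e0_le[of x] e1_le[of x] by (simp add: A_def distrib_right)
      show "ennreal \<bar>e1 x\<bar> \<le> ennreal M * ?I x" for x
        unfolding e1_def using V_pos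
        by (intro kernel_op_discretization_error[where G="G n" and V=V and b=b and s=s and K=M and X="X n"]
            b s M X G_props(1,3) V_meas less_imp_le)
    qed (use A M c0 c1 elim in \<open>auto simp: e0_def\<close>)
    obtain v where v: "is_asymptotic_variance P \<mu> (H n) v" "v \<le> 4 / (1 - \<rho>\<^sup>2) * (\<integral>x. (H n x - c)\<^sup>2 \<partial>\<mu>)"
      using E.asymptotic_variance_bound[OF VH] by blast
    have "ennreal v \<le> ennreal (4 / (1 - \<rho>\<^sup>2) * (\<integral>x. (H n x - c)\<^sup>2 \<partial>\<mu>))"
      by (rule ennreal_leI[OF v(2)])
    also have "\<dots> = ennreal (4 / (1 - \<rho>\<^sup>2)) * ennreal (\<integral>x. (H n x - c)\<^sup>2 \<partial>\<mu>)"
      using gap0 by (rule ennreal_mult) simp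
    also have "ennreal (\<integral>x. (H n x - c)\<^sup>2 \<partial>\<mu>) = (\<integral>\<^sup>+x. ennreal ((H n x - c)\<^sup>2) \<partial>\<mu>)"
      by (intro nn_integral_eq_integral[symmetric] E.integrable_V_bounded_square V_bounded_diff VH E.V_bounded_const) auto
    also have "\<dots> \<le> ennreal (A\<^sup>2 + 2 * c0 + 2 * (M\<^sup>2 * c1)) * R n"
      unfolding Hc by (rule square)
    finally have "ennreal v \<le> ennreal (4 / (1 - \<rho>\<^sup>2)) * (ennreal (A\<^sup>2 + 2 * c0 + 2 * (M\<^sup>2 * c1)) * R n)"
      by (simp add: mult_left_mono)
    also have "\<dots> = ennreal C * R n"
      unfolding C_def using gap0 c0 c1 by (subst ennreal_mult) (auto simp: mult.assoc)
    finally show ?case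
      using v(1) by blast
  qed
  then have "\<exists>C0::real. C0 > 0 \<and> (\<forall>n. \<exists>v. is_asymptotic_variance P \<mu> (H n) v \<and> ennreal v \<le> ennreal C0 * R n)"
    using E.asymptotic_variance_bound[OF VH] by (intro uniform_constant_of_eventual[OF R_pos]) blast+
  then show ?thesis
    by (simp add: H_def R_def)
qed

end

lemma V_bounded_of_LV:
  assumes V: "\<And>x. 1 \<le> V x" and F: "F \<in> LV V"
  shows "V_bounded V F"
proof -
  obtain c where c: "\<And>x. \<bar>F x\<bar> / V x \<le> c"
    using F by (auto simp: LV_def bdd_above_def)
  have "\<bar>F x\<bar> \<le> \<bar>c\<bar> * V x" for x
  proof -
    have "\<bar>F x\<bar> / V x \<le> \<bar>c\<bar>" "0 < V x"
      using c[of x] V[of x] by linarith+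
    then show ?thesis
      by (simp add: pos_divide_le_eq)
  qed
  then show ?thesis
    using F by (intro V_boundedI[of _ "\<bar>c\<bar>"]) (auto simp: LV_def)
qed

theorem theorem4p1:
  fixes p :: "'a::euclidean_space \<Rightarrow> real"
    and q :: "'a \<Rightarrow> 'a \<Rightarrow> real"
    and V F :: "'a \<Rightarrow> real"
    and X :: "nat \<Rightarrow> 'a allotment"
    and Ftilde :: "nat \<Rightarrow> 'a \<Rightarrow> real"
  assumes p_density: "is_density p"
    and q_density: "\<And>x. is_density (q x)"
    and A1: "drift_assumption (mh_kernel p q) (target p) V"
    and A2: "continuous_on UNIV p" "\<And>x. 0 < p x"
    and A3: "continuous_on UNIV (\<lambda>(x, y). q x y)" "\<And>x y. 0 < q x y"
      "bounded (range (\<lambda>(x, y). q x y))"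
    and F: "F \<in> LV V" "AE x in target p. isCont F x"
    and X: "\<And>n. is_allotment (X n)" "exhaustive X V"
    and Ftilde: "\<And>n. scheme_output (mh_kernel p q) F (X n) (Ftilde n)"
    and limsup_kernel:
      "limsup (\<lambda>n.
         (\<integral>\<^sup>+x\<in>- cell (X n) 0.
            (\<integral>\<^sup>+y. ennreal ((V x + V y) * proposal_gap p q (X n) x y) \<partial>lborel)\<^sup>2 \<partial>target p)
         / (mesh (X n) V)\<^sup>2) < \<infinity>"
    and limsup_F:
      "limsup (\<lambda>n.
         (\<integral>\<^sup>+x\<in>- cell (X n) 0. ennreal (\<bar>F x - F (rep_map (X n) x)\<bar>\<^sup>2) \<partial>target p)
         / (mesh (X n) V)\<^sup>2) < \<infinity>"
  shows "\<exists>C0::real. C0 > 0 \<and> (\<forall>n. \<exists>v.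
      is_asymptotic_variance (mh_kernel p q) (target p)
        (\<lambda>x. F x + kernel_op (mh_kernel p q) (Ftilde n) x - Ftilde n x) v \<and>
      ennreal v \<le> ennreal C0 *
        max (\<integral>\<^sup>+x\<in>cell (X n) 0. ennreal ((V x)\<^sup>2) \<partial>target p) ((mesh (X n) V)\<^sup>2))"
proof -
  obtain B where "\<forall>z\<in>range (\<lambda>(x, y). q x y). norm z \<le> B"
    using A3(3) unfolding bounded_iff by blast
  then have B: "\<bar>q x y\<bar> \<le> B" for x y
    by auto
  have q_le: "q x y \<le> B" for x y
    using B[of x y] by linarith
  obtain lam K C where lam: "0 < lam" "lam < 1" and K: "0 < K"
    and drift: "\<And>x. (\<integral>\<^sup>+y. ennreal (V y) \<partial>mh_kernel p q x) \<le> ennreal (lam * V x + K * indicator C x)"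
    using A1 unfolding drift_assumption_def by blast
  have drift': "(\<integral>\<^sup>+y. ennreal (V y) \<partial>mh_kernel p q x) \<le> ennreal (lam * V x + K)" for x
    using K by (intro order_trans[OF drift ennreal_leI]) (auto simp: indicator_def)
  interpret metropolis_hastings_drift p q B V lam K
    using p_density q_density A1 A2 A3 q_le lam K drift'
    by unfold_locales (auto simp: drift_assumption_def)
  show ?thesis
    using X(2) by (intro scheme_variance_bound V_bounded_of_LV V_ge_1 F(1) X(1) Ftilde limsup_kernel limsup_F)
      (simp add: exhaustive_def)
qed

end
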